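(* Let $\alpha,\beta\ge-1/2$ and $1\le p<\infty$. There exists a constant $C$ such that \[ \|T_{[a,b]}f\|_{\ell^p(\mathbb{N})}\le C\|f\|_{\ell^p(\mathbb{N})} \] for all $f\in\ell^p(\mathbb{N})$ and all intervals $[a,b]\subset[-1,1]$ (with $C$ independent of $f$ and $[a,b]$) if and only if $1<p<\infty$.
   Context: $\mathbb{N}=\{0,1,2,\dots\}$. For $\alpha,\beta>-1$, $d\mu_{\alpha,\beta}(x)=(1-x)^\alpha(1+x)^\beta\,dx$ on $[-1,1]$, and $p_n^{(\alpha,\beta)}$ are the orthonormal Jacobi polynomials, i.e. the classical Jacobi polynomials $P_n^{(\alpha,\beta)}$ divided by their norm in $L^2([-1,1],d\mu_{\alpha,\beta})$. For a sequence $f$, $\mathcal{F}_{\alpha,\beta}f(x)=\sum_{k\ge0}f(k)p_k^{(\alpha,\beta)}(x)$, and $\mathcal{F}^{-1}_{\alpha,\beta}F(n)=\int_{-1}^1F\,p_n^{(\alpha,\beta)}\,d\mu_{\alpha,\beta}$. The interval multiplier is $T_{[a,b]}f=\mathcal{F}^{-1}_{\alpha,\beta}(\chi_{[a,b]}\mathcal{F}_{\alpha,\beta}f)$, which for sequences in $\ell^p(\mathbb{N})$ is given by $T_{[a,b]}f(n)=\sum_{m\ge0}f(m)\int_a^b p_m^{(\alpha,\beta)}p_n^{(\alpha,\beta)}\,d\mu_{\alpha,\beta}$. *)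

theory Defs
  imports "HOL-Analysis.Analysis"
begin

definition jacobi_weight :: "real \<Rightarrow> real \<Rightarrow> real \<Rightarrow> real" where
  "jacobi_weight \<alpha> \<beta> x = (1 - x) powr \<alpha> * (1 + x) powr \<beta>"

definition jacobiP :: "real \<Rightarrow> real \<Rightarrow> nat \<Rightarrow> real \<Rightarrow> real" where
  "jacobiP \<alpha> \<beta> n x =
     (\<Sum>s\<le>n. ((of_nat n + \<alpha>) gchoose (n - s)) * ((of_nat n + \<beta>) gchoose s)
              * ((x - 1) / 2) ^ s * ((x + 1) / 2) ^ (n - s))"

definition jacobi_sqnorm :: "real \<Rightarrow> real \<Rightarrow> nat \<Rightarrow> real" where
  "jacobi_sqnorm \<alpha> \<beta> n =
     (\<integral>x\<in>{-1..1}. (jacobiP \<alpha> \<beta> n x)\<^sup>2 * jacobi_weight \<alpha> \<beta> x \<partial>lborel)"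

definition jacobi_p :: "real \<Rightarrow> real \<Rightarrow> nat \<Rightarrow> real \<Rightarrow> real" where
  "jacobi_p \<alpha> \<beta> n x = jacobiP \<alpha> \<beta> n x / sqrt (jacobi_sqnorm \<alpha> \<beta> n)"

definition interval_mult :: "real \<Rightarrow> real \<Rightarrow> real \<Rightarrow> real \<Rightarrow> (nat \<Rightarrow> real) \<Rightarrow> nat \<Rightarrow> real" where
  "interval_mult \<alpha> \<beta> a b f n =
     (\<Sum>m. f m * (\<integral>x\<in>{a..b}. jacobi_p \<alpha> \<beta> m x * jacobi_p \<alpha> \<beta> n x * jacobi_weight \<alpha> \<beta> x \<partial>lborel))"

definition in_lp :: "real \<Rightarrow> (nat \<Rightarrow> real) \<Rightarrow> bool" where
  "in_lp p f \<longleftrightarrow> summable (\<lambda>n. \<bar>f n\<bar> powr p)"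

definition lp_norm :: "real \<Rightarrow> (nat \<Rightarrow> real) \<Rightarrow> real" where
  "lp_norm p f = (\<Sum>n. \<bar>f n\<bar> powr p) powr (1 / p)"

end

theory Submission
  imports Defs "HOL-Complex_Analysis.Complex_Analysis"
begin

text \<open>
  Put \<open>x = - cos t\<close> and let \<open>u\<^sub>n\<close> be the orthonormal Jacobi polynomial times the square root of the
      transported weight.
  With a companion \<open>v\<^sub>n\<close> (the derivative, normalised by \<open>\<nu>\<^sub>n = sqrt (n (n + \<alpha> + \<beta> + 1))\<close>) the Jacobi
      equation becomes
  \<open>u' = \<phi> u - \<nu> v\<close>, \<open>v' = \<nu> u - \<phi> v\<close> with \<open>\<phi>\<close> decreasing. A modified energy is almost constant where
  \<open>\<bar>\<phi>\<bar> \<le> \<nu>/2\<close>, the energy is easily controlled in the short end pieces, and its mean is fixed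
      by the \<open>L\<^sup>2\<close> normalisation;
  hence \<open>u\<^sub>n\<close> and \<open>v\<^sub>n\<close> are bounded uniformly in \<open>n\<close> and \<open>t\<close>.

  Since \<open>(\<nu>\<^sub>n u\<^sub>m v\<^sub>n - \<nu>\<^sub>m v\<^sub>m u\<^sub>n)' = (\<nu>\<^sub>n\<^sup>2 - \<nu>\<^sub>m\<^sup>2) u\<^sub>m u\<^sub>n\<close>, the matrix of the multiplier is, up to a
      bounded diagonal,
  a sum of discrete Hilbert kernels \<open>1 / (n - m)\<close> and Hankel kernels \<open>1 / (n + m + c)\<close>, multiplied on both
      sides by
  bounded sequences. The discrete Hilbert transform is bounded on \<open>\<ell>\<^sup>p\<close> by M. Riesz's argument:
      for \<open>1 < p \<le> 2\<close> and
  \<open>f \<ge> 0\<close> integrate the \<open>p\<close>-th power of \<open>\<i> (\<Sum>m. f m / (z - m))\<close> along \<open>Im z = 1\<close>; for \<open>p > 2\<close> use duality.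

  For \<open>p = 1\<close> apply the multiplier of \<open>[- cos s, 1]\<close> to the first unit vector. Its \<open>\<ell>\<^sup>1\<close> norm is
  comparable to \<open>\<Sum>n. \<bar>v\<^sub>n s\<bar> / \<nu>\<^sub>n\<close>; integrating over \<open>s\<close> bounds the harmonic series, as the \<open>L\<^sup>1\<close> norms of
  the \<open>v\<^sub>n\<close> are bounded below.
\<close>


section \<open>The discrete Hilbert transform\<close>

text \<open>The coefficient of the analytic term is negative because \<open>cos (p t) < 0\<close>
    for \<open>t\<close> near \<open>pi/2\<close>, which needs \<open>1 < p\<close>.\<close>
lemma riesz_pointwise:
  fixes p :: real
  assumes "1 < p" "p \<le> 2"
  shows "\<exists>A\<ge>0. \<exists>B\<ge>0. \<forall>w::complex. Re w > 0 \<longrightarrow>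
    \<bar>Im w\<bar> powr p \<le> A * Re w powr p - B * Re (w powr of_real p)"
proof -
  \<comment> \<open>Midpoint of \<open>pi/(2*p)\<close> and \<open>pi/2\<close>: for
    \<open>t\<close> between \<open>t0\<close> and \<open>pi/2\<close> the angle
    \<open>p * t\<close> lies between \<open>pi/2\<close> and \<open>pi\<close>, where the cosine is
    negative.\<close>
  define t0 where "t0 = (pi / (2*p) + pi/2) / 2"
  have t0: "pi/(2*p) < t0" "t0 < pi/2" "0 < t0" "pi/2 < p * t0"
  proof -
    have "pi/(2*p) < pi/2" using assms by (simp add: field_simps)
    then show "pi/(2*p) < t0" and "t0 < pi/2" unfolding t0_def
      using field_less_half_sum[of "pi/(2*p)" "pi/2"] field_less_half_sum[of "-(pi/2)" "-(pi/(2*p))"]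
      by (simp_all del: divide_less_cancel)
    moreover have "0 < pi/(2*p)" using assms by simp
    ultimately show "0 < t0" by linarith
    show "pi/2 < p * t0" using \<open>pi/(2*p) < t0\<close> assms by (simp add: field_simps)
  qed
  define d where "d = - cos (p * t0)"
  have pt: "p * t0 \<le> pi" using mult_mono[of p 2 t0 "pi/2"] t0 assms by simp
  have d: "d > 0"
  proof -
    have "cos (p*t0) < cos (pi/2)" using t0 pt by (intro cos_monotone_0_pi) auto
    then show ?thesis unfolding d_def by simp
  qed
  define B where "B = 1/d"
  have c0: "cos t0 > 0" using t0 by (intro cos_gt_zero) auto
  \<comment> \<open>Up to \<open>t0\<close> the first term must beat 1 plus the worst value
    \<open>B\<close> of the second; beyond \<open>t0\<close> the second alone supplies 1, because
    \<open>B * d = 1\<close>.\<close>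
  define A where "A = (1 + B) / cos t0 powr p"
  have B0: "B \<ge> 0" using d by (simp add: B_def)
  have A0: "A \<ge> 0" using B0 by (simp add: A_def)
  \<comment> \<open>Both sides of the claim scale like \<open>norm w powr p\<close>, so it is enough
    to treat \<open>norm w = 1\<close> with argument \<open>t\<close>.\<close>
  have key: "\<bar>sin t\<bar> powr p \<le> A * cos t powr p - B * cos (p * t)" if "\<bar>t\<bar> < pi/2" for t
  proof (cases "\<bar>t\<bar> \<le> t0")
    case True
    have "cos t0 \<le> cos \<bar>t\<bar>" using True t0 by (intro cos_monotone_0_pi_le) auto
    then have "cos t0 powr p \<le> cos t powr p" using c0 assms by (intro powr_mono2) auto
    then have "A * cos t0 powr p \<le> A * cos t powr p" using A0 by (rule mult_left_mono)
    then have 1: "1 + B \<le> A * cos t powr p" unfolding A_def using c0 by simp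
    have "B * cos (p*t) \<le> B * 1" using B0 by (intro mult_left_mono) auto
    moreover have "\<bar>sin t\<bar> powr p \<le> 1" using assms by (simp add: powr_le1)
    ultimately show ?thesis using 1 by linarith
  next
    case False
    have "p * \<bar>t\<bar> \<le> pi" using mult_mono[of p 2 "\<bar>t\<bar>" "pi/2"] that assms by simp
    then have "cos (p * \<bar>t\<bar>) \<le> cos (p * t0)"
      using False assms t0 by (intro cos_monotone_0_pi_le) auto
    moreover have "cos (p * \<bar>t\<bar>) = cos (p * t)" by (cases "t \<ge> 0") auto
    ultimately have "cos (p*t) \<le> - d" unfolding d_def by simp
    then have "B * cos (p * t) \<le> B * - d" using B0 by (rule mult_left_mono)
    then have "B * cos (p*t) \<le> -1" using d by (simp add: B_def)
    moreover have "\<bar>sin t\<bar> powr p \<le> 1" using assms by (simp add: powr_le1)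
    moreover have "A * cos t powr p \<ge> 0" using A0 by simp
    ultimately show ?thesis by linarith
  qed
  show ?thesis
  proof (rule exI[of _ A], rule conjI[OF A0], rule exI[of _ B], rule conjI[OF B0], intro allI impI)
    fix w :: complex assume w: "Re w > 0"
    define r where "r = norm w"
    define t where "t = Arg w"
    have w0: "w \<noteq> 0" using w by auto
    have r: "r > 0" using w0 by (simp add: r_def)
    have t: "\<bar>t\<bar> < pi/2" using w Re_Ln_pos_lt[OF w0] Arg_eq_Im_Ln[OF w0] by (simp add: t_def)
    have re: "Re w = r * cos t" unfolding r_def t_def using rcis_cmod_Arg[of w] by (metis Re_rcis)
    have im: "Im w = r * sin t" unfolding r_def t_def using rcis_cmod_Arg[of w] by (metis Im_rcis)
    have ct: "cos t > 0" using t by (intro cos_gt_zero_pi) auto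
    have "w powr of_real p = exp (of_real p * Ln w)" using w0 by (simp add: powr_def)
    then have "Re (w powr of_real p) = exp (p * ln r) * cos (p * t)"
      using w0 by (simp add: Re_exp r_def t_def Arg_eq_Im_Ln)
    also have "exp (p * ln r) = r powr p" using r by (simp add: powr_def)
    finally have rp: "Re (w powr of_real p) = r powr p * cos (p*t)" .
    have "r powr p * \<bar>sin t\<bar> powr p \<le> r powr p * (A * cos t powr p - B * cos (p * t))"
      using key[OF t] by (intro mult_left_mono) auto
    moreover have "\<bar>Im w\<bar> powr p = r powr p * \<bar>sin t\<bar> powr p"
      using r by (simp add: im abs_mult powr_mult)
    moreover have "Re w powr p = r powr p * cos t powr p" using r ct by (simp add: re powr_mult)
    ultimately show "\<bar>Im w\<bar> powr p \<le> A * Re w powr p - B * Re (w powr of_real p)"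
      by (simp add: rp algebra_simps)
  qed
qed

section \<open>Contour integration of powers of a Cauchy sum\<close>

text \<open>The factor \<open>\<i>\<close> makes the real part a Poisson sum, positive for
  nonnegative nonzero \<open>f\<close>, and the imaginary part the conjugate sum that approximates
  the Hilbert transform.\<close>

definition riesz_F :: "int set \<Rightarrow> (int \<Rightarrow> real) \<Rightarrow> complex \<Rightarrow> complex" where
  "riesz_F I f z = \<i> * (\<Sum>m\<in>I. of_real (f m) / (z - of_int m))"

lemma Re_Im_riesz_term:
  assumes "y > 0"
  shows "Re (\<i> * (of_real a / (Complex x y - of_int m))) = a * y / ((x - of_int m)^2 + y^2)"
   "Im (\<i> * (of_real a / (Complex x y - of_int m))) = a * (x - of_int m) / ((x - of_int m)^2 + y^2)"
  by (simp_all add: Re_divide Im_divide)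

lemma Re_riesz_F: "y > 0 \<Longrightarrow> Re (riesz_F I f (Complex x y)) = (\<Sum>m\<in>I. f m * y / ((x - of_int m)^2 + y^2))"
  unfolding riesz_F_def sum_distrib_left Re_sum by (simp only: Re_Im_riesz_term)

lemma Im_riesz_F: "y > 0 \<Longrightarrow> Im (riesz_F I f (Complex x y)) = (\<Sum>m\<in>I. f m * (x - of_int m) / ((x - of_int m)^2
    + y^2))"
  unfolding riesz_F_def sum_distrib_left Im_sum by (simp only: Re_Im_riesz_term)

text \<open>The values of \<open>riesz_F\<close> lie in the right half-plane, so its power is
  holomorphic for \<open>Im z > 0\<close>. The segment is replaced by the other three sides of a
  rectangle; there \<open>norm z \<ge> R\<close>, each pole is at distance at least
  \<open>R / 2\<close>, and the total length is at most \<open>4 * R\<close>.\<close>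

lemma riesz_line_integral:
  fixes p :: real
  assumes p: "1 < p" "p \<le> 2" and I: "finite I" and f: "\<And>m. m \<in> I \<Longrightarrow> f m \<ge> 0"
    and pos: "\<exists>m\<in>I. f m > 0" and R: "R \<ge> 1" "\<And>m. m \<in> I \<Longrightarrow> 2 * \<bar>of_int m\<bar> \<le> R"
  shows "\<exists>J. ((\<lambda>x. riesz_F I f (Complex x 1) powr of_real p) has_integral J) {-R..R}
           \<and> norm J \<le> 4 * R * (2 * sum f I / R) powr p"
proof -
  let ?S = "{z. Im z > 0}"
  let ?F = "riesz_F I f"
  have nz: "z \<noteq> of_int m" if "z \<in> ?S" for z m using that by auto
  have holF: "?F holomorphic_on ?S" unfolding riesz_F_def
    by (intro holomorphic_intros) (use nz in auto)
  have Fpos: "Re (?F z) > 0" if "z \<in> ?S" for z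
  proof -
    define x y where "x = Re z" and "y = Im z"
    have z: "z = Complex x y" "y > 0" using that by (auto simp: x_def y_def)
    obtain m where m: "m \<in> I" "f m > 0" using pos by auto
    have "(\<Sum>m\<in>I. f m * y / ((x - of_int m)^2 + y^2)) > 0"
      using z by (intro sum_pos2[OF I m(1)]) (auto intro!: divide_pos_pos divide_nonneg_pos mult_pos_pos
          mult_nonneg_nonneg m f add_nonneg_pos)
    then show ?thesis using z Re_riesz_F by simp
  qed
  have hol: "(\<lambda>z. ?F z powr of_real p) holomorphic_on ?S"
    by (intro holomorphic_intros holF) (use Fpos in \<open>force simp: complex_nonpos_Reals_iff\<close>)
  \<comment> \<open>A primitive on the convex half-plane plays the role of Cauchy's theorem: both
    paths give the same difference of values of \<open>g\<close>.\<close>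
  obtain g where g: "\<And>z. z \<in> ?S \<Longrightarrow> (g has_field_derivative ?F z powr of_real p) (at z)"
  using holomorphic_convex_primitive'[OF convex_halfspace_Im_gt open_halfspace_Im_gt hol]
    by (metis at_within_open open_halfspace_Im_gt)
  let ?M = "(2 * sum f I / R) powr p"
  have bnd: "norm (?F z powr of_real p) \<le> ?M" if "norm z \<ge> R" for z
  proof -
    have "norm (?F z) \<le> (\<Sum>m\<in>I. norm (of_real (f m) / (z - of_int m)))"
      unfolding riesz_F_def norm_mult by (simp add: norm_sum)
    also have "\<dots> \<le> (\<Sum>m\<in>I. f m * (2 / R))"
    proof (rule sum_mono)
      fix m assume m: "m \<in> I"
      have "norm (z - of_int m) \<ge> norm z - norm (of_int m :: complex)" by (rule norm_triangle_ineq2)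
      then have "norm (z - of_int m) \<ge> R / 2" using that R(2)[OF m] by simp
      moreover from this have "norm (z - of_int m) > 0" using R(1) by linarith
      ultimately have "f m / norm (z - of_int m) \<le> f m / (R/2)" using f[OF m] R(1)
          by (intro divide_left_mono) auto
      then show "norm (of_real (f m) / (z - of_int m)) \<le> f m * (2 / R)" using f[OF m] by (simp add: norm_divide)
    qed
    also have "\<dots> = 2 * sum f I / R" unfolding sum_distrib_right[symmetric] by simp
    finally show ?thesis using p by (subst norm_powr_real_powr') (auto intro: powr_mono2)
  qed
  have seg: "norm (g b - g a) \<le> ?M * norm (b - a)"
    if "closed_segment a b \<subseteq> {z. Im z > 0 \<and> norm z \<ge> R}" for a b
    by (rule field_differentiable_bound[of "closed_segment a b" g "\<lambda>z. ?F z powr of_real p"])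
       (use that in \<open>auto intro!: has_field_derivative_at_within g bnd\<close>)
  let ?a = "Complex (-R) 1" and ?b = "Complex R 1" and ?c = "Complex R R" and ?d = "Complex (-R) R"
  have s1: "norm (g ?d - g ?a) \<le> ?M * norm (?d - ?a)"
  proof (rule seg, safe)
    fix z assume "z \<in> closed_segment ?a ?d"
    then have "Re z = -R" "Im z \<ge> 1" using R(1)
        by (auto simp: closed_segment_same_Re closed_segment_eq_real_ivl)
    then show "Im z > 0" "norm z \<ge> R" using abs_Re_le_cmod[of z] R by auto
  qed
  have s2: "norm (g ?c - g ?d) \<le> ?M * norm (?c - ?d)"
  proof (rule seg, safe)
    fix z assume "z \<in> closed_segment ?d ?c"
    then have "Im z = R" using R(1) by (auto simp: closed_segment_same_Im)
    then show "Im z > 0" "norm z \<ge> R" using abs_Im_le_cmod[of z] R by auto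
  qed
  have s3: "norm (g ?b - g ?c) \<le> ?M * norm (?b - ?c)"
  proof (rule seg, safe)
    fix z assume "z \<in> closed_segment ?c ?b"
    then have "Re z = R" "Im z \<ge> 1" using R(1)
        by (auto simp: closed_segment_same_Re closed_segment_eq_real_ivl split: if_splits)
    then show "Im z > 0" "norm z \<ge> R" using abs_Re_le_cmod[of z] R by auto
  qed
  have n1: "norm (?d - ?a) \<le> R" "norm (?b - ?c) \<le> R" "norm (?c - ?d) \<le> 2 * R"
    using R(1) by (auto simp: cmod_def real_sqrt_mult)
  have "norm (g ?b - g ?a) \<le> norm (g ?d - g ?a) + norm (g ?c - g ?d) + norm (g ?b - g ?c)"
    using norm_triangle_ineq[of "g ?b - g ?c" "g ?c - g ?d + (g ?d - g ?a)"] norm_triangle_ineq[of "g ?c - g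
        ?d" "g ?d - g ?a"] by simp
  also have "\<dots> \<le> ?M * R + ?M * (2*R) + ?M * R"
    by (intro add_mono order_trans[OF s1] order_trans[OF s2] order_trans[OF s3] mult_left_mono n1) auto
  finally have nb: "norm (g ?b - g ?a) \<le> 4 * R * ?M" by (simp add: algebra_simps)
  have "((\<lambda>x. ?F (Complex x 1) powr of_real p) has_integral (g ?b - g ?a)) {-R..R}"
  proof (rule fundamental_theorem_of_calculus[of "-R" R "\<lambda>x. g (Complex x 1)"])
    fix x assume "x \<in> {-R..R}"
    have "((\<lambda>x. Complex x 1) has_vector_derivative 1) (at x within {-R..R})"
      unfolding Complex_eq by (auto intro!: derivative_eq_intros)
    moreover have "(g has_field_derivative ?F (Complex x 1) powr of_real p) (at (Complex x 1) within range
        (\<lambda>x. Complex x 1))"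
      by (rule has_field_derivative_at_within[OF g]) simp
    ultimately have "((g \<circ> (\<lambda>x. Complex x 1)) has_vector_derivative 1 * (?F (Complex x 1) powr of_real p))
        (at x within {-R..R})"
      by (intro field_vector_diff_chain_within) (auto intro: has_field_derivative_subset)
    then show "((\<lambda>x. g (Complex x 1)) has_vector_derivative ?F (Complex x 1) powr of_real p) (at x within
        {-R..R})"
      by (simp add: o_def)
  qed (use R(1) in auto)
  with nb show ?thesis by blast
qed

section \<open>Young's inequality, the Schur test and comparison of kernels\<close>

text \<open>If \<open>x \<le> e * y\<close> the second term alone dominates, otherwise the first
  does. The weight \<open>e\<close> is chosen small later, to absorb the second term into a
  left-hand side.\<close>

lemma young_scaled:
  fixes x y e p :: real
  assumes "p > 1" "e > 0" "x \<ge> 0" "y \<ge> 0"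
  shows "x * y powr (p - 1) \<le> e powr (1 - p) * x powr p + e * y powr p"
proof (cases "x \<le> e * y")
  case True
  then have "x * y powr (p - 1) \<le> e * y * y powr (p - 1)" by (intro mult_right_mono) auto
  also have "\<dots> = e * y powr p" using assms by (cases "y = 0") (auto simp: powr_mult_base)
  finally show ?thesis using assms by (simp add: add_increasing)
next
  case False
  then have x: "x > 0" "y \<le> x / e" using assms by (auto simp: field_simps intro: le_less_trans[of 0 "e*y"])
  have "x * y powr (p - 1) \<le> x * (x / e) powr (p - 1)"
    using assms x by (intro mult_left_mono powr_mono2) auto
  also have "\<dots> = x * x powr (p - 1) * e powr (1 - p)"
    using assms x by (simp add: powr_divide powr_minus_divide[of e "p - 1", simplified])
  also have "\<dots> = e powr (1 - p) * x powr p" using x by (simp add: powr_mult_base mult.commute)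
  finally show ?thesis using assms by (simp add: add_increasing2)
qed

lemma powr_add_le:
  fixes a b p :: real
  assumes "a \<ge> 0" "b \<ge> 0" "p \<ge> 0"
  shows "(a + b) powr p \<le> 2 powr p * (a powr p + b powr p)"
proof -
  have "(a + b) powr p \<le> (2 * max a b) powr p" using assms by (intro powr_mono2) auto
  also have "\<dots> = 2 powr p * (max a b) powr p" using assms by (simp add: powr_mult)
  also have "\<dots> \<le> 2 powr p * (a powr p + b powr p)" by (intro mult_left_mono) (auto simp: max_def)
  finally show ?thesis .
qed

text \<open>Split one factor off the p-th power and apply Young's inequality termwise. With
  \<open>e = 1 / (2 * A)\<close> the row sums turn the part containing the left-hand side into half
  of it, which is absorbed; the column sums control the rest.\<close>

lemma schur_test:
  fixes p A :: real and k :: "'a \<Rightarrow> 'b \<Rightarrow> real"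
  assumes p: "p > 1" and A: "A > 0" and k: "\<And>n m. k n m \<ge> 0"
    and s1: "\<And>n. n \<in> I \<Longrightarrow> (\<Sum>m\<in>J. k n m) \<le> A" and s2: "\<And>m. m \<in> J \<Longrightarrow> (\<Sum>n\<in>I. k n m) \<le> A"
    and f: "\<And>m. m \<in> J \<Longrightarrow> f m \<ge> 0"
  shows "(\<Sum>n\<in>I. (\<Sum>m\<in>J. k n m * f m) powr p) \<le> (2 * A) powr p * (\<Sum>m\<in>J. f m powr p)"
proof -
  define e where "e = 1 / (2 * A)"
  have e: "e > 0" using A by (auto simp: e_def)
  define w where "w = (\<lambda>n. \<Sum>m\<in>J. k n m * f m)"
  have w: "w n \<ge> 0" for n unfolding w_def using k f by (auto intro!: sum_nonneg)
  have "(\<Sum>n\<in>I. w n powr p) = (\<Sum>n\<in>I. w n * w n powr (p - 1))"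
    using w p by (intro sum.cong refl) (auto simp: powr_mult_base)
  also have "\<dots> = (\<Sum>n\<in>I. \<Sum>m\<in>J. k n m * (f m * w n powr (p - 1)))"
    by (subst (1) w_def) (simp add: sum_distrib_right mult.assoc)
  also have "\<dots> \<le> (\<Sum>n\<in>I. \<Sum>m\<in>J. k n m * (e powr (1 - p) * f m powr p + e * w n powr p))"
    by (intro sum_mono mult_left_mono young_scaled p e f w k)
  also have "\<dots> = (\<Sum>n\<in>I. \<Sum>m\<in>J. k n m * (e powr (1 - p) * f m powr p)) + (\<Sum>n\<in>I. \<Sum>m\<in>J. k n m * (e * w n powr p))"
    by (simp add: distrib_left sum.distrib)
  also have "(\<Sum>n\<in>I. \<Sum>m\<in>J. k n m * (e powr (1 - p) * f m powr p)) = (\<Sum>m\<in>J. (\<Sum>n\<in>I. k n m) * (e powr (1 - p) *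
      f m powr p))"
    by (subst sum.swap) (simp add: sum_distrib_right)
  also have "\<dots> \<le> (\<Sum>m\<in>J. A * (e powr (1 - p) * f m powr p))"
    using s2 by (intro sum_mono mult_right_mono) auto
  also have "\<dots> = A * e powr (1 - p) * (\<Sum>m\<in>J. f m powr p)"
    by (simp add: sum_distrib_left mult.assoc)
  also have "(\<Sum>n\<in>I. \<Sum>m\<in>J. k n m * (e * w n powr p)) = (\<Sum>n\<in>I. (\<Sum>m\<in>J. k n m) * (e * w n powr p))"
    by (simp add: sum_distrib_right)
  also have "\<dots> \<le> (\<Sum>n\<in>I. A * (e * w n powr p))"
    using s1 e by (intro sum_mono mult_right_mono) auto
  also have "\<dots> = (1/2) * (\<Sum>n\<in>I. w n powr p)"
    using A by (simp add: e_def sum_divide_distrib)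
  finally have "(\<Sum>n\<in>I. w n powr p) \<le> 2 * A * e powr (1 - p) * (\<Sum>m\<in>J. f m powr p)" by simp
  also have "2 * A * e powr (1 - p) = (2 * A) * (2 * A) powr (p - 1)"
    using A by (simp add: e_def powr_divide powr_minus_divide[symmetric])
  also have "\<dots> = (2 * A) powr p" using A by (subst powr_mult_base) auto
  finally show ?thesis by (simp add: w_def)
qed

lemma sum_inverse_square_int:
  obtains A :: real where "A > 0" "\<And>(J::int set) n. finite J \<Longrightarrow> (\<Sum>m\<in>J. 1 / ((of_int (n - m))^2 + 1)) \<le> A"
proof -
  let ?g = "\<lambda>n::nat. 1 / ((real n)^2 + 1)"
  have sg: "summable ?g"
  proof (rule summable_comparison_test_ev)
    show "summable (\<lambda>n. inverse (real n ^ 2))" by (rule inverse_power_summable) auto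
    show "\<forall>\<^sub>F n in sequentially. norm (?g n) \<le> inverse (real n ^ 2)"
      using eventually_gt_at_top[of 0] by eventually_elim (auto simp: inverse_eq_divide intro!:
          divide_left_mono mult_pos_pos add_pos_pos)
  qed
  define A where "A = 2 * suminf ?g + 1"
  show thesis
  proof (rule that[of A])
    show "A > 0" unfolding A_def using suminf_nonneg[OF sg] by (simp add: add_nonneg_pos)
    fix J :: "int set" and n :: int assume J: "finite J"
    define K where "K = (\<lambda>m. n - m) ` J"
    have K: "finite K" using J by (simp add: K_def)
    have half: "(\<Sum>j\<in>L. 1 / ((of_int j)^2 + 1)) \<le> suminf ?g"
      \<comment> \<open>Splitting by sign makes \<open>\<bar>j\<bar>\<close> injective, so each half
        is bounded by the full series over the naturals, independently of \<open>J\<close> and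
        \<open>n\<close>.\<close>
      if "finite L" "inj_on (\<lambda>j::int. nat \<bar>j\<bar>) L" for L
    proof -
      have "(\<Sum>j\<in>L. 1 / ((of_int j)^2 + 1)) = (\<Sum>j\<in>L. ?g (nat \<bar>j\<bar>))" by simp
      also have "\<dots> = sum ?g ((\<lambda>j. nat \<bar>j\<bar>) ` L)" using that by (subst sum.reindex) auto
      also have "\<dots> \<le> suminf ?g" using that by (intro sum_le_suminf sg) auto
      finally show ?thesis .
    qed
    have "(\<Sum>m\<in>J. 1 / ((of_int (n - m))^2 + 1::real)) = (\<Sum>j\<in>K. 1 / ((of_int j)^2 + 1))"
      unfolding K_def by (subst sum.reindex) (auto simp: inj_on_def)
    also have "\<dots> = (\<Sum>j\<in>K \<inter> {0..}. 1 / ((of_int j)^2 + 1)) + (\<Sum>j\<in>K \<inter> {..<0}. 1 / ((of_int j)^2 + 1))"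
      using K by (subst sum.union_disjoint[symmetric]) (auto intro!: sum.cong)
    also have "\<dots> \<le> suminf ?g + suminf ?g"
      using K by (intro add_mono half) (auto simp: inj_on_def)
    finally show "(\<Sum>m\<in>J. 1 / ((of_int (n - m))^2 + 1)) \<le> A" by (simp add: A_def)
  qed
qed

text \<open>For \<open>x\<close> in \<open>{n..n + 1}\<close> one has \<open>x - m = j + t\<close>
  with \<open>j = n - m\<close>. Passing from \<open>x\<close> to the integer point costs only a
  summable kernel, to which the Schur test applies.\<close>

lemma hilbert_kernel_compare:
  fixes j :: int and t :: real
  assumes "0 \<le> t" "t \<le> 1"
  shows "1 / ((of_int j + t)^2 + 1) \<le> 3 / ((of_int j)^2 + 1)"
    and "\<bar>(of_int j + t) / ((of_int j + t)^2 + 1) - 1 / of_int j\<bar> \<le> 9 / ((of_int j)^2 + 1)"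
proof -
  define x :: real where "x = of_int j"
  have "0 \<le> (x + 2*t)^2" by simp
  then have "x^2 \<le> 2*(x+t)^2 + 2*t^2" by (simp add: power2_eq_square algebra_simps)
  moreover have "t^2 \<le> 1" using assms by (simp add: power_le_one)
  moreover have "0 \<le> (x+t)^2" by simp
  ultimately have "x^2 + 1 \<le> 3 * ((x+t)^2 + 1)" unfolding distrib_left by linarith
  moreover have pos: "0 < (x+t)^2 + 1" "0 < x^2 + 1" by (auto intro: add_nonneg_pos)
  ultimately have 1: "1 / ((x + t)^2 + 1) \<le> 3 / (x^2 + 1)" by (simp add: divide_simps)
  then show "1 / ((of_int j + t)^2 + 1) \<le> 3 / ((of_int j)^2 + 1)" by (simp add: x_def)
  have "\<bar>(x + t) / ((x + t)^2 + 1) - 1 / x\<bar> \<le> 9 / (x^2 + 1)"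
  proof (cases "j = 0")
    \<comment> \<open>\<open>1 / of_int 0\<close> is 0, so here the difference is the conjugate
      kernel itself.\<close>
    case True
    then have "\<bar>(x + t) / ((x + t)^2 + 1) - 1 / x\<bar> = t / (t^2 + 1)" using assms by (simp add: x_def)
    also have "\<dots> \<le> 1" using assms by (simp add: divide_le_eq_1 add_nonneg_pos) (smt (verit) zero_le_power2)
    finally show ?thesis using True by (simp add: x_def)
  next
    case False
    then have x: "\<bar>x\<bar> \<ge> 1" "x \<noteq> 0" unfolding x_def by linarith+
    have "(x + t) / ((x + t)^2 + 1) - 1 / x = - (t * (x + t) + 1) / (x * ((x+t)^2 + 1))"
      using x pos by (simp add: divide_simps) (simp add: power2_eq_square algebra_simps)
    then have "\<bar>(x + t) / ((x + t)^2 + 1) - 1 / x\<bar> = \<bar>t * (x + t) + 1\<bar> / (\<bar>x\<bar> * ((x+t)^2 + 1))"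
      using pos by (simp only: abs_divide abs_minus_cancel abs_mult abs_of_pos)
    also have "\<dots> \<le> (3 * \<bar>x\<bar>) / (\<bar>x\<bar> * ((x+t)^2 + 1))"
    proof (intro divide_right_mono)
      have "\<bar>t * (x + t)\<bar> \<le> 1 * (\<bar>x\<bar> + 1)" unfolding abs_mult using assms by (intro mult_mono) auto
      moreover have "\<bar>t * (x + t) + 1\<bar> \<le> \<bar>t * (x + t)\<bar> + 1" by (rule order_trans[OF abs_triangle_ineq]) simp
      ultimately have "\<bar>t * (x + t) + 1\<bar> \<le> 1 * (\<bar>x\<bar> + 1) + 1" by (meson add_right_mono order_trans)
      also have "\<dots> \<le> 3 * \<bar>x\<bar>" using x(1) by simp
      finally show "\<bar>t * (x + t) + 1\<bar> \<le> 3 * \<bar>x\<bar>" .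
    qed (use pos in auto)
    also have "\<dots> = 3 * (1 / ((x+t)^2 + 1))" using x by simp
    also have "\<dots> \<le> 3 * (3 / (x^2 + 1))" using 1 by (intro mult_left_mono) auto
    finally show ?thesis by simp
  qed
  then show "\<bar>(of_int j + t) / ((of_int j + t)^2 + 1) - 1 / of_int j\<bar> \<le> 9 / ((of_int j)^2 + 1)"
    by (simp add: x_def)
qed

section \<open>The bound for the discrete Hilbert transform\<close>

lemma integral_unit_pieces:
  fixes g :: "real \<Rightarrow> real"
  assumes "g integrable_on {a..a + real k}"
  shows "(\<Sum>i<k. integral {a + real i..a + real i + 1} g) = integral {a..a + real k} g"
  using assms
proof (induction k)
  case (Suc k)
  have "g integrable_on {a..a + real k}" by (rule integrable_on_subinterval[OF Suc.prems]) auto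
  moreover have "integral {a..a + real k} g + integral {a + real k..a + real (Suc k)} g = integral {a..a +
      real (Suc k)} g"
    using Suc.prems by (intro Henstock_Kurzweil_Integration.integral_combine) auto
  ultimately show ?case using Suc.IH by (simp add: add_ac)
qed auto

text \<open>The diagonal term \<open>m = n\<close> vanishes because division by zero yields zero.\<close>
definition hilb :: "int set \<Rightarrow> (int \<Rightarrow> real) \<Rightarrow> int \<Rightarrow> real" where
  "hilb I f n = (\<Sum>m\<in>I. f m / of_int (n - m))"

text \<open>Riesz's pointwise inequality is integrated at height 1 over the unit cells of the
  window. The Poisson part gives the first term by the Schur test; the analytic power, estimated
  along the contour, gives the second.\<close>

lemma hilb_window:
  fixes p :: real
  assumes p: "1 < p" "p \<le> 2"
  obtains K B :: real where "K \<ge> 0" "B \<ge> 0"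
   "\<And>I f N. finite I \<Longrightarrow> (\<And>m. m \<in> I \<Longrightarrow> f m \<ge> 0) \<Longrightarrow> \<exists>m\<in>I. f m > 0 \<Longrightarrow> N \<ge> 1 \<Longrightarrow>
      (\<And>m. m \<in> I \<Longrightarrow> 2 * \<bar>m\<bar> \<le> int N) \<Longrightarrow>
      (\<Sum>n\<in>{-int N..<int N}. \<bar>hilb I f n\<bar> powr p) \<le> K * (\<Sum>m\<in>I. f m powr p) + B * (real N * (2 * sum f I /
          real N) powr p)"
proof -
  obtain A B where AB: "A \<ge> 0" "B \<ge> 0"
    "\<And>w::complex. Re w > 0 \<Longrightarrow> \<bar>Im w\<bar> powr p \<le> A * Re w powr p - B * Re (w powr of_real p)"
    using riesz_pointwise[OF p] by blast
  obtain D :: real where D: "D > 0" "\<And>(J::int set) n. finite J \<Longrightarrow> (\<Sum>m\<in>J. 1 / ((of_int (n - m))^2 + 1)) \<le> D"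
    by (rule sum_inverse_square_int) auto
  define E where "E = (2 * D) powr p"
  have E: "E \<ge> 0" by (simp add: E_def)
  \<comment> \<open>\<open>2 powr p\<close> comes from splitting the power of a sum, 3 and 9 from
    \<open>hilbert_kernel_compare\<close>.\<close>
  define K1 where "K1 = 2 powr p * (A * 3 powr p + 9 powr p)"
  define B1 where "B1 = 2 powr p * B"
  have K1: "K1 \<ge> 0" "B1 \<ge> 0" using AB by (auto simp: K1_def B1_def)
  show thesis
  proof (rule that[of "K1 * E" "4 * B1"])
    show "K1 * E \<ge> 0" "4 * B1 \<ge> 0" using K1 E by auto
    fix I :: "int set" and f :: "int \<Rightarrow> real" and N :: nat
    assume I: "finite I" and f: "\<And>m. m \<in> I \<Longrightarrow> f m \<ge> 0" and pos: "\<exists>m\<in>I. f m > 0" and N: "N \<ge> 1"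
       "\<And>m. m \<in> I \<Longrightarrow> 2 * \<bar>m\<bar> \<le> int N"
    define G where "G = (\<lambda>x. riesz_F I f (Complex x 1) powr of_real p)"
    define S where "S = (\<lambda>n::int. \<Sum>m\<in>I. (1 / ((of_int (n - m))^2 + 1)) * f m)"
    have S0: "S n \<ge> 0" for n unfolding S_def using f by (auto intro!: sum_nonneg mult_nonneg_nonneg)
    have N': "2 * \<bar>real_of_int m\<bar> \<le> real N" if "m \<in> I" for m using N(2)[OF that] by linarith
    obtain Q where Q: "(G has_integral Q) {-real N..real N}" "norm Q \<le> 4 * real N * (2 * sum f I / real N)
        powr p"
      using riesz_line_integral[OF p I f pos, of "real N"] N(1) N' unfolding G_def by auto
    have ReG: "((\<lambda>x. Re (G x)) has_integral Re Q) {-real N..real N}" using Q(1) by (rule has_integral_Re)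
    \<comment> \<open>\<open>S n\<close> controls the real part as well as the error of replacing
      \<open>x\<close> by \<open>n\<close>; only the analytic term still depends on
      \<open>x\<close>.\<close>
    have pw: "\<bar>hilb I f n\<bar> powr p \<le> K1 * S n powr p - B1 * Re (G x)" if x: "of_int n \<le> x" "x \<le> of_int n + 1"
        for n x
    proof -
      define t where "t = x - of_int n"
      have t: "0 \<le> t" "t \<le> 1" using x by (auto simp: t_def)
      let ?w = "riesz_F I f (Complex x 1)"
      have xm: "x - of_int m = of_int (n - m) + t" for m by (simp add: t_def)
      have Re: "Re ?w = (\<Sum>m\<in>I. f m * (1 / ((of_int (n - m) + t)^2 + 1)))" by (simp add: Re_riesz_F xm)
      have Im: "Im ?w = (\<Sum>m\<in>I. f m * ((of_int (n - m) + t) / ((of_int (n - m) + t)^2 + 1)))"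
          by (simp add: Im_riesz_F xm)
      have Repos: "Re ?w > 0"
      proof -
        obtain m where m: "m \<in> I" "f m > 0" using pos by auto
        show ?thesis unfolding Re
          by (intro sum_pos2[OF I m(1)]) (auto intro!: divide_pos_pos divide_nonneg_pos mult_pos_pos
              mult_nonneg_nonneg m f add_nonneg_pos)
      qed
      have "Re ?w \<le> 3 * S n" unfolding Re S_def sum_distrib_left
      proof (intro sum_mono)
        fix m assume "m \<in> I"
        from mult_left_mono[OF hilbert_kernel_compare(1)[OF t, of "n - m"] f[OF this]]
        show "f m * (1 / ((of_int (n - m) + t)^2 + 1)) \<le> 3 * (1 / ((of_int (n - m))^2 + 1) * f m)"
            by (simp add: mult.commute)
      qed
      then have "Re ?w powr p \<le> (3 * S n) powr p" using Repos p by (intro powr_mono2) auto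
      then have 1: "Re ?w powr p \<le> 3 powr p * S n powr p" using S0 by (simp add: powr_mult)
      have "\<bar>Im ?w - hilb I f n\<bar> = \<bar>\<Sum>m\<in>I. f m * ((of_int (n - m) + t) / ((of_int (n - m) + t)^2 + 1) - 1 /
          of_int (n - m))\<bar>"
        unfolding Im hilb_def by (simp add: sum_subtractf right_diff_distrib)
      also have "\<dots> \<le> (\<Sum>m\<in>I. f m * (9 / ((of_int (n - m))^2 + 1)))"
        using hilbert_kernel_compare(2)[OF t] f
        by (intro order_trans[OF sum_abs] sum_mono) (auto simp only: abs_mult abs_of_nonneg intro!:
            mult_left_mono)
      also have "\<dots> = 9 * S n" unfolding S_def sum_distrib_left by (simp add: mult_ac)
      finally have "\<bar>hilb I f n\<bar> \<le> \<bar>Im ?w\<bar> + 9 * S n" by linarith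
      then have "\<bar>hilb I f n\<bar> powr p \<le> (\<bar>Im ?w\<bar> + 9 * S n) powr p" using p by (intro powr_mono2) auto
      also have "\<dots> \<le> 2 powr p * (\<bar>Im ?w\<bar> powr p + (9 * S n) powr p)" using S0 p by (intro powr_add_le) auto
      also have "\<dots> \<le> 2 powr p * ((A * (3 powr p * S n powr p) - B * Re (G x)) + 9 powr p * S n powr p)"
      proof (intro mult_left_mono add_mono)
        have "\<bar>Im ?w\<bar> powr p \<le> A * Re ?w powr p - B * Re (G x)" unfolding G_def by (rule AB(3)[OF Repos])
        also have "\<dots> \<le> A * (3 powr p * S n powr p) - B * Re (G x)" using mult_left_mono[OF 1 AB(1)] by simp
        finally show "\<bar>Im ?w\<bar> powr p \<le> A * (3 powr p * S n powr p) - B * Re (G x)" .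
        show "(9 * S n) powr p \<le> 9 powr p * S n powr p" using S0 by (simp add: powr_mult)
      qed auto
      also have "\<dots> = K1 * S n powr p - B1 * Re (G x)" by (simp add: K1_def B1_def algebra_simps)
      finally show ?thesis .
    qed
    define P where "P = (\<lambda>n::int. integral {real_of_int n..real_of_int n + 1} (\<lambda>x. Re (G x)))"
    \<comment> \<open>The other terms are constant on a cell of length 1, so integration changes
      only the analytic term.\<close>
    have step: "\<bar>hilb I f n\<bar> powr p \<le> K1 * S n powr p - B1 * P n" if n: "n \<in> {-int N..<int N}" for n
    proof -
      have "(\<lambda>x. Re (G x)) integrable_on {of_int n..of_int n + 1}"
        by (rule integrable_on_subinterval[OF has_integral_integrable[OF ReG]]) (use n in \<open>auto; linarith\<close>)
      then have 2: "((\<lambda>x. K1 * S n powr p - B1 * Re (G x)) has_integral K1 * S n powr p * 1 - B1 * P n)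
          {real_of_int n..real_of_int n + 1}"
        unfolding P_def
        by (intro has_integral_diff has_integral_mult_right integrable_integral)
           (use has_integral_const_real[of "K1 * S n powr p" "real_of_int n" "real_of_int n + 1"] in auto)
      have 1: "((\<lambda>x. \<bar>hilb I f n\<bar> powr p) has_integral \<bar>hilb I f n\<bar> powr p) {real_of_int n..real_of_int n + 1}"
        using has_integral_const_real[of "\<bar>hilb I f n\<bar> powr p" "real_of_int n" "real_of_int n + 1"] by simp
      have "\<bar>hilb I f n\<bar> powr p \<le> K1 * S n powr p * 1 - B1 * P n"
        by (rule has_integral_le[OF 1 2], rule pw) simp_all
      then show ?thesis by simp
    qed
    have "(\<Sum>n\<in>{-int N..<int N}. P n) = (\<Sum>i<2*N. P (int i - int N))"
      by (rule sum.reindex_bij_witness[of _ "\<lambda>i. int i - int N" "\<lambda>n. nat (n + int N)"]) auto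
    also have "\<dots> = (\<Sum>i<2*N. integral {-real N + real i..-real N + real i + 1} (\<lambda>x. Re (G x)))"
      by (simp add: P_def add_ac)
    also have "\<dots> = integral {-real N..-real N + real (2*N)} (\<lambda>x. Re (G x))"
      using ReG by (intro integral_unit_pieces) auto
    also have "\<dots> = Re Q" using ReG by (simp add: integral_unique)
    finally have sP: "(\<Sum>n\<in>{-int N..<int N}. P n) = Re Q" .
    have "- Re Q \<le> norm Q" using abs_Re_le_cmod[of Q] by linarith
    then have "- Re Q \<le> 4 * real N * (2 * sum f I / real N) powr p" using Q(2) by linarith
    then have Qb: "B1 * - Re Q \<le> B1 * (4 * real N * (2 * sum f I / real N) powr p)" using K1(2)
        by (rule mult_left_mono)
    have "(\<Sum>n\<in>{-int N..<int N}. \<bar>hilb I f n\<bar> powr p) \<le> (\<Sum>n\<in>{-int N..<int N}. K1 * S n powr p - B1 * P n)"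
      by (intro sum_mono step)
    also have "\<dots> = K1 * (\<Sum>n\<in>{-int N..<int N}. S n powr p) - B1 * Re Q"
      by (simp add: sum_subtractf sum_distrib_left[symmetric] sP)
    also have "\<dots> \<le> K1 * (E * (\<Sum>m\<in>I. f m powr p)) + B1 * (4 * real N * (2 * sum f I / real N) powr p)"
    proof -
      have "(\<Sum>n\<in>{-int N..<int N}. S n powr p) \<le> E * (\<Sum>m\<in>I. f m powr p)" unfolding S_def E_def
      proof (rule schur_test[OF p(1) D(1)])
        fix m show "(\<Sum>n\<in>{-int N..<int N}. 1 / ((real_of_int (n - m))\<^sup>2 + 1)) \<le> D"
          using D(2)[of "{-int N..<int N}" m] by (simp add: power2_commute)
      qed (use I f D(2) in auto)
      from mult_left_mono[OF this K1(1)] show ?thesis using Qb by linarith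
    qed
    finally show "(\<Sum>n\<in>{-int N..<int N}. \<bar>hilb I f n\<bar> powr p) \<le> K1 * E * (\<Sum>m\<in>I. f m powr p) + 4 * B1 * (real
        N * (2 * sum f I / real N) powr p)"
      by (simp add: mult_ac)
  qed
qed

text \<open>For fixed \<open>I\<close> the contour term of \<open>hilb_window\<close> is a multiple
  of \<open>N powr (1 - p)\<close>, which tends to 0 because \<open>p > 1\<close>. The zero sequence
  is treated apart, since Riesz's inequality requires a positive real part.\<close>

lemma hilb_bounded_nonneg:
  fixes p :: real
  assumes p: "1 < p" "p \<le> 2"
  shows "\<exists>K\<ge>0. \<forall>I f. finite I \<and> (\<forall>m\<in>I. f m \<ge> 0) \<longrightarrow> (\<Sum>n\<in>I. \<bar>hilb I f n\<bar> powr p) \<le> K * (\<Sum>m\<in>I. f m powr p)"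
proof -
  obtain K B where K: "K \<ge> 0" and B: "B \<ge> 0" and win:
   "\<And>I f N. finite I \<Longrightarrow> (\<And>m. m \<in> I \<Longrightarrow> f m \<ge> 0) \<Longrightarrow> \<exists>m\<in>I. f m > 0 \<Longrightarrow> N \<ge> 1 \<Longrightarrow>
      (\<And>m. m \<in> I \<Longrightarrow> 2 * \<bar>m\<bar> \<le> int N) \<Longrightarrow>
      (\<Sum>n\<in>{-int N..<int N}. \<bar>hilb I f n\<bar> powr p) \<le> K * (\<Sum>m\<in>I. f m powr p) + B * (real N * (2 * sum f I /
          real N) powr p)"
    using hilb_window[OF p] by blast
  have "(\<Sum>n\<in>I. \<bar>hilb I f n\<bar> powr p) \<le> K * (\<Sum>m\<in>I. f m powr p)"
    if I: "finite I" and f: "\<And>m. m \<in> I \<Longrightarrow> f m \<ge> 0" for I f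
  proof (cases "\<exists>m\<in>I. f m > 0")
    case False
    then have "f m = 0" if "m \<in> I" for m using f[OF that] that by force
    then have "hilb I f n = 0" for n by (simp add: hilb_def)
    then show ?thesis using K by (auto intro!: mult_nonneg_nonneg sum_nonneg)
  next
    case True
    define S where "S = 2 * sum f I"
    have S: "S \<ge> 0" using f by (simp add: S_def sum_nonneg)
    define L where "L = (\<Sum>m\<in>I. 2 * nat \<bar>m\<bar>) + 1"
    have L: "2 * \<bar>m\<bar> < int L" if "m \<in> I" for m
    proof -
      have "2 * nat \<bar>m\<bar> \<le> (\<Sum>m\<in>I. 2 * nat \<bar>m\<bar>)" using I that by (intro member_le_sum) auto
      then show ?thesis unfolding L_def by linarith
    qed
    have "((\<lambda>x. x powr (1 - p)) \<longlongrightarrow> 0) at_top" using p by (intro tendsto_neg_powr filterlim_ident) auto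
    then have "(\<lambda>N. (real N) powr (1 - p)) \<longlonglongrightarrow> 0" by (rule filterlim_compose[OF _ filterlim_real_sequentially])
    then have "(\<lambda>N. K * (\<Sum>m\<in>I. f m powr p) + B * (S powr p * (real N) powr (1 - p))) \<longlonglongrightarrow> K * (\<Sum>m\<in>I. f m powr
        p) + B * (S powr p * 0)"
      by (intro tendsto_intros)
    moreover have "\<forall>\<^sub>F N in sequentially. (\<Sum>n\<in>I. \<bar>hilb I f n\<bar> powr p) \<le> K * (\<Sum>m\<in>I. f m powr p) + B * (S powr
        p * (real N) powr (1 - p))"
      using eventually_ge_at_top[of L]
    proof eventually_elim
      case (elim N)
      have N: "2 * \<bar>m\<bar> < int N" if "m \<in> I" for m using L[OF that] elim by linarith
      have "(\<Sum>n\<in>I. \<bar>hilb I f n\<bar> powr p) \<le> (\<Sum>n\<in>{-int N..<int N}. \<bar>hilb I f n\<bar> powr p)"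
      proof (rule sum_mono2)
        show "I \<subseteq> {- int N..<int N}" using N by force
      qed auto
      also have "\<dots> \<le> K * (\<Sum>m\<in>I. f m powr p) + B * (real N * (2 * sum f I / real N) powr p)"
      proof (rule win[OF I f True])
        show "N \<ge> 1" using elim by (simp add: L_def)
      qed (use N in force)+
      also have "real N * (2 * sum f I / real N) powr p = S powr p * (real N) powr (1 - p)"
        using S elim by (simp add: S_def[symmetric] powr_divide powr_diff L_def)
      finally show ?case .
    qed
    ultimately have "(\<Sum>n\<in>I. \<bar>hilb I f n\<bar> powr p) \<le> K * (\<Sum>m\<in>I. f m powr p) + B * (S powr p * 0)"
      by (rule tendsto_lowerbound) simp
    then show ?thesis by simp
  qed
  with K show ?thesis by blast
qed

text \<open>Real sequences are split into positive and negative parts, each of which is covered by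
  the nonnegative case.\<close>

lemma hilb_bounded_le2:
  fixes p :: real
  assumes p: "1 < p" "p \<le> 2"
  shows "\<exists>K\<ge>0. \<forall>I f. finite I \<longrightarrow> (\<Sum>n\<in>I. \<bar>hilb I f n\<bar> powr p) \<le> K * (\<Sum>m\<in>I. \<bar>f m\<bar> powr p)"
proof -
  obtain K where K: "K \<ge> 0" and b: "\<And>I f. finite I \<Longrightarrow> (\<forall>m\<in>I. f m \<ge> 0) \<Longrightarrow> (\<Sum>n\<in>I. \<bar>hilb I f n\<bar> powr p) \<le> K *
      (\<Sum>m\<in>I. f m powr p)"
    using hilb_bounded_nonneg[OF p] by blast
  show ?thesis
  proof (rule exI[of _ "2 powr p * (2 * K)"], intro conjI allI impI)
    fix I :: "int set" and f :: "int \<Rightarrow> real" assume I: "finite I"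
    define g h where "g = (\<lambda>m. max (f m) 0)" and "h = (\<lambda>m. max (- f m) 0)"
    have fgh: "f = (\<lambda>m. g m - h m)" by (auto simp: g_def h_def)
    have g: "(\<Sum>n\<in>I. \<bar>hilb I g n\<bar> powr p) \<le> K * (\<Sum>m\<in>I. \<bar>f m\<bar> powr p)"
      using p by (intro order_trans[OF b[OF I]] mult_left_mono K sum_mono powr_mono2) (auto simp: g_def)
    have h: "(\<Sum>n\<in>I. \<bar>hilb I h n\<bar> powr p) \<le> K * (\<Sum>m\<in>I. \<bar>f m\<bar> powr p)"
      using p by (intro order_trans[OF b[OF I]] mult_left_mono K sum_mono powr_mono2) (auto simp: h_def)
    have "\<bar>hilb I f n\<bar> powr p \<le> 2 powr p * (\<bar>hilb I g n\<bar> powr p + \<bar>hilb I h n\<bar> powr p)" for n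
    proof -
      have "hilb I f n = hilb I g n - hilb I h n"
        by (simp add: hilb_def fgh diff_divide_distrib sum_subtractf)
      then have "\<bar>hilb I f n\<bar> powr p \<le> (\<bar>hilb I g n\<bar> + \<bar>hilb I h n\<bar>) powr p" using p by (intro powr_mono2) auto
      also have "\<dots> \<le> 2 powr p * (\<bar>hilb I g n\<bar> powr p + \<bar>hilb I h n\<bar> powr p)" using p by (intro powr_add_le) auto
      finally show ?thesis .
    qed
    then have "(\<Sum>n\<in>I. \<bar>hilb I f n\<bar> powr p) \<le> (\<Sum>n\<in>I. 2 powr p * (\<bar>hilb I g n\<bar> powr p + \<bar>hilb I h n\<bar> powr p))"
      by (rule sum_mono)
    also have "\<dots> = 2 powr p * ((\<Sum>n\<in>I. \<bar>hilb I g n\<bar> powr p) + (\<Sum>n\<in>I. \<bar>hilb I h n\<bar> powr p))"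
      by (simp only: sum_distrib_left[symmetric] sum.distrib)
    also have "\<dots> \<le> 2 powr p * (K * (\<Sum>m\<in>I. \<bar>f m\<bar> powr p) + K * (\<Sum>m\<in>I. \<bar>f m\<bar> powr p))"
      by (intro mult_left_mono add_mono g h) auto
    finally show "(\<Sum>n\<in>I. \<bar>hilb I f n\<bar> powr p) \<le> 2 powr p * (2 * K) * (\<Sum>m\<in>I. \<bar>f m\<bar> powr p)"
        by (simp add: mult_ac)
  qed (use K in auto)
qed

text \<open>For \<open>p > 2\<close> the conjugate exponent \<open>q\<close> lies below 2. The
  kernel is antisymmetric, so the transform can be moved onto a test sequence; Young's inequality
  with absorption takes the place of dual norms.\<close>

lemma hilb_bounded:
  fixes p :: real
  assumes p: "1 < p"
  shows "\<exists>K\<ge>0. \<forall>I f. finite I \<longrightarrow> (\<Sum>n\<in>I. \<bar>hilb I f n\<bar> powr p) \<le> K * (\<Sum>m\<in>I. \<bar>f m\<bar> powr p)"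
proof (cases "p \<le> 2")
  case True
  then show ?thesis by (rule hilb_bounded_le2[OF p])
next
  case False
  define q where "q = p / (p - 1)"
  have q: "1 < q" "q \<le> 2" using False by (auto simp: q_def field_simps)
  have pq: "(p - 1) * q = p" using p by (simp add: q_def)
  obtain K where K: "K \<ge> 0" and b: "\<And>I f. finite I \<Longrightarrow> (\<Sum>n\<in>I. \<bar>hilb I f n\<bar> powr q) \<le> K * (\<Sum>m\<in>I. \<bar>f m\<bar> powr q)"
    using hilb_bounded_le2[OF q] by blast
  \<comment> \<open>Small enough for half of the left-hand side to absorb the last term;
    \<open>K + 1\<close> keeps the denominator positive when \<open>K = 0\<close>.\<close>
  define e where "e = 1 / (2 * (K + 1))"
  have e: "e > 0" "e * K \<le> 1/2" using K by (auto simp: e_def field_simps)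
  show ?thesis
  proof (rule exI[of _ "2 * e powr (1 - p)"], intro conjI allI impI)
    fix I :: "int set" and f :: "int \<Rightarrow> real" assume I: "finite I"
    define w where "w = hilb I f"
    \<comment> \<open>The extremal sequence of Hoelder's inequality: \<open>w n * g n\<close> and
      \<open>\<bar>g n\<bar> powr q\<close> both equal
      \<open>\<bar>w n\<bar> powr p\<close>.\<close>
    define g where "g = (\<lambda>n. sgn (w n) * \<bar>w n\<bar> powr (p - 1))"
    define h where "h = hilb I g"
    have wg: "w n * g n = \<bar>w n\<bar> powr p" for n
    proof -
      have "w n * g n = \<bar>w n\<bar> * \<bar>w n\<bar> powr (p - 1)" by (simp add: g_def abs_sgn)
      then show ?thesis by (simp add: powr_mult_base)
    qed
    have gq: "\<bar>g n\<bar> powr q = \<bar>w n\<bar> powr p" for n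
      by (cases "w n = 0") (auto simp: g_def abs_mult abs_sgn_eq powr_powr pq)
    have "(\<Sum>n\<in>I. \<bar>w n\<bar> powr p) = (\<Sum>n\<in>I. w n * g n)" by (simp add: wg)
    also have "\<dots> = (\<Sum>n\<in>I. \<Sum>m\<in>I. f m / of_int (n - m) * g n)" by (simp add: w_def hilb_def sum_distrib_right)
    also have "\<dots> = (\<Sum>m\<in>I. \<Sum>n\<in>I. f m / of_int (n - m) * g n)" by (rule sum.swap)
    also have "\<dots> = (\<Sum>m\<in>I. - (f m * h m))"
    proof (intro sum.cong refl)
      fix m
      have "f m / of_int (n - m) * g n = - (f m * (g n / of_int (m - n)))" for n
        by (cases "n = m") (auto simp: field_simps)
      then show "(\<Sum>n\<in>I. f m / of_int (n - m) * g n) = - (f m * h m)"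
        by (simp only: h_def hilb_def sum_distrib_left sum_negf)
    qed
    also have "\<dots> \<le> (\<Sum>m\<in>I. e powr (1 - p) * \<bar>f m\<bar> powr p + e * \<bar>h m\<bar> powr q)"
    proof (intro sum_mono)
      fix m
      have "- (f m * h m) \<le> \<bar>f m\<bar> * \<bar>h m\<bar>" using abs_ge_minus_self[of "f m * h m"] by (simp add: abs_mult)
      \<comment> \<open>Written as a power with exponent \<open>p - 1\<close> to fit
        \<open>young_scaled\<close>; the p-th power of the base is then
        \<open>\<bar>h m\<bar> powr q\<close>.\<close>
      also have "\<dots> = \<bar>f m\<bar> * (\<bar>h m\<bar> powr (1 / (p - 1))) powr (p - 1)"
        using p by (simp add: powr_powr)
      also have "\<dots> \<le> e powr (1 - p) * \<bar>f m\<bar> powr p + e * (\<bar>h m\<bar> powr (1 / (p - 1))) powr p"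
        using e p by (intro young_scaled) auto
      finally show "- (f m * h m) \<le> e powr (1 - p) * \<bar>f m\<bar> powr p + e * \<bar>h m\<bar> powr q"
        by (simp add: powr_powr q_def)
    qed
    also have "\<dots> = e powr (1 - p) * (\<Sum>m\<in>I. \<bar>f m\<bar> powr p) + e * (\<Sum>m\<in>I. \<bar>h m\<bar> powr q)"
      by (simp add: sum.distrib sum_distrib_left)
    also have "\<dots> \<le> e powr (1 - p) * (\<Sum>m\<in>I. \<bar>f m\<bar> powr p) + e * (K * (\<Sum>m\<in>I. \<bar>g m\<bar> powr q))"
      unfolding h_def using e by (intro add_left_mono mult_left_mono b I) auto
    also have "e * (K * (\<Sum>m\<in>I. \<bar>g m\<bar> powr q)) = (e * K) * (\<Sum>n\<in>I. \<bar>w n\<bar> powr p)" by (simp add: gq)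
    also have "\<dots> \<le> (1/2) * (\<Sum>n\<in>I. \<bar>w n\<bar> powr p)" using e by (intro mult_right_mono sum_nonneg) auto
    finally show "(\<Sum>n\<in>I. \<bar>hilb I f n\<bar> powr p) \<le> 2 * e powr (1 - p) * (\<Sum>m\<in>I. \<bar>f m\<bar> powr p)"
      by (simp add: w_def)
  qed auto
qed

section \<open>Matrices acting on sequence spaces\<close>

text \<open>Square sections and arbitrary \<open>f\<close> keep convergence out of the algebra of
  kernels. \<open>B\<close> bounds p-th powers, so the operator norm it yields is
  \<open>B powr (1/p)\<close>.\<close>

definition lp_kernel :: "real \<Rightarrow> real \<Rightarrow> (nat \<Rightarrow> nat \<Rightarrow> real) \<Rightarrow> bool" where
  "lp_kernel p B k \<longleftrightarrow> B \<ge> 0 \<and> (\<forall>M f. (\<Sum>n<M. \<bar>\<Sum>m<M. k n m * f m\<bar> powr p) \<le> B * (\<Sum>m<M. \<bar>f m\<bar> powr p))"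

lemma lp_kernelD: "lp_kernel p B k \<Longrightarrow> (\<Sum>n<M. \<bar>\<Sum>m<M. k n m * f m\<bar> powr p) \<le> B * (\<Sum>m<M. \<bar>f m\<bar> powr p)"
  by (simp add: lp_kernel_def)

lemma lp_kernel_mult:
  assumes k: "lp_kernel p B k" and p: "p \<ge> 0" and a: "\<And>n. \<bar>a n\<bar> \<le> A" and b: "\<And>m. \<bar>b m\<bar> \<le> A'"
  shows "lp_kernel p (A powr p * B * A' powr p) (\<lambda>n m. a n * k n m * b m)"
  unfolding lp_kernel_def
proof (intro conjI allI)
  have B: "B \<ge> 0" using k by (simp add: lp_kernel_def)
  then show "0 \<le> A powr p * B * A' powr p" by simp
  fix M f
  have "(\<Sum>n<M. \<bar>\<Sum>m<M. a n * k n m * b m * f m\<bar> powr p) = (\<Sum>n<M. \<bar>a n\<bar> powr p * \<bar>\<Sum>m<M. k n m * (b m * f m)\<bar>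
      powr p)"
  proof (intro sum.cong refl)
    fix n
    have "(\<Sum>m<M. a n * k n m * b m * f m) = a n * (\<Sum>m<M. k n m * (b m * f m))"
        by (simp add: sum_distrib_left mult.assoc)
    then show "\<bar>\<Sum>m<M. a n * k n m * b m * f m\<bar> powr p = \<bar>a n\<bar> powr p * \<bar>\<Sum>m<M. k n m * (b m * f m)\<bar> powr p"
      by (simp add: abs_mult powr_mult)
  qed
  also have "\<dots> \<le> (\<Sum>n<M. A powr p * \<bar>\<Sum>m<M. k n m * (b m * f m)\<bar> powr p)"
    using a p by (intro sum_mono mult_right_mono powr_mono2) auto
  also have "\<dots> = A powr p * (\<Sum>n<M. \<bar>\<Sum>m<M. k n m * (b m * f m)\<bar> powr p)" by (simp add: sum_distrib_left)
  also have "\<dots> \<le> A powr p * (B * (\<Sum>m<M. \<bar>b m * f m\<bar> powr p))"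
    by (intro mult_left_mono lp_kernelD[OF k]) auto
  also have "\<dots> \<le> A powr p * (B * (\<Sum>m<M. A' powr p * \<bar>f m\<bar> powr p))"
  proof (intro mult_left_mono sum_mono B)
    fix m show "\<bar>b m * f m\<bar> powr p \<le> A' powr p * \<bar>f m\<bar> powr p"
      using b[of m] p by (auto simp: abs_mult powr_mult intro!: mult_right_mono powr_mono2)
  qed auto
  finally show "(\<Sum>n<M. \<bar>\<Sum>m<M. a n * k n m * b m * f m\<bar> powr p) \<le> A powr p * B * A' powr p * (\<Sum>m<M. \<bar>f m\<bar>
      powr p)"
    by (simp add: sum_distrib_left[symmetric] mult_ac)
qed

lemma lp_kernel_add:
  assumes k: "lp_kernel p B k" and l: "lp_kernel p B' l" and p: "p \<ge> 0"
  shows "lp_kernel p (2 powr p * (B + B')) (\<lambda>n m. k n m + l n m)"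
  unfolding lp_kernel_def
proof (intro conjI allI)
  show "0 \<le> 2 powr p * (B + B')" using k l by (simp add: lp_kernel_def)
  fix M f
  let ?K = "\<lambda>n. \<Sum>m<M. k n m * f m" and ?L = "\<lambda>n. \<Sum>m<M. l n m * f m"
  have "(\<Sum>n<M. \<bar>\<Sum>m<M. (k n m + l n m) * f m\<bar> powr p) \<le> (\<Sum>n<M. 2 powr p * (\<bar>?K n\<bar> powr p + \<bar>?L n\<bar> powr p))"
  proof (intro sum_mono)
    fix n
    have "\<bar>\<Sum>m<M. (k n m + l n m) * f m\<bar> \<le> \<bar>?K n\<bar> + \<bar>?L n\<bar>" by (simp add: distrib_right sum.distrib)
    then have "\<bar>\<Sum>m<M. (k n m + l n m) * f m\<bar> powr p \<le> (\<bar>?K n\<bar> + \<bar>?L n\<bar>) powr p" using p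
        by (intro powr_mono2) auto
    also have "\<dots> \<le> 2 powr p * (\<bar>?K n\<bar> powr p + \<bar>?L n\<bar> powr p)" using p by (intro powr_add_le) auto
    finally show "\<bar>\<Sum>m<M. (k n m + l n m) * f m\<bar> powr p \<le> 2 powr p * (\<bar>?K n\<bar> powr p + \<bar>?L n\<bar> powr p)" .
  qed
  also have "\<dots> = 2 powr p * ((\<Sum>n<M. \<bar>?K n\<bar> powr p) + (\<Sum>n<M. \<bar>?L n\<bar> powr p))"
      by (simp only: sum_distrib_left[symmetric] sum.distrib)
  also have "\<dots> \<le> 2 powr p * (B * (\<Sum>m<M. \<bar>f m\<bar> powr p) + B' * (\<Sum>m<M. \<bar>f m\<bar> powr p))"
    by (intro mult_left_mono add_mono lp_kernelD[OF k] lp_kernelD[OF l]) auto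
  finally show "(\<Sum>n<M. \<bar>\<Sum>m<M. (k n m + l n m) * f m\<bar> powr p) \<le> 2 powr p * (B + B') * (\<Sum>m<M. \<bar>f m\<bar> powr p)"
    by (simp add: algebra_simps)
qed

text \<open>A nonnegative dominating kernel is tested on the absolute values of the
  sequence.\<close>

lemma lp_kernel_mono:
  assumes l: "lp_kernel p B l" and kl: "\<And>n m. \<bar>k n m\<bar> \<le> l n m" and p: "p \<ge> 0"
  shows "lp_kernel p B k"
  unfolding lp_kernel_def
proof (intro conjI allI)
  show "0 \<le> B" using l by (simp add: lp_kernel_def)
  fix M f
  have "(\<Sum>n<M. \<bar>\<Sum>m<M. k n m * f m\<bar> powr p) \<le> (\<Sum>n<M. \<bar>\<Sum>m<M. l n m * \<bar>f m\<bar>\<bar> powr p)"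
  proof (intro sum_mono powr_mono2 p)
    fix n
    have "\<bar>\<Sum>m<M. k n m * f m\<bar> \<le> (\<Sum>m<M. \<bar>k n m * f m\<bar>)" by (rule sum_abs)
    also have "\<dots> \<le> (\<Sum>m<M. l n m * \<bar>f m\<bar>)" unfolding abs_mult by (intro sum_mono mult_right_mono kl) auto
    finally show "\<bar>\<Sum>m<M. k n m * f m\<bar> \<le> \<bar>\<Sum>m<M. l n m * \<bar>f m\<bar>\<bar>" by linarith
  qed auto
  also have "\<dots> \<le> B * (\<Sum>m<M. \<bar>\<bar>f m\<bar>\<bar> powr p)" by (rule lp_kernelD[OF l])
  finally show "(\<Sum>n<M. \<bar>\<Sum>m<M. k n m * f m\<bar> powr p) \<le> B * (\<Sum>m<M. \<bar>f m\<bar> powr p)" by simp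
qed

lemma lp_kernel_diag:
  assumes "\<And>n. \<bar>d n\<bar> \<le> D" "p \<ge> 0"
  shows "lp_kernel p (D powr p) (\<lambda>n m. if n = m then d n else 0)"
  unfolding lp_kernel_def
proof (intro conjI allI)
  fix M and f :: "nat \<Rightarrow> real"
  have "(\<Sum>n<M. \<bar>\<Sum>m<M. (if n = m then d n else 0) * f m\<bar> powr p) = (\<Sum>n<M. \<bar>d n\<bar> powr p * \<bar>f n\<bar> powr p)"
  proof (intro sum.cong refl)
    fix n assume n: "n \<in> {..<M}"
    have "(\<Sum>m<M. (if n = m then d n else 0) * f m) = (\<Sum>m<M. if n = m then d n * f m else 0)"
        by (intro sum.cong) auto
    also have "\<dots> = d n * f n" using n by simp
    finally show "\<bar>\<Sum>m<M. (if n = m then d n else 0) * f m\<bar> powr p = \<bar>d n\<bar> powr p * \<bar>f n\<bar> powr p"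
        by (simp add: abs_mult powr_mult)
  qed
  also have "\<dots> \<le> (\<Sum>n<M. D powr p * \<bar>f n\<bar> powr p)" using assms
      by (intro sum_mono mult_right_mono powr_mono2) auto
  finally show "(\<Sum>n<M. \<bar>\<Sum>m<M. (if n = m then d n else 0) * f m\<bar> powr p) \<le> D powr p * (\<Sum>m<M. \<bar>f m\<bar> powr p)"
      by (simp add: sum_distrib_left)
qed simp

text \<open>The naturals are embedded in the integers; the diagonal entry \<open>1 / 0\<close> is 0,
  as in \<open>hilb\<close>.\<close>

lemma lp_kernel_hilbert:
  assumes "p > 1"
  shows "\<exists>B. lp_kernel p B (\<lambda>n m. 1 / (real n - real m))"
proof -
  obtain K where K: "K \<ge> 0" and b: "\<And>I f. finite I \<Longrightarrow> (\<Sum>n\<in>I. \<bar>hilb I f n\<bar> powr p) \<le> K * (\<Sum>m\<in>I. \<bar>f m\<bar> powr p)"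
    using hilb_bounded[OF assms] by blast
  have "(\<Sum>n<M. \<bar>\<Sum>m<M. 1 / (real n - real m) * f m\<bar> powr p) \<le> K * (\<Sum>m<M. \<bar>f m\<bar> powr p)" for M f
  proof -
    have r: "(\<Sum>m\<in>int ` {..<M}. g m) = (\<Sum>m<M. g (int m))" for g :: "int \<Rightarrow> real" by (simp add: sum.reindex)
    show ?thesis using b[of "int ` {..<M}" "\<lambda>j. f (nat j)"] by (simp add: r hilb_def)
  qed
  with K show ?thesis unfolding lp_kernel_def by blast
qed

text \<open>On the integers, \<open>n + m + 1 = n - m'\<close> with \<open>m' = - m - 1 < 0\<close>, so this is the Hilbert kernel applied to
  sequences supported on the negative half-line.\<close>
lemma lp_kernel_hankel:
  assumes "p > 1"
  shows "\<exists>B. lp_kernel p B (\<lambda>n m. 1 / (real n + real m + 1))"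
proof -
  obtain K where K: "K \<ge> 0" and b: "\<And>I f. finite I \<Longrightarrow> (\<Sum>n\<in>I. \<bar>hilb I f n\<bar> powr p) \<le> K * (\<Sum>m\<in>I. \<bar>f m\<bar> powr p)"
    using hilb_bounded[OF assms] by blast
  have "(\<Sum>n<M. \<bar>\<Sum>m<M. 1 / (real n + real m + 1) * f m\<bar> powr p) \<le> K * (\<Sum>m<M. \<bar>f m\<bar> powr p)" for M f
  proof -
    define g where "g = (\<lambda>j. if j < 0 then f (nat (- j - 1)) else 0)"
    let ?P = "int ` {..<M}" and ?Q = "(\<lambda>m. - int m - 1) ` {..<M}"
    have r: "(\<Sum>m\<in>?P. g m) = (\<Sum>m<M. g (int m))" for g :: "int \<Rightarrow> real" by (simp add: sum.reindex)
    have r': "(\<Sum>m\<in>?Q. g m) = (\<Sum>m<M. g (- int m - 1))" for g :: "int \<Rightarrow> real"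
        by (subst sum.reindex) (auto simp: inj_on_def)
    have d: "(\<Sum>m\<in>?P \<union> ?Q. g m) = (\<Sum>m<M. g (int m)) + (\<Sum>m<M. g (- int m - 1))" for g :: "int \<Rightarrow> real"
      unfolding r[symmetric] r'[symmetric] by (rule sum.union_disjoint) auto
    \<comment> \<open>Dropping the rows of negative index can only decrease the sum.\<close>
    have "(\<Sum>n<M. \<bar>hilb (?P \<union> ?Q) g (int n)\<bar> powr p) \<le> (\<Sum>n\<in>?P \<union> ?Q. \<bar>hilb (?P \<union> ?Q) g n\<bar> powr p)"
      unfolding d by (auto intro: sum_nonneg)
    also have "\<dots> \<le> K * (\<Sum>m\<in>?P \<union> ?Q. \<bar>g m\<bar> powr p)" by (rule b) auto
    also have "(\<Sum>m\<in>?P \<union> ?Q. \<bar>g m\<bar> powr p) = (\<Sum>m<M. \<bar>f m\<bar> powr p)" unfolding d by (simp add: g_def)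
    finally show ?thesis unfolding hilb_def d by (simp add: g_def algebra_simps)
  qed
  with K show ?thesis unfolding lp_kernel_def by blast
qed

text \<open>The bound on sections is uniform, so it passes to the limit once each row is known to
  converge; row convergence comes from the same bound with adjusted signs.\<close>

lemma lp_kernel_bounded_operator:
  assumes k: "lp_kernel p B k" and p: "p > 0" and f: "in_lp p f"
  shows "in_lp p (\<lambda>n. \<Sum>m. k n m * f m)" and "lp_norm p (\<lambda>n. \<Sum>m. k n m * f m) \<le> B powr (1/p) * lp_norm p f"
proof -
  define S where "S = (\<Sum>n. \<bar>f n\<bar> powr p)"
  have sf: "summable (\<lambda>n. \<bar>f n\<bar> powr p)" using f by (simp add: in_lp_def)
  have S0: "S \<ge> 0" unfolding S_def by (rule suminf_nonneg[OF sf]) auto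
  have B: "B \<ge> 0" using k by (simp add: lp_kernel_def)
  have part: "(\<Sum>n<M. \<bar>\<Sum>m<M. k n m * g m\<bar> powr p) \<le> B * S" if "\<And>m. \<bar>g m\<bar> \<le> \<bar>f m\<bar>" for g M
  proof -
    have "(\<Sum>m<M. \<bar>g m\<bar> powr p) \<le> (\<Sum>m<M. \<bar>f m\<bar> powr p)" using that p by (intro sum_mono powr_mono2) auto
    also have "\<dots> \<le> S" unfolding S_def by (rule sum_le_suminf[OF sf]) auto
    finally show ?thesis using lp_kernelD[OF k, where M=M and f=g] mult_left_mono[OF _ B] by (meson order_trans)
  qed
  have sm: "summable (\<lambda>m. k n m * f m)" for n
  proof (rule summable_rabs_cancel, rule summableI_nonneg_bounded)
    fix M
    \<comment> \<open>These signs turn row \<open>n\<close> into a sum of absolute values.\<close>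
    define g where "g = (\<lambda>m. sgn (k n m) * \<bar>f m\<bar>)"
    have kg: "k n m * g m = \<bar>k n m * f m\<bar>" for m
        by (cases "k n m" "0::real" rule: linorder_cases) (auto simp: g_def abs_mult)
    \<comment> \<open>At least \<open>Suc n\<close>, so that row \<open>n\<close> occurs in the
      section.\<close>
    let ?M = "max M (Suc n)"
    have "(\<Sum>m<M. \<bar>k n m * f m\<bar>) \<le> (\<Sum>m<?M. \<bar>k n m * f m\<bar>)" by (rule sum_mono2) auto
    also have "\<dots> = (\<bar>\<Sum>m<?M. k n m * g m\<bar> powr p) powr (1/p)" using p by (simp add: kg powr_powr sum_nonneg)
    also have "\<dots> \<le> (\<Sum>n<?M. \<bar>\<Sum>m<?M. k n m * g m\<bar> powr p) powr (1/p)"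
      using p by (intro powr_mono2 member_le_sum[of n "{..<?M}" "\<lambda>n. \<bar>\<Sum>m<?M. k n m * g m\<bar> powr p"]) auto
    also have "\<dots> \<le> (B * S) powr (1/p)"
      using p by (intro powr_mono2 part sum_nonneg) (auto simp: g_def abs_mult abs_sgn_eq)
    finally show "(\<Sum>m<M. \<bar>k n m * f m\<bar>) \<le> (B * S) powr (1/p)" .
  qed simp
  define T where "T = (\<lambda>n. \<Sum>m. k n m * f m)"
  \<comment> \<open>For a fixed number \<open>L\<close> of rows the number of columns tends to
    infinity; the rows below \<open>L\<close> belong to the section as soon as
    \<open>M \<ge> L\<close>.\<close>
  have TL: "(\<Sum>n<L. \<bar>T n\<bar> powr p) \<le> B * S" for L
  proof (rule tendsto_upperbound)
    show "(\<lambda>M. \<Sum>n<L. \<bar>\<Sum>m<M. k n m * f m\<bar> powr p) \<longlonglongrightarrow> (\<Sum>n<L. \<bar>T n\<bar> powr p)"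
      unfolding T_def using p
          by (intro tendsto_sum tendsto_powr2 tendsto_rabs summable_LIMSEQ sm tendsto_const) auto
    show "\<forall>\<^sub>F M in sequentially. (\<Sum>n<L. \<bar>\<Sum>m<M. k n m * f m\<bar> powr p) \<le> B * S"
      using eventually_ge_at_top[of L]
    proof eventually_elim
      case (elim M)
      have "(\<Sum>n<L. \<bar>\<Sum>m<M. k n m * f m\<bar> powr p) \<le> (\<Sum>n<M. \<bar>\<Sum>m<M. k n m * f m\<bar> powr p)"
        using elim by (intro sum_mono2) auto
      then show ?case using part[of f] by (meson order_refl order_trans)
    qed
  qed simp
  have sT: "summable (\<lambda>n. \<bar>T n\<bar> powr p)" by (rule summableI_nonneg_bounded[OF _ TL]) auto
  then show "in_lp p (\<lambda>n. \<Sum>m. k n m * f m)" by (simp add: in_lp_def T_def)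
  have "(\<Sum>n. \<bar>T n\<bar> powr p) \<le> B * S" by (rule suminf_le_const[OF sT TL])
  then have "lp_norm p T \<le> (B * S) powr (1/p)" unfolding lp_norm_def using p
    by (intro powr_mono2 suminf_nonneg[OF sT]) auto
  then show "lp_norm p (\<lambda>n. \<Sum>m. k n m * f m) \<le> B powr (1/p) * lp_norm p f"
    using B S0 by (simp add: T_def lp_norm_def S_def powr_mult)
qed

section \<open>Uniform energy bounds\<close>

definition jphi :: "real \<Rightarrow> real \<Rightarrow> real \<Rightarrow> real" where
  "jphi \<kappa> \<mu> t = \<kappa>/2 * cot (t/2) - \<mu>/2 * tan (t/2)"

lemma half_angle_pos: "0 < t \<Longrightarrow> t < pi \<Longrightarrow> sin (t/2) > 0" "0 < t \<Longrightarrow> t < pi \<Longrightarrow> cos (t/2) > 0"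
  by (auto intro: sin_gt_zero cos_gt_zero)

lemma DERIV_jphi:
  assumes "0 < t" "t < pi"
  shows "(jphi \<kappa> \<mu> has_real_derivative (- \<kappa>/4 / (sin (t/2))\<^sup>2 - \<mu>/4 / (cos (t/2))\<^sup>2)) (at t)"
proof -
  have "((\<lambda>t. \<kappa>/2 * cot (t/2) - \<mu>/2 * tan (t/2)) has_real_derivative
      (\<kappa>/2 * (- inverse ((sin (t/2))\<^sup>2) * (1/2)) - \<mu>/2 * (inverse ((cos (t/2))\<^sup>2) * (1/2)))) (at t)"
    using half_angle_pos[OF assms]
    by (intro DERIV_diff DERIV_cmult DERIV_chain2[OF DERIV_cot] DERIV_chain2[OF DERIV_tan] DERIV_cdivide
        DERIV_ident) auto
  then show ?thesis by (simp add: jphi_def[abs_def] field_simps)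
qed

lemma jphi_deriv_nonpos:
  fixes \<kappa> \<mu> t :: real
  assumes "\<kappa> \<ge> 0" "\<mu> \<ge> 0"
  shows "- \<kappa>/4 / (sin (t/2))\<^sup>2 - \<mu>/4 / (cos (t/2))\<^sup>2 \<le> 0"
proof -
  have "\<kappa>/4 / (sin (t/2))\<^sup>2 \<ge> 0" "\<mu>/4 / (cos (t/2))\<^sup>2 \<ge> 0" using assms by simp_all
  then show ?thesis unfolding minus_divide_left[symmetric] by linarith
qed

lemma jphi_antimono:
  assumes "\<kappa> \<ge> 0" "\<mu> \<ge> 0" "0 < s" "s \<le> t" "t < pi"
  shows "jphi \<kappa> \<mu> t \<le> jphi \<kappa> \<mu> s"
proof (rule DERIV_nonpos_imp_nonincreasing[OF assms(4)])
  fix x assume "s \<le> x" "x \<le> t"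
  with assms show "\<exists>y. (jphi \<kappa> \<mu> has_real_derivative y) (at x) \<and> y \<le> 0"
    using DERIV_jphi[of x \<kappa> \<mu>] jphi_deriv_nonpos[of \<kappa> \<mu> x] by auto
qed

text \<open>From \<open>y \<le> tan y\<close> at \<open>y = t/2\<close>; the tangent term only
  lowers \<open>jphi\<close>.\<close>

lemma jphi_le:
  assumes "\<kappa> \<ge> 0" "\<mu> \<ge> 0" "0 < t" "t < pi"
  shows "jphi \<kappa> \<mu> t \<le> \<kappa> / t"
proof -
  note sc = half_angle_pos[OF assms(3,4)]
  have "t/2 \<le> tan (t/2)" using abs_tan_ge[of "t/2"] sc assms by (simp add: tan_def)
  then have "(t/2) * cos (t/2) \<le> sin (t/2)" using sc by (simp add: tan_def field_simps)
  then have "cot (t/2) \<le> 2/t" using sc assms by (simp add: cot_def field_simps)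
  then have "\<kappa>/2 * cot (t/2) \<le> \<kappa>/2 * (2/t)" using assms by (intro mult_left_mono) auto
  moreover have "\<mu>/2 * tan (t/2) \<ge> 0" using sc assms by (simp add: tan_def)
  moreover have "\<kappa>/2 * (2/t) = \<kappa>/t" by simp
  ultimately show ?thesis unfolding jphi_def by linarith
qed

text \<open>Carries estimates near 0 over to \<open>pi\<close>, with the two exponents
  exchanged.\<close>

lemma jphi_reflect: "jphi \<kappa> \<mu> (pi - t) = - jphi \<mu> \<kappa> t"
proof -
  have "sin ((pi - t)/2) = cos (t/2)" "cos ((pi - t)/2) = sin (t/2)"
    by (simp_all add: diff_divide_distrib sin_diff cos_diff)
  then show ?thesis by (simp add: jphi_def tan_def cot_def)
qed

text \<open>On the middle third \<open>t \<ge> pi/3 > 1\<close>, so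
  \<open>\<kappa>/t \<le> \<kappa>\<close>. The lower bound is this upper bound after
  reflection.\<close>

lemma abs_jphi_middle:
  assumes "\<kappa> \<ge> 0" "\<mu> \<ge> 0" "pi/3 \<le> t" "t \<le> 2*pi/3"
  shows "\<bar>jphi \<kappa> \<mu> t\<bar> \<le> \<kappa> + \<mu>"
proof -
  have up: "jphi \<kappa> \<mu> t \<le> \<kappa>" if "\<kappa> \<ge> 0" "\<mu> \<ge> 0" "pi/3 \<le> t" "t < pi" for \<kappa> \<mu> t
  proof -
    have "1 \<le> t" using that pi_gt3 by linarith
    moreover have "jphi \<kappa> \<mu> t \<le> \<kappa>/t" using that \<open>1 \<le> t\<close> by (intro jphi_le) auto
    moreover have "\<kappa>/t \<le> \<kappa>/1" using that \<open>1 \<le> t\<close> by (intro divide_left_mono) auto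
    ultimately show ?thesis by simp
  qed
  have t: "t < pi" "pi/3 \<le> pi - t" "pi - t < pi" using assms pi_gt_zero by linarith+
  have "jphi \<kappa> \<mu> t \<le> \<kappa>" using assms t by (intro up) auto
  moreover have "jphi \<mu> \<kappa> (pi - t) \<le> \<mu>" using assms t by (intro up) auto
  ultimately show ?thesis using jphi_reflect[of \<mu> \<kappa> t] assms by linarith
qed

text \<open>The first-order form of the Jacobi equation. The function \<open>jphi \<kappa> \<mu>\<close> is the logarithmic derivative of
  \<open>sin (t/2) powr \<kappa> * cos (t/2) powr \<mu>\<close>.\<close>
locale jacobi_system =
  fixes \<kappa> \<mu> \<nu> :: real and u v :: "real \<Rightarrow> real"
  assumes kappa: "\<kappa> \<ge> 0" and mu: "\<mu> \<ge> 0" and nu: "\<nu> > 0"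
    and du: "\<And>t. 0 < t \<Longrightarrow> t < pi \<Longrightarrow> (u has_real_derivative jphi \<kappa> \<mu> t * u t - \<nu> * v t) (at t)"
    and dv: "\<And>t. 0 < t \<Longrightarrow> t < pi \<Longrightarrow> (v has_real_derivative \<nu> * u t - jphi \<kappa> \<mu> t * v t) (at t)"
    and v0: "(v \<longlongrightarrow> 0) (at_right 0)" and vpi: "(v \<longlongrightarrow> 0) (at_left pi)"
begin

definition "energy t = (u t)\<^sup>2 + (v t)\<^sup>2"

lemma energy_nonneg: "energy t \<ge> 0" by (simp add: energy_def)

lemma jphi_IVT:
  assumes "0 < s" "s \<le> t" "t < pi" "jphi \<kappa> \<mu> t \<le> y" "y \<le> jphi \<kappa> \<mu> s"
  obtains x where "s \<le> x" "x \<le> t" "jphi \<kappa> \<mu> x = y"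
proof -
  have "\<exists>x\<ge>s. x \<le> t \<and> jphi \<kappa> \<mu> x = y"
    using assms by (intro IVT2) (auto intro: DERIV_isCont[OF DERIV_jphi])
  then show thesis using that by auto
qed

text \<open>The corrected energy \<open>F\<close> has derivative
  \<open>- 2 * q x * (u x * v x) / \<nu>\<close> with \<open>q\<close> the derivative of
  \<open>jphi\<close>. As \<open>jphi\<close> is monotone and varies by at most \<open>\<nu>\<close>
  between the two points, a Gronwall argument costs \<open>exp 2\<close>; comparing \<open>F\<close>
  with \<open>energy\<close> costs 3.\<close>

lemma energy_middle:
  assumes s: "0 < s" "s < pi" "\<bar>jphi \<kappa> \<mu> s\<bar> \<le> \<nu>/2" and t: "0 < t" "t < pi" "\<bar>jphi \<kappa> \<mu> t\<bar> \<le> \<nu>/2"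
  shows "energy s \<le> 3 * exp 2 * energy t"
proof -
  let ?p = "jphi \<kappa> \<mu>"
  \<comment> \<open>Since \<open>(u v)' = \<nu> (u\<^sup>2 - v\<^sup>2)\<close>, this correction cancels the oscillating term of \<open>energy'\<close>.\<close>
  define F where "F = (\<lambda>t. energy t - 2 * ?p t * (u t * v t) / \<nu>)"
  have F: "energy x / 2 \<le> F x" "F x \<le> 3/2 * energy x" if "\<bar>?p x\<bar> \<le> \<nu>/2" for x
  proof -
    have "2 * \<bar>u x * v x\<bar> \<le> energy x"
      using zero_le_power2[of "\<bar>u x\<bar> - \<bar>v x\<bar>"] by (simp add: energy_def power2_eq_square algebra_simps abs_mult)
    moreover have "\<bar>?p x / \<nu>\<bar> \<le> 1/2" using that nu by (simp add: abs_divide field_simps)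
    ultimately have a: "\<bar>?p x / \<nu>\<bar> * (2 * \<bar>u x * v x\<bar>) \<le> 1/2 * energy x" by (intro mult_mono) auto
    have b: "\<bar>2 * ?p x * (u x * v x) / \<nu>\<bar> = \<bar>?p x / \<nu>\<bar> * (2 * \<bar>u x * v x\<bar>)" by (simp add: abs_mult)
    have "\<bar>2 * ?p x * (u x * v x) / \<nu>\<bar> \<le> 1/2 * energy x" unfolding b by (rule a)
    then show "energy x / 2 \<le> F x" "F x \<le> 3/2 * energy x" unfolding F_def by linarith+
  qed
  have R: "\<bar>?p x\<bar> \<le> \<nu>/2" if "min s t \<le> x" "x \<le> max s t" for x
  proof -
    have "?p x \<le> ?p (min s t)" "?p (max s t) \<le> ?p x" using that s t kappa mu by (intro jphi_antimono; simp)+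
    moreover have "\<bar>?p (min s t)\<bar> \<le> \<nu>/2" "\<bar>?p (max s t)\<bar> \<le> \<nu>/2" using s t by (auto simp: min_def max_def)
    ultimately show ?thesis by linarith
  qed
  define q where "q = (\<lambda>x. - \<kappa>/4 / (sin (x/2))\<^sup>2 - \<mu>/4 / (cos (x/2))\<^sup>2)"
  have dp: "(?p has_real_derivative q x) (at x)" if "0 < x" "x < pi" for x
    unfolding q_def by (rule DERIV_jphi[OF that])
  have dF: "(F has_real_derivative (- 2 * q x * (u x * v x) / \<nu>)) (at x)" if x: "0 < x" "x < pi" for x
  proof -
    have "(F has_real_derivative ((2 * u x * (?p x * u x - \<nu> * v x) + 2 * v x * (\<nu> * u x - ?p x * v x)) -
        (2 * q x * (u x * v x) + 2 * ?p x * ((?p x * u x - \<nu> * v x) * v x + u x * (\<nu> * u x - ?p x * v x))) /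
            \<nu>)) (at x)"
      unfolding F_def energy_def
      by (auto intro!: derivative_eq_intros du[OF x] dv[OF x] dp[OF x]) (use nu in \<open>simp_all add:
          algebra_simps\<close>)
    moreover have "((2 * u x * (?p x * u x - \<nu> * v x) + 2 * v x * (\<nu> * u x - ?p x * v x)) -
        (2 * q x * (u x * v x) + 2 * ?p x * ((?p x * u x - \<nu> * v x) * v x + u x * (\<nu> * u x - ?p x * v x))) /
            \<nu>) = - 2 * q x * (u x * v x) / \<nu>"
      using nu by (simp add: field_simps power2_eq_square)
    ultimately show ?thesis by simp
  qed
  have dom: "\<bar>2 * q x * (u x * v x) / \<nu>\<bar> \<le> - (2 * q x / \<nu>) * F x" if x: "min s t \<le> x" "x \<le> max s t" for x
  proof -
    have q: "q x \<le> 0" unfolding q_def using jphi_deriv_nonpos[OF kappa mu] by simp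
    have "2 * \<bar>u x * v x\<bar> \<le> energy x"
      using zero_le_power2[of "\<bar>u x\<bar> - \<bar>v x\<bar>"] by (simp add: energy_def power2_eq_square algebra_simps abs_mult)
    also have "\<dots> \<le> 2 * F x" using F(1)[OF R[OF x]] by simp
    finally have "2 * \<bar>u x * v x\<bar> \<le> 2 * F x" .
    moreover have "- q x / \<nu> \<ge> 0" using q nu by (intro divide_nonneg_pos) auto
    ultimately have "- q x / \<nu> * (2 * \<bar>u x * v x\<bar>) \<le> - q x / \<nu> * (2 * F x)" by (intro mult_left_mono) auto
    moreover have "\<bar>2 * q x * (u x * v x) / \<nu>\<bar> = - q x / \<nu> * (2 * \<bar>u x * v x\<bar>)" using q nu
        by (simp add: abs_mult)
    ultimately show ?thesis by (simp add: mult_ac)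
  qed
  have Fst: "F s \<le> exp 2 * F t"
  proof (cases "s \<le> t")
    case True
    \<comment> \<open>The exponent \<open>- (2 * ?p x / \<nu>)\<close> has derivative
      \<open>- (2 * q x / \<nu>)\<close>, exactly the growth rate in \<open>dom\<close>.\<close>
    have "F s * exp (- (2 * ?p s / \<nu>)) \<le> F t * exp (- (2 * ?p t / \<nu>))"
    proof (rule DERIV_nonneg_imp_nondecreasing[OF True])
      fix x assume x: "s \<le> x" "x \<le> t"
      then have x': "0 < x" "x < pi" "min s t \<le> x" "x \<le> max s t" using s t by auto
      have "((\<lambda>x. F x * exp (- (2 * ?p x / \<nu>))) has_real_derivative
          (- 2 * q x * (u x * v x) / \<nu>) * exp (- (2 * ?p x / \<nu>)) + exp (- (2 * ?p x / \<nu>)) * (- (2 * q x /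
              \<nu>)) * F x) (at x)"
        by (auto intro!: derivative_eq_intros dF x' dp simp: nu[THEN less_imp_neq, symmetric])
      moreover have "(- 2 * q x * (u x * v x) / \<nu>) * exp (- (2 * ?p x / \<nu>)) + exp (- (2 * ?p x / \<nu>)) * (- (2
          * q x / \<nu>)) * F x
          = exp (- (2 * ?p x / \<nu>)) * (- (2 * q x / \<nu>) * F x - 2 * q x * (u x * v x) / \<nu>)" by (simp add:
              algebra_simps)
      moreover have "- (2 * q x / \<nu>) * F x - 2 * q x * (u x * v x) / \<nu> \<ge> 0" using dom[OF x'(3,4)] by linarith
      ultimately show "\<exists>y. ((\<lambda>x. F x * exp (- (2 * ?p x / \<nu>))) has_real_derivative y) (at x) \<and> 0 \<le> y" by auto
    qed
    then have "F s \<le> F t * exp (- (2 * ?p t / \<nu>)) * exp (2 * ?p s / \<nu>)" by (simp add: exp_minus field_simps)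
    also have "\<dots> = F t * exp (2 * (?p s - ?p t) / \<nu>)"
        by (simp add: exp_add[symmetric] diff_divide_distrib right_diff_distrib)
    also have "\<dots> \<le> F t * exp 2"
    proof (intro mult_left_mono)
      have "?p s - ?p t \<le> \<nu>" using s t by linarith
      then have "2 * (?p s - ?p t) / \<nu> \<le> 2" using nu by (simp add: field_simps)
      then show "exp (2 * (?p s - ?p t) / \<nu>) \<le> exp 2" by simp
      show "0 \<le> F t" using F(1)[OF t(3)] energy_nonneg[of t] by linarith
    qed
    finally show ?thesis by (simp add: mult.commute)
  next
    case False
    then have ts: "t \<le> s" by simp
    \<comment> \<open>The same argument in the opposite direction, with the inverse integrating
      factor.\<close>
    have "F s * exp (2 * ?p s / \<nu>) \<le> F t * exp (2 * ?p t / \<nu>)"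
    proof (rule DERIV_nonpos_imp_nonincreasing[OF ts])
      fix x assume x: "t \<le> x" "x \<le> s"
      then have x': "0 < x" "x < pi" "min s t \<le> x" "x \<le> max s t" using s t by auto
      have "((\<lambda>x. F x * exp (2 * ?p x / \<nu>)) has_real_derivative
          (- 2 * q x * (u x * v x) / \<nu>) * exp (2 * ?p x / \<nu>) + exp (2 * ?p x / \<nu>) * (2 * q x / \<nu>) * F x) (at x)"
        by (auto intro!: derivative_eq_intros dF x' dp simp: nu[THEN less_imp_neq, symmetric])
      moreover have "(- 2 * q x * (u x * v x) / \<nu>) * exp (2 * ?p x / \<nu>) + exp (2 * ?p x / \<nu>) * (2 * q x / \<nu>)
          * F x
          = - (exp (2 * ?p x / \<nu>) * (- (2 * q x / \<nu>) * F x + 2 * q x * (u x * v x) / \<nu>))" by (simp add: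
              algebra_simps)
      moreover have "- (2 * q x / \<nu>) * F x + 2 * q x * (u x * v x) / \<nu> \<ge> 0" using dom[OF x'(3,4)] by linarith
      ultimately show "\<exists>y. ((\<lambda>x. F x * exp (2 * ?p x / \<nu>)) has_real_derivative y) (at x) \<and> y \<le> 0" by auto
    qed
    then have "F s \<le> F t * exp (2 * ?p t / \<nu>) * exp (- (2 * ?p s / \<nu>))" by (simp add: exp_minus field_simps)
    also have "\<dots> = F t * exp (2 * (?p t - ?p s) / \<nu>)"
        by (simp add: exp_add[symmetric] diff_divide_distrib right_diff_distrib)
    also have "\<dots> \<le> F t * exp 2"
    proof (intro mult_left_mono)
      have "?p t - ?p s \<le> \<nu>" using s t by linarith
      then have "2 * (?p t - ?p s) / \<nu> \<le> 2" using nu by (simp add: field_simps)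
      then show "exp (2 * (?p t - ?p s) / \<nu>) \<le> exp 2" by simp
      show "0 \<le> F t" using F(1)[OF t(3)] energy_nonneg[of t] by linarith
    qed
    finally show ?thesis by (simp add: mult.commute)
  qed
  have "energy s \<le> 2 * F s" using F(1)[OF s(3)] by simp
  also have "\<dots> \<le> 2 * (exp 2 * F t)" using Fst by simp
  also have "\<dots> \<le> 2 * (exp 2 * (3/2 * energy t))" using F(2)[OF t(3)] by simp
  finally show ?thesis by (simp add: mult_ac)
qed

lemma energy_deriv:
  assumes "0 < x" "x < pi"
  shows "(energy has_real_derivative 2 * jphi \<kappa> \<mu> x * ((u x)\<^sup>2 - (v x)\<^sup>2)) (at x)"
  unfolding energy_def
  by (auto intro!: derivative_eq_intros du dv assms simp: algebra_simps power2_eq_square)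

text \<open>Moving left from \<open>t\<close> there are three zones. Up to
  \<open>jphi = \<nu>/2\<close> the middle estimate applies; between \<open>\<nu>/2\<close> and
  \<open>\<nu>\<close> the zone is so short that crude growth suffices; beyond \<open>\<nu>\<close>
  the energy is monotone.\<close>

lemma energy_left:
  assumes s: "0 < s" "s \<le> t" and t: "t < pi" "\<bar>jphi \<kappa> \<mu> t\<bar> \<le> \<nu>/2"
  shows "energy s \<le> 3 * exp (2 + 4 * \<kappa>) * energy t"
proof -
  let ?p = "jphi \<kappa> \<mu>"
  let ?C = "3 * exp 2 * energy t"
  have C0: "?C \<ge> 0" using energy_nonneg by simp
  have ts: "?p t \<le> ?p s" using s t kappa mu by (intro jphi_antimono) auto
  have low: "energy s \<le> exp (4 * \<kappa>) * ?C" if s: "0 < s" "s \<le> t" "?p s \<le> \<nu>" for s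
  proof (cases "?p s \<le> \<nu>/2")
    case True
    have "?p t \<le> ?p s" using s t kappa mu by (intro jphi_antimono) auto
    then have "energy s \<le> ?C" using s t True by (intro energy_middle) auto
    also have "\<dots> \<le> exp (4 * \<kappa>) * ?C" using C0 kappa mult_right_mono[of 1 "exp (4 * \<kappa>)" ?C] by simp
    finally show ?thesis .
  next
    case False
    \<comment> \<open>By \<open>jphi_le\<close> this point satisfies
      \<open>\<nu> * r \<le> 2 * \<kappa>\<close>. To the left the energy falls at relative rate at
      most \<open>2 * \<nu>\<close> as \<open>x\<close> increases, whence the factor
      \<open>exp (4 * \<kappa>)\<close>.\<close>
    obtain r where r: "s \<le> r" "r \<le> t" "?p r = \<nu>/2"
      by (rule jphi_IVT[of s t "\<nu>/2"]) (use s t False in auto)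
    have r0: "0 < r" "r < pi" using r s t by auto
    have "\<nu>/2 \<le> \<kappa> / r" using jphi_le[OF kappa mu r0] r by simp
    then have nr: "\<nu> * r \<le> 2 * \<kappa>" using r0 by (simp add: field_simps)
    have "energy s * exp (2 * \<nu> * s) \<le> energy r * exp (2 * \<nu> * r)"
    proof (rule DERIV_nonneg_imp_nondecreasing[OF r(1)])
      fix x assume x: "s \<le> x" "x \<le> r"
      then have x': "0 < x" "x < pi" using s r t by auto
      have px: "\<nu>/2 \<le> ?p x" "?p x \<le> \<nu>"
          using jphi_antimono[OF kappa mu, of x r] jphi_antimono[OF kappa mu, of s x] x x' r r0 s by auto
      have "((\<lambda>x. energy x * exp (2 * \<nu> * x)) has_real_derivative
         2 * ?p x * ((u x)\<^sup>2 - (v x)\<^sup>2) * exp (2 * \<nu> * x) + exp (2 * \<nu> * x) * (2 * \<nu>) * energy x) (at x)"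
        by (auto intro!: derivative_eq_intros energy_deriv x')
      moreover have "2 * ?p x * ((u x)\<^sup>2 - (v x)\<^sup>2) * exp (2 * \<nu> * x) + exp (2 * \<nu> * x) * (2 * \<nu>) * energy x =
         exp (2 * \<nu> * x) * 2 * ((\<nu> + ?p x) * (u x)\<^sup>2 + (\<nu> - ?p x) * (v x)\<^sup>2)" by (simp add: energy_def
             algebra_simps)
      moreover have "\<dots> \<ge> 0" using px nu by (intro mult_nonneg_nonneg add_nonneg_nonneg) auto
      ultimately show "\<exists>y. ((\<lambda>x. energy x * exp (2 * \<nu> * x)) has_real_derivative y) (at x) \<and> 0 \<le> y" by auto
    qed
    moreover have "energy s * 1 \<le> energy s * exp (2 * \<nu> * s)" using nu s energy_nonneg
        by (intro mult_left_mono) auto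
    ultimately have "energy s \<le> energy r * exp (2 * \<nu> * r)" by linarith
    also have "\<dots> \<le> ?C * exp (4 * \<kappa>)"
    proof (intro mult_mono)
      show "energy r \<le> ?C" using r r0 t s nu by (intro energy_middle) auto
    qed (use nr C0 energy_nonneg in auto)
    finally show ?thesis by (simp add: mult.commute)
  qed
  have "energy s \<le> exp (4 * \<kappa>) * ?C"
  proof (cases "?p s \<le> \<nu>")
    case True
    then show ?thesis using low s by simp
  next
    case False
    obtain r where r: "s \<le> r" "r \<le> t" "?p r = \<nu>"
      by (rule jphi_IVT[of s t "\<nu>"]) (use s t False nu in auto)
    \<comment> \<open>Where \<open>jphi \<ge> \<nu>\<close>, \<open>D\<close> is increasing and starts at a nonnegative value, so the energy increases as well.\<close>
    define D where "D = (\<lambda>x. (u x)\<^sup>2 - (v x)\<^sup>2)"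
    have Dmono: "D x \<le> D y" if "0 < x" "x \<le> y" "y \<le> r" for x y
    proof (rule DERIV_nonneg_imp_nondecreasing[OF that(2)])
      fix z assume z: "x \<le> z" "z \<le> y"
      then have z': "0 < z" "z < pi" "z \<le> r" using that r t by auto
      have pz: "\<nu> \<le> ?p z" using jphi_antimono[OF kappa mu, of z r] r t z' by auto
      have "(D has_real_derivative 2 * (?p z * ((u z)\<^sup>2 + (v z)\<^sup>2) - 2 * \<nu> * (u z * v z))) (at z)"
        unfolding D_def
        by (auto intro!: derivative_eq_intros du dv z' simp: algebra_simps power2_eq_square)
      moreover have "2 * \<nu> * (u z * v z) \<le> ?p z * ((u z)\<^sup>2 + (v z)\<^sup>2)"
      proof -
        have "2 * (u z * v z) \<le> (u z)\<^sup>2 + (v z)\<^sup>2" using zero_le_power2[of "u z - v z"]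
            by (simp add: power2_eq_square algebra_simps)
        then have "\<nu> * (2 * (u z * v z)) \<le> \<nu> * ((u z)\<^sup>2 + (v z)\<^sup>2)" using nu by (intro mult_left_mono) auto
        also have "\<dots> \<le> ?p z * ((u z)\<^sup>2 + (v z)\<^sup>2)" using pz by (intro mult_right_mono) auto
        finally show ?thesis by (simp add: mult_ac)
      qed
      ultimately show "\<exists>y. (D has_real_derivative y) (at z) \<and> 0 \<le> y" by fastforce
    qed
    have D0: "D x \<ge> 0" if x: "0 < x" "x \<le> r" for x
    proof -
      \<comment> \<open>The boundary limit of \<open>v\<close> bounds \<open>D\<close> from below:
        \<open>D e \<ge> - (v e)^2\<close>, and \<open>D\<close> increases.\<close>
      have "((\<lambda>e. - (v e)\<^sup>2) \<longlongrightarrow> - 0\<^sup>2) (at_right 0)" by (intro tendsto_intros v0)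
      moreover have "\<forall>\<^sub>F e in at_right 0. - (v e)\<^sup>2 \<le> D x"
        using eventually_at_right_real[OF x(1)]
      proof eventually_elim
        case (elim e)
        have "- (v e)\<^sup>2 \<le> D e" by (simp add: D_def)
        also have "D e \<le> D x" using elim x by (intro Dmono) auto
        finally show ?case .
      qed
      ultimately have "- 0\<^sup>2 \<le> D x" by (rule tendsto_upperbound) simp
      then show ?thesis by simp
    qed
    have "energy s \<le> energy r"
    proof (rule DERIV_nonneg_imp_nondecreasing[OF r(1)])
      fix x assume x: "s \<le> x" "x \<le> r"
      then have x': "0 < x" "x < pi" using s r t by auto
      have pz: "\<nu> \<le> ?p x" using jphi_antimono[OF kappa mu, of x r] r t x x' by auto
      have "0 \<le> 2 * ?p x * ((u x)\<^sup>2 - (v x)\<^sup>2)" using D0[of x] x x' pz nu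
          by (intro mult_nonneg_nonneg) (auto simp: D_def)
      then show "\<exists>y. (energy has_real_derivative y) (at x) \<and> 0 \<le> y" using energy_deriv[OF x'] by blast
    qed
    also have "\<dots> \<le> exp (4 * \<kappa>) * ?C" using low[of r] r s by simp
    finally show ?thesis .
  qed
  then show ?thesis by (simp add: exp_add mult_ac)
qed

end

text \<open>Reversing \<open>t\<close> flips both derivatives; \<open>jphi_reflect\<close> restores
  the diagonal terms, and the sign change of \<open>v\<close> restores the coupling.\<close>

lemma jacobi_system_reflect:
  assumes "jacobi_system \<kappa> \<mu> \<nu> u v"
  shows "jacobi_system \<mu> \<kappa> \<nu> (\<lambda>t. u (pi - t)) (\<lambda>t. - v (pi - t))"
proof -
  interpret jacobi_system \<kappa> \<mu> \<nu> u v by fact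
  have l: "filterlim (\<lambda>t. pi - t) (at_left pi) (at_right 0)" "filterlim (\<lambda>t. pi - t) (at_right 0) (at_left pi)"
    by real_asymp+
  show ?thesis
  proof
    fix t :: real assume t: "0 < t" "t < pi"
    then have t': "0 < pi - t" "pi - t < pi" by auto
    have j: "jphi \<kappa> \<mu> (pi - t) = - jphi \<mu> \<kappa> t" by (rule jphi_reflect)
    have "((\<lambda>t. u (pi - t)) has_real_derivative (jphi \<kappa> \<mu> (pi - t) * u (pi - t) - \<nu> * v (pi - t)) * (- 1))
        (at t)"
      by (rule DERIV_chain2[where f=u and g="\<lambda>t. pi - t", OF du[OF t']]) (auto intro!: derivative_eq_intros)
    then show "((\<lambda>t. u (pi - t)) has_real_derivative jphi \<mu> \<kappa> t * u (pi - t) - \<nu> * - v (pi - t)) (at t)"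
      by (simp add: j algebra_simps)
    have "((\<lambda>t. v (pi - t)) has_real_derivative (\<nu> * u (pi - t) - jphi \<kappa> \<mu> (pi - t) * v (pi - t)) * (- 1))
        (at t)"
      by (rule DERIV_chain2[where f=v and g="\<lambda>t. pi - t", OF dv[OF t']]) (auto intro!: derivative_eq_intros)
    from DERIV_minus[OF this] show "((\<lambda>t. - v (pi - t)) has_real_derivative \<nu> * u (pi - t) - jphi \<mu> \<kappa> t * -
        v (pi - t)) (at t)"
      by (simp add: j algebra_simps)
  next
    show "((\<lambda>t. - v (pi - t)) \<longlongrightarrow> 0) (at_right 0)"
      using tendsto_minus[OF filterlim_compose[OF vpi l(1)]] by simp
    show "((\<lambda>t. - v (pi - t)) \<longlongrightarrow> 0) (at_left pi)"
      using tendsto_minus[OF filterlim_compose[OF v0 l(2)]] by simp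
  qed (use kappa mu nu in auto)
qed

context jacobi_system
begin

text \<open>To the left of \<open>t\<close> this is \<open>energy_left\<close>, to the right it is
  \<open>energy_left\<close> for the reflected system.\<close>

lemma energy_le:
  assumes s: "0 < s" "s < pi" and t: "0 < t" "t < pi" "\<bar>jphi \<kappa> \<mu> t\<bar> \<le> \<nu>/2"
  shows "energy s \<le> 3 * exp (2 + 4 * (\<kappa> + \<mu>)) * energy t"
proof (cases "s \<le> t")
  case True
  have "energy s \<le> 3 * exp (2 + 4 * \<kappa>) * energy t" using True s t by (intro energy_left) auto
  also have "\<dots> \<le> 3 * exp (2 + 4 * (\<kappa> + \<mu>)) * energy t"
    using mu energy_nonneg by (intro mult_right_mono) auto
  finally show ?thesis .
next
  case False
  interpret r: jacobi_system \<mu> \<kappa> \<nu> "\<lambda>t. u (pi - t)" "\<lambda>t. - v (pi - t)"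
    by (rule jacobi_system_reflect) unfold_locales
  have e: "r.energy (pi - x) = energy x" for x by (simp add: r.energy_def energy_def)
  have "r.energy (pi - s) \<le> 3 * exp (2 + 4 * \<mu>) * r.energy (pi - t)"
    using False s t by (intro r.energy_left) (auto simp: jphi_reflect)
  then have "energy s \<le> 3 * exp (2 + 4 * \<mu>) * energy t" by (simp only: e)
  also have "\<dots> \<le> 3 * exp (2 + 4 * (\<kappa> + \<mu>)) * energy t"
    using kappa energy_nonneg by (intro mult_right_mono) auto
  finally show ?thesis .
qed

text \<open>\<open>energy_le\<close> is averaged over the middle third, whose length
  \<open>pi/3\<close> exceeds 1; there \<open>\<bar>jphi \<kappa> \<mu> t\<bar> \<le> \<kappa> +
  \<mu> \<le> \<nu>/2\<close>.\<close>

lemma energy_le_integral: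
  assumes s: "0 < s" "s < pi" and n: "2 * (\<kappa> + \<mu>) \<le> \<nu>"
  shows "energy s \<le> 3 * exp (2 + 4 * (\<kappa> + \<mu>)) * integral {pi/3..2*pi/3} energy"
proof -
  let ?C = "3 * exp (2 + 4 * (\<kappa> + \<mu>))"
  have J: "0 < t" "t < pi" if "t \<in> {pi/3..2*pi/3}" for t
  proof -
    have "pi/3 \<le> t" "t \<le> 2*pi/3" using that by auto
    then show "0 < t" "t < pi" using pi_gt_zero by linarith+
  qed
  have cont: "continuous_on {pi/3..2*pi/3} energy"
    by (intro continuous_at_imp_continuous_on ballI DERIV_isCont[OF energy_deriv] J)
  then have int: "energy integrable_on {pi/3..2*pi/3}" by (rule integrable_continuous_real)
  have "energy s * (pi/3) = integral {pi/3..2*pi/3} (\<lambda>_. energy s)" by simp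
  also have "\<dots> \<le> integral {pi/3..2*pi/3} (\<lambda>t. ?C * energy t)"
  proof (rule integral_le)
    fix t assume t: "t \<in> {pi/3..2*pi/3}"
    then have "\<bar>jphi \<kappa> \<mu> t\<bar> \<le> \<nu>/2" using abs_jphi_middle[OF kappa mu, of t] n by auto
    then show "energy s \<le> ?C * energy t" using J[OF t] s by (intro energy_le) auto
  qed (use int in auto)
  also have "\<dots> = ?C * integral {pi/3..2*pi/3} energy" by simp
  finally have "energy s * (pi/3) \<le> ?C * integral {pi/3..2*pi/3} energy" .
  moreover have "energy s * 1 \<le> energy s * (pi/3)" using pi_gt3 energy_nonneg by (intro mult_left_mono) auto
  ultimately show ?thesis by linarith
qed

end

section \<open>The Jacobi differential equation\<close>

definition jmono :: "nat \<Rightarrow> nat \<Rightarrow> real \<Rightarrow> real" where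
  "jmono i j x = ((x - 1)/2)^i * ((x + 1)/2)^j"

text \<open>Truncated subtraction is harmless: whenever \<open>i - 1\<close> or \<open>j - 1\<close>
  degenerates, the factor in front is 0.\<close>

definition jmono' :: "nat \<Rightarrow> nat \<Rightarrow> real \<Rightarrow> real" where
  "jmono' i j x = (real i * jmono (i - 1) j x + real j * jmono i (j - 1) x) / 2"

definition jmono'' :: "nat \<Rightarrow> nat \<Rightarrow> real \<Rightarrow> real" where
  "jmono'' i j x = (real i * jmono' (i - 1) j x + real j * jmono' i (j - 1) x) / 2"

lemma DERIV_jmono: "(jmono i j has_real_derivative jmono' i j x) (at x)"
  unfolding jmono_def[abs_def] jmono'_def
  by (auto intro!: derivative_eq_intros simp: algebra_simps)

lemma DERIV_jmono': "(jmono' i j has_real_derivative jmono'' i j x) (at x)"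
  unfolding jmono'_def[of i j, abs_def] jmono''_def
  by (auto intro!: derivative_eq_intros DERIV_jmono)

text \<open>In \<open>X = (x - 1)/2\<close> and \<open>Y = (x + 1)/2\<close> the Jacobi operator
  preserves the total degree \<open>i + j\<close> and acts tridiagonally, because
  \<open>1 - x^2 = - 4 * (X * Y)\<close>.\<close>

lemma jmono_ode:
  fixes \<alpha> \<beta> x :: real
  shows "(1 - x\<^sup>2) * jmono'' i j x + (\<beta> - \<alpha> - (\<alpha> + \<beta> + 2) * x) * jmono' i j x =
    - (real i * (real i + \<alpha>) * jmono (i - 1) (j + 1) x
       + (2 * real i * real j + (\<alpha> + 1) * real j + (\<beta> + 1) * real i) * jmono i j x
       + real j * (real j + \<beta>) * jmono (i + 1) (j - 1) x)"
proof -
  define X Y where "X = (x - 1)/2" and "Y = (x + 1)/2"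
  define a0 a1 a2 where "a0 = X^i" and "a1 = real i * X^(i - 1)" and "a2 = real i * (real (i - 1) * X^(i - 1
      - 1))"
  define b0 b1 b2 where "b0 = Y^j" and "b1 = real j * Y^(j - 1)" and "b2 = real j * (real (j - 1) * Y^(j - 1
      - 1))"
  \<comment> \<open>Euler relations: multiplication by the variable undoes a differentiation. They
    also hold where an exponent degenerates.\<close>
  have a: "a1 * X = real i * a0" "a2 * X = (real i - 1) * a1"
    unfolding a0_def a1_def a2_def by (cases i; cases "i - 1"; simp)+
  have b: "b1 * Y = real j * b0" "b2 * Y = (real j - 1) * b1"
    unfolding b0_def b1_def b2_def by (cases j; cases "j - 1"; simp)+
  have c: "1 - x\<^sup>2 = - 4 * (X * Y)" "\<beta> - \<alpha> - (\<alpha> + \<beta> + 2) * x = - 2 * ((\<alpha> + 1) * Y + (\<beta> + 1) * X)"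
    by (simp_all add: X_def Y_def field_simps power2_eq_square)
  have m: "jmono i j x = X^i * Y^j" for i j by (simp add: jmono_def X_def Y_def)
  have d: "jmono' i j x = (a1 * b0 + a0 * b1) / 2" "jmono'' i j x = (a2 * b0 + 2 * (a1 * b1) + a0 * b2) / 4"
    by (simp_all add: jmono''_def jmono'_def m
        a0_def a1_def a2_def b0_def b1_def b2_def algebra_simps add_divide_distrib)
  have e: "real i * jmono (i - 1) (j + 1) x = a1 * b0 * Y" "jmono i j x = a0 * b0" "real j * jmono (i + 1)
      (j - 1) x = a0 * X * b1"
    by (simp_all add: m a0_def a1_def b0_def b1_def)
  have "(1 - x\<^sup>2) * jmono'' i j x + (\<beta> - \<alpha> - (\<alpha> + \<beta> + 2) * x) * jmono' i j x =
     - ((a2 * X) * b0 * Y + 2 * ((a1 * X) * (b1 * Y)) + a0 * X * (b2 * Y))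
     - ((\<alpha> + 1) * (a1 * b0 * Y + a0 * (b1 * Y)) + (\<beta> + 1) * ((a1 * X) * b0 + a0 * X * b1))"
    unfolding c d by (simp add: field_simps)
  also have "\<dots> = - ((real i + \<alpha>) * (a1 * b0 * Y)
       + (2 * real i * real j + (\<alpha> + 1) * real j + (\<beta> + 1) * real i) * (a0 * b0) + (real j + \<beta>) * (a0 * X *
           b1))"
    unfolding a b by (simp add: algebra_simps)
  also have "\<dots> = - (real i * (real i + \<alpha>) * jmono (i - 1) (j + 1) x
       + (2 * real i * real j + (\<alpha> + 1) * real j + (\<beta> + 1) * real i) * jmono i j x
       + real j * (real j + \<beta>) * jmono (i + 1) (j - 1) x)"
    unfolding e[symmetric] by (simp add: algebra_simps)
  finally show ?thesis .
qed

definition jcoeff :: "real \<Rightarrow> real \<Rightarrow> nat \<Rightarrow> nat \<Rightarrow> real" where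
  "jcoeff \<alpha> \<beta> n s = ((of_nat n + \<alpha>) gchoose (n - s)) * ((of_nat n + \<beta>) gchoose s)"

text \<open>Both binomials change by one step, each governed by \<open>gbinomial_mult_1\<close>.
  This ratio makes the outer terms of the tridiagonal action collapse onto the diagonal.\<close>

lemma jcoeff_rec:
  assumes "s < n"
  shows "jcoeff \<alpha> \<beta> n (Suc s) * (real (Suc s) * (real (Suc s) + \<alpha>)) = jcoeff \<alpha> \<beta> n s * (real (n - s) * (real
      (n - s) + \<beta>))"
proof -
  let ?a = "real n + \<alpha>" and ?b = "real n + \<beta>"
  obtain k where k: "n - s = Suc k" "n - Suc s = k" using assms by (cases "n - s") auto
  have n: "real n = real k + real s + 1" using k assms by linarith
  have 1: "(?a gchoose Suc k) * real (Suc k) = (?a gchoose k) * (\<alpha> + real s + 1)"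
    using gbinomial_mult_1[of ?a k] by (simp add: n algebra_simps)
  have 2: "(?b gchoose Suc s) * real (Suc s) = (?b gchoose s) * (real (n - s) + \<beta>)"
    using gbinomial_mult_1[of ?b s] assms by (simp add: of_nat_diff algebra_simps)
  have "jcoeff \<alpha> \<beta> n (Suc s) * (real (Suc s) * (real (Suc s) + \<alpha>)) = ((?a gchoose k) * (\<alpha> + real s + 1)) *
      ((?b gchoose Suc s) * real (Suc s))"
    by (simp add: jcoeff_def k add_ac)
  also have "\<dots> = ((?a gchoose Suc k) * real (Suc k)) * ((?b gchoose s) * (real (n - s) + \<beta>))"
      by (simp only: 1 2)
  also have "\<dots> = jcoeff \<alpha> \<beta> n s * (real (n - s) * (real (n - s) + \<beta>))" by (simp add: jcoeff_def k)
  finally show ?thesis .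
qed

lemma jacobiP_eq: "jacobiP \<alpha> \<beta> n x = (\<Sum>s\<le>n. jcoeff \<alpha> \<beta> n s * jmono s (n - s) x)"
  by (simp add: jacobiP_def jcoeff_def jmono_def mult.assoc)

definition jacobiP' :: "real \<Rightarrow> real \<Rightarrow> nat \<Rightarrow> real \<Rightarrow> real" where
  "jacobiP' \<alpha> \<beta> n x = (\<Sum>s\<le>n. jcoeff \<alpha> \<beta> n s * jmono' s (n - s) x)"

definition jacobiP'' :: "real \<Rightarrow> real \<Rightarrow> nat \<Rightarrow> real \<Rightarrow> real" where
  "jacobiP'' \<alpha> \<beta> n x = (\<Sum>s\<le>n. jcoeff \<alpha> \<beta> n s * jmono'' s (n - s) x)"

lemma DERIV_jacobiP: "(jacobiP \<alpha> \<beta> n has_real_derivative jacobiP' \<alpha> \<beta> n x) (at x)"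
  unfolding jacobiP_eq[abs_def] jacobiP'_def by (intro DERIV_sum DERIV_cmult DERIV_jmono)

lemma DERIV_jacobiP': "(jacobiP' \<alpha> \<beta> n has_real_derivative jacobiP'' \<alpha> \<beta> n x) (at x)"
  unfolding jacobiP'_def[abs_def] jacobiP''_def by (intro DERIV_sum DERIV_cmult DERIV_jmono')

lemma jacobiP_0: "jacobiP \<alpha> \<beta> 0 x = 1" "jacobiP' \<alpha> \<beta> 0 x = 0"
  by (simp_all add: jacobiP_def jacobiP'_def jmono'_def)

text \<open>At 1 only the term \<open>s = 0\<close> survives. Positivity at this point later
  excludes a vanishing norm.\<close>

lemma jacobiP_at_1_pos:
  assumes "\<alpha> > -1"
  shows "jacobiP \<alpha> \<beta> n 1 > 0"
proof -
  have "jacobiP \<alpha> \<beta> n 1 = (\<Sum>s\<le>n. if s = 0 then (real n + \<alpha>) gchoose n else 0)"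
    unfolding jacobiP_def by (intro sum.cong) auto
  also have "\<dots> = (real n + \<alpha>) gchoose n" by simp
  also have "\<dots> > 0" unfolding gbinomial_prod_rev
    using assms by (intro divide_pos_pos prod_pos) auto
  finally show ?thesis .
qed

text \<open>After index shifts all three terms of \<open>jmono_ode\<close> are multiples of the same
  product, and their total factor does not depend on \<open>s\<close>.\<close>

lemma jacobiP_ode:
  "(1 - x\<^sup>2) * jacobiP'' \<alpha> \<beta> n x + (\<beta> - \<alpha> - (\<alpha> + \<beta> + 2) * x) * jacobiP' \<alpha> \<beta> n x
     + real n * (real n + \<alpha> + \<beta> + 1) * jacobiP \<alpha> \<beta> n x = 0"
proof -
  let ?a = "jcoeff \<alpha> \<beta> n"
  let ?e = "\<lambda>s. jmono s (n - s) x"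
  let ?A = "\<lambda>s. real s * (real s + \<alpha>)" and ?B = "\<lambda>s. real (n - s) * (real (n - s) + \<beta>)"
  let ?M = "\<lambda>s. 2 * real s * real (n - s) + (\<alpha> + 1) * real (n - s) + (\<beta> + 1) * real s"
  \<comment> \<open>The term \<open>s = 0\<close> is 0; shifting the index exchanges the weight
    \<open>?A\<close> for \<open>?B\<close> through \<open>jcoeff_rec\<close>.\<close>
  have T1: "(\<Sum>s\<le>n. ?a s * (?A s * jmono (s - 1) (n - s + 1) x)) = (\<Sum>s\<le>n. ?a s * (?B s * ?e s))"
  proof (cases n)
    case (Suc n')
    have "(\<Sum>s\<le>n. ?a s * (?A s * jmono (s - 1) (n - s + 1) x)) = (\<Sum>s\<le>n'. ?a (Suc s) * (?A (Suc s) * jmono s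
        (n - Suc s + 1) x))"
      unfolding Suc by (subst sum.atMost_Suc_shift) simp
    also have "\<dots> = (\<Sum>s\<le>n'. ?a s * (?B s * ?e s))"
    proof (intro sum.cong refl)
      fix s assume "s \<in> {..n'}"
      then have s: "s < n" and e: "n - Suc s + 1 = n - s" using Suc by auto
      show "?a (Suc s) * (?A (Suc s) * jmono s (n - Suc s + 1) x) = ?a s * (?B s * ?e s)"
        unfolding e using jcoeff_rec[OF s, of \<alpha> \<beta>] by (simp only: mult.assoc[symmetric])
    qed
    also have "\<dots> = (\<Sum>s\<le>n. ?a s * (?B s * ?e s))" unfolding Suc by simp
    finally show ?thesis .
  qed simp
  \<comment> \<open>The opposite shift; here the term \<open>s = n\<close> is 0.\<close>
  have T3: "(\<Sum>s\<le>n. ?a s * (?B s * jmono (s + 1) (n - s - 1) x)) = (\<Sum>s\<le>n. ?a s * (?A s * ?e s))"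
  proof (cases n)
    case (Suc n')
    have "(\<Sum>s\<le>n. ?a s * (?A s * ?e s)) = (\<Sum>s\<le>n'. ?a (Suc s) * (?A (Suc s) * ?e (Suc s)))"
      unfolding Suc by (subst sum.atMost_Suc_shift) simp
    also have "\<dots> = (\<Sum>s\<le>n'. ?a s * (?B s * jmono (s + 1) (n - s - 1) x))"
    proof (intro sum.cong refl)
      fix s assume "s \<in> {..n'}"
      then have s: "s < n" using Suc by auto
      show "?a (Suc s) * (?A (Suc s) * ?e (Suc s)) = ?a s * (?B s * jmono (s + 1) (n - s - 1) x)"
        using jcoeff_rec[OF s, of \<alpha> \<beta>] by (simp add: mult.assoc[symmetric])
    qed
    also have "\<dots> = (\<Sum>s\<le>n. ?a s * (?B s * jmono (s + 1) (n - s - 1) x))" unfolding Suc by simp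
    finally show ?thesis by simp
  qed simp
  have "(1 - x\<^sup>2) * jacobiP'' \<alpha> \<beta> n x + (\<beta> - \<alpha> - (\<alpha> + \<beta> + 2) * x) * jacobiP' \<alpha> \<beta> n x =
     (\<Sum>s\<le>n. ?a s * ((1 - x\<^sup>2) * jmono'' s (n - s) x + (\<beta> - \<alpha> - (\<alpha> + \<beta> + 2) * x) * jmono' s (n - s) x))"
    unfolding jacobiP''_def jacobiP'_def sum_distrib_left sum.distrib[symmetric]
        by (intro sum.cong) (auto simp: algebra_simps)
  also have "\<dots> = - ((\<Sum>s\<le>n. ?a s * (?A s * jmono (s - 1) (n - s + 1) x)) + (\<Sum>s\<le>n. ?a s * (?M s * ?e s))
      + (\<Sum>s\<le>n. ?a s * (?B s * jmono (s + 1) (n - s - 1) x)))"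
    unfolding jmono_ode sum.distrib[symmetric] sum_negf[symmetric]
        by (intro sum.cong) (auto simp: algebra_simps)
  also have "\<dots> = - (\<Sum>s\<le>n. ?a s * ((?B s + ?M s + ?A s) * ?e s))"
    unfolding T1 T3 sum.distrib[symmetric] by (simp add: algebra_simps)
  also have "\<dots> = - (\<Sum>s\<le>n. real n * (real n + \<alpha> + \<beta> + 1) * (?a s * ?e s))"
  proof (intro arg_cong[where f=uminus] sum.cong refl)
    fix s assume "s \<in> {..n}"
    define k where "k = real (n - s)"
    have n: "real n = k + real s" using \<open>s \<in> {..n}\<close> by (simp add: k_def)
    have "?B s + ?M s + ?A s = real n * (real n + \<alpha> + \<beta> + 1)"
      unfolding n k_def[symmetric] by (simp add: algebra_simps)
    then show "?a s * ((?B s + ?M s + ?A s) * ?e s) = real n * (real n + \<alpha> + \<beta> + 1) * (?a s * ?e s)" by simp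
  qed
  also have "\<dots> = - (real n * (real n + \<alpha> + \<beta> + 1) * jacobiP \<alpha> \<beta> n x)" by (simp add: jacobiP_eq sum_distrib_left)
  finally show ?thesis by simp
qed

section \<open>Jacobi polynomials in the angular variable\<close>

text \<open>For \<open>a = \<beta> + 1/2\<close> and \<open>b = \<alpha> + 1/2\<close> this is, up
  to a constant, the square root of the weight transported by \<open>x = - cos t\<close>, Jacobian
  included.\<close>

definition rho :: "real \<Rightarrow> real \<Rightarrow> real \<Rightarrow> real" where
  "rho a b t = sin (t/2) powr a * cos (t/2) powr b"

lemma half_angle_nonneg: "0 \<le> t \<Longrightarrow> t \<le> pi \<Longrightarrow> sin (t/2) \<ge> 0" "0 \<le> t \<Longrightarrow> t \<le> pi \<Longrightarrow> cos (t/2) \<ge> 0"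
  by (auto intro: sin_ge_zero cos_ge_zero)

lemma rho_nonneg: "rho a b t \<ge> 0"
  by (simp add: rho_def)

lemma rho_le_1:
  assumes "a \<ge> 0" "b \<ge> 0" "0 \<le> t" "t \<le> pi"
  shows "rho a b t \<le> 1"
proof -
  have "sin (t/2) powr a \<le> 1" "cos (t/2) powr b \<le> 1"
    using half_angle_nonneg[OF assms(3,4)] assms(1,2) by (auto intro!: powr_le1)
  then show ?thesis unfolding rho_def by (intro mult_le_one) auto
qed

lemma rho_pos: "0 < t \<Longrightarrow> t < pi \<Longrightarrow> rho a b t > 0"
  using half_angle_pos[of t] by (simp add: rho_def)

text \<open>\<open>0 powr a\<close> is 0 even for \<open>a = 0\<close>. Hence \<open>rho\<close> may
  jump at an end when an exponent is 0, and continuity up to the ends has to come from positive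
  exponents.\<close>

lemma rho_ends: "rho a b 0 = 0" "rho a b pi = 0"
  by (simp_all add: rho_def)

lemma rho_mult: "rho a b t * rho a' b' t = rho (a + a') (b + b') t"
  by (simp add: rho_def powr_add)

text \<open>The factor \<open>sin t\<close> raises both exponents by 1, which makes nonnegative
  exponents positive and yields continuity up to the ends.\<close>

lemma rho_sin:
  assumes "0 \<le> t" "t \<le> pi"
  shows "rho a b t * sin t = 2 * rho (a + 1) (b + 1) t"
proof -
  have "sin t = 2 * sin (t/2) * cos (t/2)" using sin_double[of "t/2"] by simp
  then show ?thesis using half_angle_nonneg[OF assms] by (simp add: rho_def powr_add)
qed

lemma continuous_on_rho:
  assumes "a > 0" "b > 0"
  shows "continuous_on {0..pi} (rho a b)"
  unfolding rho_def using assms half_angle_nonneg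
  by (intro continuous_intros continuous_on_powr') auto

lemma DERIV_rho:
  assumes "0 < t" "t < pi"
  shows "(rho a b has_real_derivative jphi a b t * rho a b t) (at t)"
proof -
  note sc = half_angle_pos[OF assms]
  have 1: "((\<lambda>t. sin (t/2) powr a) has_real_derivative a * sin (t/2) powr (a - 1) * (cos (t/2) / 2)) (at t)"
    using sc by (auto intro!: derivative_eq_intros)
  have 2: "((\<lambda>t. cos (t/2) powr b) has_real_derivative b * cos (t/2) powr (b - 1) * (- sin (t/2) / 2)) (at t)"
    using sc by (auto intro!: derivative_eq_intros)
  have "((\<lambda>t. sin (t/2) powr a * cos (t/2) powr b) has_real_derivative
     (a * sin (t/2) powr (a - 1) * (cos (t/2) / 2)) * cos (t/2) powr b + (b * cos (t/2) powr (b - 1) * (-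
         sin (t/2) / 2)) * sin (t/2) powr a) (at t)"
    by (rule DERIV_mult[OF 1 2])
  moreover have "(a * sin (t/2) powr (a - 1) * (cos (t/2) / 2)) * cos (t/2) powr b + (b * cos (t/2) powr (b
      - 1) * (- sin (t/2) / 2)) * sin (t/2) powr a
     = jphi a b t * rho a b t"
    using sc by (simp add: jphi_def rho_def cot_def tan_def powr_diff field_simps)
  ultimately show ?thesis by (simp add: rho_def[abs_def])
qed

text \<open>Clears the half-angle denominators, for comparison with the first-order coefficient of
  the Jacobi equation at \<open>x = - cos t\<close>.\<close>

lemma jphi_sin:
  assumes "0 < t" "t < pi"
  shows "2 * (jphi a b t * sin t) = a * (1 + cos t) - b * (1 - cos t)"
proof -
  have s: "sin t = 2 * sin (t/2) * cos (t/2)" using sin_double[of "t/2"] by simp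
  have c: "1 + cos t = 2 * (cos (t/2))\<^sup>2" "1 - cos t = 2 * (sin (t/2))\<^sup>2"
    using cos_double_cos[of "t/2"] cos_double_sin[of "t/2"] by simp_all
  show ?thesis unfolding s c using half_angle_pos[OF assms]
    by (simp add: jphi_def cot_def tan_def field_simps power2_eq_square)
qed

lemma jacobi_weight_cos:
  assumes "0 \<le> t" "t \<le> pi"
  shows "jacobi_weight \<alpha> \<beta> (- cos t) * sin t = 2 powr (\<alpha> + \<beta> + 1) * (rho (\<beta> + 1/2) (\<alpha> + 1/2) t)\<^sup>2"
proof (cases "t = 0 \<or> t = pi")
  case True
  then show ?thesis by (auto simp: rho_ends)
next
  case False
  then have t: "0 < t" "t < pi" using assms by auto
  note sc = half_angle_pos[OF t]
  have s: "sin t = 2 * sin (t/2) * cos (t/2)" using sin_double[of "t/2"] by simp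
  have c: "1 + cos t = 2 * (cos (t/2))\<^sup>2" "1 - cos t = 2 * (sin (t/2))\<^sup>2"
    using cos_double_cos[of "t/2"] cos_double_sin[of "t/2"] by simp_all
  have sq: "(x\<^sup>2) powr a = x powr (2 * a)" if "x > 0" for x a :: real
    using that by (simp add: powr_powr powr_numeral[symmetric] del: powr_numeral)
  have "jacobi_weight \<alpha> \<beta> (- cos t) * sin t = (2 * (cos (t/2))\<^sup>2) powr \<alpha> * (2 * (sin (t/2))\<^sup>2) powr \<beta> * (2 *
      sin (t/2) * cos (t/2))"
    by (simp add: jacobi_weight_def s[symmetric] c[symmetric])
  also have "\<dots> = 2 powr (\<alpha> + \<beta> + 1) * (sin (t/2) powr (2 * \<beta> + 1) * cos (t/2) powr (2 * \<alpha> + 1))"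
    using sc by (simp add: powr_mult sq powr_add)
  also have "sin (t/2) powr (2 * \<beta> + 1) * cos (t/2) powr (2 * \<alpha> + 1) = (rho (\<beta> + 1/2) (\<alpha> + 1/2) t)\<^sup>2"
    unfolding power2_eq_square rho_mult by (simp add: rho_def)
  finally show ?thesis .
qed

lemma jacobi_weight_nonneg: "jacobi_weight \<alpha> \<beta> x \<ge> 0"
  by (simp add: jacobi_weight_def)

lemma measurable_jacobi_weight [measurable]: "jacobi_weight \<alpha> \<beta> \<in> borel_measurable borel"
  unfolding jacobi_weight_def[abs_def] by measurable

lemma continuous_jacobiP [continuous_intros]: "continuous_on A (jacobiP \<alpha> \<beta> n)" "continuous_on A (jacobiP' \<alpha>
    \<beta> n)"
  by (meson DERIV_jacobiP DERIV_jacobiP' DERIV_isCont continuous_at_imp_continuous_on)+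

lemma measurable_jacobiP [measurable]: "jacobiP \<alpha> \<beta> n \<in> borel_measurable borel"
  by (intro borel_measurable_continuous_onI continuous_intros)

section \<open>Orthonormal Jacobi functions and their first-order system\<close>

locale jacobi_params =
  fixes \<alpha> \<beta> :: real
  assumes alpha: "\<alpha> \<ge> -1/2" and beta: "\<beta> \<ge> -1/2"
begin

abbreviation "c \<equiv> \<alpha> + \<beta> + 1"
abbreviation "r \<equiv> rho (\<beta> + 1/2) (\<alpha> + 1/2)"
abbreviation "w \<equiv> jacobi_weight \<alpha> \<beta>"
abbreviation "h \<equiv> jacobi_sqnorm \<alpha> \<beta>"
abbreviation "p \<equiv> jacobi_p \<alpha> \<beta>"

lemma c_nonneg: "c \<ge> 0" using alpha beta by linarith

text \<open>After \<open>x = - cos t\<close> the weight times the Jacobian is bounded, both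
  exponents of \<open>r\<close> being nonnegative. Substitution in nonnegative integrals presupposes
  no integrability.\<close>

lemma weight_integrable: "set_integrable lborel {-1..1} w"
proof -
  have "(\<integral>\<^sup>+x. ennreal (w x * indicator {- cos 0..- cos pi} x) \<partial>lborel) =
        (\<integral>\<^sup>+x. ennreal (w (- cos x) * sin x * indicator {0..pi} x) \<partial>lborel)"
    by (rule nn_integral_substitution)
       (auto intro!: derivative_eq_intros continuous_intros sin_ge_zero simp: set_borel_measurable_def)
  also have "\<dots> \<le> (\<integral>\<^sup>+x. ennreal (2 powr c) * indicator {0..pi} x \<partial>lborel)"
  proof (intro nn_integral_mono)
    fix x
    have "w (- cos x) * sin x \<le> 2 powr c" if "0 \<le> x" "x \<le> pi"
      unfolding jacobi_weight_cos[OF that] using rho_le_1[OF _ _ that, of "\<beta> + 1/2" "\<alpha> + 1/2"] alpha beta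
      by (intro mult_left_le) (auto intro!: power_le_one rho_nonneg)
    then show "ennreal (w (- cos x) * sin x * indicator {0..pi} x) \<le> ennreal (2 powr c) * indicator {0..pi} x"
      by (auto simp: indicator_def intro!: ennreal_leI)
  qed
  also have "\<dots> < \<infinity>" by (simp add: nn_integral_cmult ennreal_mult_less_top)
  finally have fin: "(\<integral>\<^sup>+x. ennreal (w x * indicator {-1..1} x) \<partial>lborel) < \<infinity>" by simp
  show ?thesis unfolding set_integrable_def
  proof (rule integrableI_nonneg)
    show "(\<integral>\<^sup>+ x. ennreal (indicat_real {- 1..1} x *\<^sub>R w x) \<partial>lborel) < \<infinity>"
      using fin by (simp add: mult.commute)
  qed (auto simp: jacobi_weight_nonneg)
qed

lemma weighted_integrable:
  assumes g: "continuous_on UNIV g" and A: "A \<subseteq> {-1..1}" "A \<in> sets lborel"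
  shows "set_integrable lborel A (\<lambda>x. g x * w x)"
proof -
  have gm [measurable]: "g \<in> borel_measurable borel" using g by (rule borel_measurable_continuous_onI)
  have "bounded (g ` {-1..1})"
      by (intro compact_imp_bounded compact_continuous_image continuous_on_subset[OF g]) auto
  then obtain B where "\<forall>y\<in>g ` {-1..1}. norm y \<le> B" unfolding bounded_iff by blast
  then have B: "\<And>x. x \<in> {-1..1} \<Longrightarrow> \<bar>g x\<bar> \<le> B" by auto
  have "set_integrable lborel {-1..1} (\<lambda>x. g x * w x)"
    unfolding set_integrable_def
  proof (rule Bochner_Integration.integrable_bound)
    show "integrable lborel (\<lambda>x. B * (indicat_real {- 1..1} x *\<^sub>R w x))"
      using weight_integrable unfolding set_integrable_def by (rule integrable_mult_right)
    show "AE x in lborel. norm (indicat_real {- 1..1} x *\<^sub>R (g x * w x)) \<le> norm (B * (indicat_real {- 1..1}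
        x *\<^sub>R w x))"
    proof (intro AE_I2)
      fix x
      show "norm (indicat_real {- 1..1} x *\<^sub>R (g x * w x)) \<le> norm (B * (indicat_real {- 1..1} x *\<^sub>R w x))"
        using B[of x] jacobi_weight_nonneg[of \<alpha> \<beta> x]
        by (auto simp: indicator_def abs_mult intro!: mult_right_mono order_trans[OF B abs_ge_self])
    qed
  qed measurable
  then show ?thesis by (rule set_integrable_subset) (use A in auto)
qed

text \<open>The polynomial is positive just left of 1, where the weight is positive too, so the
  integrand cannot vanish almost everywhere.\<close>

lemma sqnorm_pos: "h n > 0"
proof -
  let ?f = "\<lambda>x. (jacobiP \<alpha> \<beta> n x)\<^sup>2 * w x"
  have int: "set_integrable lborel {-1..1} ?f"
    by (rule weighted_integrable) (auto intro!: continuous_intros)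
  have "isCont (jacobiP \<alpha> \<beta> n) 1" by (rule DERIV_isCont[OF DERIV_jacobiP])
  moreover have "jacobiP \<alpha> \<beta> n 1 > 0" using alpha by (intro jacobiP_at_1_pos) auto
  ultimately have "\<forall>\<^sub>F x in at 1. jacobiP \<alpha> \<beta> n x > 0"
      by (intro order_tendstoD(1)[of _ "jacobiP \<alpha> \<beta> n 1"]) (auto simp: isCont_def)
  then have "\<forall>\<^sub>F x in at_left 1. jacobiP \<alpha> \<beta> n x > 0" by (simp add: eventually_at_split)
  then obtain d where d: "d < 1" "\<And>x. d < x \<Longrightarrow> x < 1 \<Longrightarrow> jacobiP \<alpha> \<beta> n x > 0"
      unfolding eventually_at_left_field by blast
  \<comment> \<open>Taking it nonnegative keeps the interval away from -1, so that the weight is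
    positive on it.\<close>
  define d' where "d' = max d 0"
  have d': "d' < 1" "d' \<ge> 0" "d \<le> d'" using d by (auto simp: d'_def)
  have "h n \<noteq> 0"
  proof
    assume "h n = 0"
    then have "integral\<^sup>L lborel (\<lambda>x. indicat_real {-1..1} x *\<^sub>R ?f x) = 0"
        by (simp add: jacobi_sqnorm_def set_lebesgue_integral_def)
    then have "AE x in lborel. indicat_real {-1..1} x *\<^sub>R ?f x = 0"
      using int unfolding set_integrable_def
      by (subst (asm) integral_nonneg_eq_0_iff_AE) (auto simp: jacobi_weight_nonneg)
    then have "AE x in lborel. x \<notin> {d'<..<1}"
    proof eventually_elim
      case (elim x)
      show ?case
      proof
        assume x: "x \<in> {d'<..<1}"
        then have "jacobiP \<alpha> \<beta> n x > 0" using d' by (intro d(2)) auto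
        moreover have "w x > 0" using x d' by (simp add: jacobi_weight_def)
        ultimately show False using elim x d' by (auto simp: indicator_def split: if_splits)
      qed
    qed
    then have "emeasure lborel {d'<..<1} = 0" by (subst (asm) AE_iff_measurable[OF _ refl]) (auto simp:
        greaterThanLessThan_def greaterThan_def lessThan_def Int_def)
    then show False using d' by simp
  qed
  moreover have "h n \<ge> 0" unfolding jacobi_sqnorm_def set_lebesgue_integral_def
    by (intro integral_nonneg_AE AE_I2) (auto simp: jacobi_weight_nonneg)
  ultimately show ?thesis by simp
qed

text \<open>Everything is written in \<open>x = - cos t\<close>, so that \<open>x\<close> increases with \<open>t\<close>; hence \<open>\<beta>\<close> governs \<open>t = 0\<close>.
  At \<open>n = 0\<close> the junk value of \<open>v\<close> is \<open>0\<close>, which is consistent with the system.\<close>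
definition dp where "dp n x = jacobiP' \<alpha> \<beta> n x / sqrt (h n)"
definition lam where "lam n = real n * (real n + c)"
definition nu where "nu n = sqrt (lam n)"
definition u where "u n t = r t * p n (- cos t)"
definition flux where "flux n t = - (r t * (sin t * dp n (- cos t)))"
definition v where "v n t = flux n t / nu n"

lemma continuous_p [continuous_intros]: "continuous_on A (p n)" "continuous_on A (dp n)"
  unfolding dp_def[abs_def] jacobi_p_def[abs_def]
  by (intro continuous_intros; use sqnorm_pos[of n] in simp)+

lemma lam_nonneg: "lam n \<ge> 0" unfolding lam_def using c_nonneg by simp
lemma nu_nonneg: "nu n \<ge> 0" unfolding nu_def using lam_nonneg by simp
lemma nu_sq: "nu n * nu n = lam n" unfolding nu_def using lam_nonneg by simp

lemma nu_ge: "real n \<le> nu n"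
proof -
  have "lam n = (real n)\<^sup>2 + real n * c" by (simp add: lam_def power2_eq_square algebra_simps)
  moreover have "real n * c \<ge> 0" using c_nonneg by (intro mult_nonneg_nonneg) auto
  ultimately show ?thesis unfolding nu_def by (intro real_le_rsqrt) linarith
qed

lemma nu_le: "nu n \<le> real n + c/2"
proof -
  have "lam n + (c/2)\<^sup>2 = (real n + c/2)\<^sup>2" by (simp add: lam_def power2_eq_square field_simps)
  then have "lam n \<le> (real n + c/2)\<^sup>2" using zero_le_power2[of "c/2"] by linarith
  then show ?thesis unfolding nu_def using c_nonneg by (intro real_le_lsqrt) auto
qed

lemma nu_pos: "n \<ge> 1 \<Longrightarrow> nu n > 0" using nu_ge[of n] by linarith

text \<open>At \<open>n = 0\<close> the polynomial is constant and both sides vanish; the flux form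
  therefore covers every degree without division by \<open>nu n\<close>.\<close>

lemma flux_eq: "flux n t = nu n * v n t"
proof (cases "n = 0")
  case True
  then show ?thesis by (simp add: flux_def dp_def jacobiP_0 nu_def lam_def)
next
  case False
  then show ?thesis using nu_pos[of n] by (simp add: v_def)
qed

lemma DERIV_u:
  assumes "0 < t" "t < pi"
  shows "(u n has_real_derivative jphi (\<beta> + 1/2) (\<alpha> + 1/2) t * u n t - flux n t) (at t)"
proof -
  have P: "(p n has_real_derivative dp n x) (at x)" for x
    unfolding jacobi_p_def[abs_def] dp_def by (intro DERIV_cdivide DERIV_jacobiP)
  have "((\<lambda>t. p n (- cos t)) has_real_derivative dp n (- cos t) * sin t) (at t)"
    by (rule DERIV_chain2[where f="p n", OF P]) (auto intro!: derivative_eq_intros)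
  from DERIV_mult[OF DERIV_rho[OF assms, of "\<beta> + 1/2" "\<alpha> + 1/2"] this] show ?thesis
    unfolding u_def[abs_def] flux_def by (simp add: algebra_simps)
qed

lemma DERIV_flux:
  assumes t: "0 < t" "t < pi"
  shows "(flux n has_real_derivative lam n * u n t - jphi (\<beta> + 1/2) (\<alpha> + 1/2) t * flux n t) (at t)"
proof -
  let ?f = "jphi (\<beta> + 1/2) (\<alpha> + 1/2) t"
  define ddp where "ddp x = jacobiP'' \<alpha> \<beta> n x / sqrt (h n)" for x
  have P: "(dp n has_real_derivative ddp x) (at x)" for x
    unfolding ddp_def dp_def[abs_def] by (intro DERIV_cdivide DERIV_jacobiP')
  have 1: "((\<lambda>t. dp n (- cos t)) has_real_derivative ddp (- cos t) * sin t) (at t)"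
    by (rule DERIV_chain2[where f="dp n", OF P]) (auto intro!: derivative_eq_intros)
  let ?D = "dp n (- cos t)" and ?DD = "ddp (- cos t)" and ?P = "p n (- cos t)"
  have "(flux n has_real_derivative - (?f * r t * (sin t * ?D) + (cos t * ?D + ?DD * sin t * sin t) * r t))
      (at t)"
    unfolding flux_def[abs_def]
        by (rule DERIV_minus[OF DERIV_mult[OF DERIV_rho[OF t] DERIV_mult[OF DERIV_sin 1]]])
  moreover have "- (?f * r t * (sin t * ?D) + (cos t * ?D + ?DD * sin t * sin t) * r t) = lam n * u n t - ?f
      * flux n t"
  proof -
    have "((1 - (- cos t)\<^sup>2) * jacobiP'' \<alpha> \<beta> n (- cos t) + (\<beta> - \<alpha> - (\<alpha> + \<beta> + 2) * (- cos t)) * jacobiP' \<alpha> \<beta>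
        n (- cos t)
     + real n * (real n + \<alpha> + \<beta> + 1) * jacobiP \<alpha> \<beta> n (- cos t)) / sqrt (h n) = 0" unfolding jacobiP_ode by simp
    then have "(1 - (- cos t)\<^sup>2) * ?DD + (\<beta> - \<alpha> - (\<alpha> + \<beta> + 2) * (- cos t)) * ?D + real n * (real n + \<alpha> + \<beta> +
        1) * ?P = 0"
      by (simp only: add_divide_distrib times_divide_eq_right[symmetric] dp_def[symmetric]
          ddp_def[symmetric] jacobi_p_def[symmetric])
    moreover have sc: "1 - (- cos t)\<^sup>2 = sin t * sin t" using sin_squared_eq[of t]
        by (simp add: power2_eq_square)
    ultimately have "sin t * sin t * ?DD + (\<beta> - \<alpha> - (\<alpha> + \<beta> + 2) * (- cos t)) * ?D + real n * (real n + \<alpha> + \<beta>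
        + 1) * ?P = 0"
      by (simp only: sc)
    then have ode: "?DD * sin t * sin t = - (\<beta> - \<alpha> + (\<alpha> + \<beta> + 2) * cos t) * ?D - lam n * ?P"
      by (simp add: lam_def algebra_simps)
    \<comment> \<open>Adding \<open>cos t\<close>, the derivative of \<open>sin t\<close>, gives
      \<open>\<beta> - \<alpha> + (\<alpha> + \<beta> + 2) * cos t\<close>, the first-order
      coefficient in \<open>ode\<close>; so the terms in \<open>?D\<close> cancel.\<close>
    have fs: "2 * (?f * sin t) = \<beta> - \<alpha> + (\<alpha> + \<beta> + 1) * cos t"
      unfolding jphi_sin[OF t] by (simp add: field_simps)
    have "- (?f * r t * (sin t * ?D) + (cos t * ?D + ?DD * sin t * sin t) * r t) - (lam n * u n t - ?f *
        flux n t)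
       = - r t * ?D * (2 * (?f * sin t) + cos t) - r t * (?DD * sin t * sin t + lam n * ?P)"
      by (simp add: u_def flux_def algebra_simps)
    also have "\<dots> = 0" unfolding ode fs by (simp add: algebra_simps)
    finally show ?thesis by simp
  qed
  ultimately show ?thesis by simp
qed

lemma flux_continuous: "continuous_on {0..pi} (flux n)"
proof -
  have "continuous_on {0..pi} (\<lambda>t. - (2 * rho (\<beta> + 1/2 + 1) (\<alpha> + 1/2 + 1) t * dp n (- cos t)))"
    using alpha beta by (intro continuous_intros continuous_on_rho continuous_on_compose2[OF
        continuous_p(2)[of UNIV n]]) auto
  then show ?thesis
    by (rule continuous_on_eq) (simp add: flux_def rho_sin mult.assoc[symmetric])
qed

text \<open>\<open>u m\<close> may jump at an end when an exponent of \<open>r\<close> is 0, so the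
  factor \<open>sin t\<close> of the flux is absorbed into \<open>rho\<close> for the whole
  product.\<close>

lemma u_flux_continuous: "continuous_on {0..pi} (\<lambda>t. u m t * flux n t)"
proof -
  have "continuous_on {0..pi} (\<lambda>t. - (2 * rho (\<beta> + 1/2 + (\<beta> + 1/2) + 1) (\<alpha> + 1/2 + (\<alpha> + 1/2) + 1) t * p m (-
      cos t) * dp n (- cos t)))"
    using alpha beta by (intro continuous_intros continuous_on_rho continuous_on_compose2[OF
        continuous_p(2)[of UNIV n]] continuous_on_compose2[OF continuous_p(1)[of UNIV m]]) auto
  then show ?thesis
  proof (rule continuous_on_eq)
    fix t assume "t \<in> {0..pi}"
    then have "r t * r t * sin t = 2 * rho (\<beta> + 1/2 + (\<beta> + 1/2) + 1) (\<alpha> + 1/2 + (\<alpha> + 1/2) + 1) t"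
      unfolding rho_mult by (intro rho_sin) auto
    then show "- (2 * rho (\<beta> + 1/2 + (\<beta> + 1/2) + 1) (\<alpha> + 1/2 + (\<alpha> + 1/2) + 1) t * p m (- cos t) * dp n (-
        cos t)) = u m t * flux n t"
      by (simp only: flip: \<open>r t * r t * sin t = _\<close>) (simp add: u_def flux_def)
  qed
qed

lemma ends: "u n 0 = 0" "u n pi = 0" "flux n 0 = 0" "flux n pi = 0" "v n 0 = 0" "v n pi = 0"
  by (simp_all add: u_def flux_def v_def rho_ends)

text \<open>The boundary limits of \<open>v n\<close> come from continuity of the flux on the closed
  interval and its zero end values.\<close>

lemma jacobi_system:
  assumes "n \<ge> 1"
  shows "jacobi_system (\<beta> + 1/2) (\<alpha> + 1/2) (nu n) (u n) (v n)"
proof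
  note nn = nu_pos[OF assms]
  fix t :: real assume t: "0 < t" "t < pi"
  show "(u n has_real_derivative jphi (\<beta> + 1/2) (\<alpha> + 1/2) t * u n t - nu n * v n t) (at t)"
    using DERIV_u[OF t] by (simp add: flux_eq)
  have "((\<lambda>t. flux n t / nu n) has_real_derivative (lam n * u n t - jphi (\<beta> + 1/2) (\<alpha> + 1/2) t * flux n t) /
      nu n) (at t)"
    by (rule DERIV_cdivide[OF DERIV_flux[OF t]])
  moreover have "(lam n * u n t - jphi (\<beta> + 1/2) (\<alpha> + 1/2) t * flux n t) / nu n = nu n * u n t - jphi (\<beta> +
      1/2) (\<alpha> + 1/2) t * v n t"
    using nn by (simp add: nu_sq[symmetric] flux_eq field_simps)
  ultimately show "(v n has_real_derivative nu n * u n t - jphi (\<beta> + 1/2) (\<alpha> + 1/2) t * v n t) (at t)"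
    by (simp add: v_def[abs_def])
next
  have "continuous_on {0..pi} (v n)" unfolding v_def[abs_def] using nu_pos[OF assms]
    by (intro continuous_intros flux_continuous) auto
  then have "(v n \<longlongrightarrow> v n 0) (at 0 within {0..pi})" "(v n \<longlongrightarrow> v n pi) (at pi within {0..pi})"
    by (auto simp: continuous_on_def)
  then show "(v n \<longlongrightarrow> 0) (at_right 0)" "(v n \<longlongrightarrow> 0) (at_left pi)"
    by (simp_all add: ends at_within_Icc_at_right at_within_Icc_at_left)
qed (use alpha beta nu_pos[OF assms] in auto)

section \<open>Matrix entries as integrals in the angle\<close>

lemma kernel_substitution:
  assumes st: "0 \<le> s" "s \<le> t" "t \<le> pi"
  shows "set_integrable lborel {s..t} (\<lambda>x. u m x * u n x)"
    and "(\<integral>x\<in>{- cos s..- cos t}. p m x * p n x * w x \<partial>lborel) = 2 powr c * (\<integral>x\<in>{s..t}. u m x * u n x \<partial>lborel)"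
proof -
  let ?f = "\<lambda>x. p m x * p n x * w x"
  have eq: "?f (- cos x) * sin x = 2 powr c * (u m x * u n x)" if "x \<in> {s..t}" for x
  proof -
    have "?f (- cos x) * sin x = p m (- cos x) * p n (- cos x) * (w (- cos x) * sin x)"
        by (simp only: mult.assoc)
    also have "w (- cos x) * sin x = 2 powr c * (r x)\<^sup>2" using that st by (intro jacobi_weight_cos) auto
    finally show ?thesis by (simp add: u_def power2_eq_square mult_ac)
  qed
  have int: "set_integrable lborel {- cos s..- cos t} ?f"
    by (rule weighted_integrable) (auto intro!: continuous_intros simp: order_trans[OF cos_le_one] minus_le_iff)
  have a: "set_integrable lborel {s..t} (\<lambda>x. ?f (- cos x) * sin x)"
    and b: "(LBINT x. ?f x * indicator {- cos s..- cos t} x) = (LBINT x. ?f (- cos x) * sin x * indicator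
        {s..t} x)"
    using st by (intro integral_substitution[where g="\<lambda>t. - cos t" and a=s and b=t, OF int]; auto intro!:
        derivative_eq_intros continuous_intros sin_ge_zero)+
  have ind: "indicat_real {s..t} x *\<^sub>R (?f (- cos x) * sin x) = indicat_real {s..t} x *\<^sub>R (2 powr c * (u m x
      * u n x))" for x
  proof (cases "x \<in> {s..t}")
    case True
    show ?thesis by (simp only: eq[OF True])
  qed simp
  have "set_integrable lborel {s..t} (\<lambda>x. 2 powr c * (u m x * u n x))"
    using a unfolding set_integrable_def ind .
  then show "set_integrable lborel {s..t} (\<lambda>x. u m x * u n x)"
      by (subst (asm) set_integrable_mult_right_iff) auto
  have "(\<integral>x\<in>{- cos s..- cos t}. ?f x \<partial>lborel) = (LBINT x. ?f (- cos x) * sin x * indicator {s..t} x)"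
    unfolding b[symmetric] set_lebesgue_integral_def by (simp add: mult.commute)
  also have "\<dots> = (\<integral>x\<in>{s..t}. 2 powr c * (u m x * u n x) \<partial>lborel)"
    unfolding set_lebesgue_integral_def ind[symmetric] by (simp add: mult.commute)
  also have "\<dots> = 2 powr c * (\<integral>x\<in>{s..t}. u m x * u n x \<partial>lborel)" by simp
  finally show "(\<integral>x\<in>{- cos s..- cos t}. ?f x \<partial>lborel) = 2 powr c * (\<integral>x\<in>{s..t}. u m x * u n x \<partial>lborel)" .
qed

text \<open>Passage from the Lebesgue to the gauge integral, in which the fundamental theorem is
  applied.\<close>

lemma kernel_integral:
  assumes st: "0 \<le> s" "s \<le> t" "t \<le> pi"
  shows "(\<integral>x\<in>{- cos s..- cos t}. p m x * p n x * w x \<partial>lborel) = 2 powr c * integral {s..t} (\<lambda>x. u m x * u n x)"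
    and "(\<lambda>x. u m x * u n x) integrable_on {s..t}"
  using kernel_substitution[OF st, of m n] set_borel_integral_eq_integral[of "{s..t}" "\<lambda>x. u m x * u n x"]
      by auto

text \<open>Lagrange's identity: in the derivative of \<open>u m * flux n - u n * flux m\<close> the
  \<open>jphi\<close> terms and the products of two fluxes cancel. The interior form of the
  fundamental theorem is used because derivatives are known only between 0 and
  \<open>pi\<close>.\<close>

lemma kernel_offdiag:
  assumes st: "0 \<le> s" "s \<le> t" "t \<le> pi"
  shows "(lam n - lam m) * integral {s..t} (\<lambda>x. u m x * u n x) = (u m t * flux n t - u n t * flux m t) - (u
      m s * flux n s - u n s * flux m s)"
proof -
  have "((\<lambda>x. (lam n - lam m) * (u m x * u n x)) has_integral (u m t * flux n t - u n t * flux m t) - (u m s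
      * flux n s - u n s * flux m s)) {s..t}"
  proof (rule fundamental_theorem_of_calculus_interior[OF st(2)])
    show "continuous_on {s..t} (\<lambda>x. u m x * flux n x - u n x * flux m x)"
      by (rule continuous_on_subset[of "{0..pi}"]) (use st in \<open>auto intro!: continuous_intros
          u_flux_continuous\<close>)
    fix x assume "x \<in> {s<..<t}"
    then have x: "0 < x" "x < pi" using st by auto
    show "((\<lambda>x. u m x * flux n x - u n x * flux m x) has_vector_derivative (lam n - lam m) * (u m x * u n
        x)) (at x)"
      unfolding has_real_derivative_iff_has_vector_derivative[symmetric]
      by (rule DERIV_cong[OF DERIV_diff[OF DERIV_mult[OF DERIV_u[OF x] DERIV_flux[OF x]] DERIV_mult[OF
          DERIV_u[OF x] DERIV_flux[OF x]]]])
         (simp add: algebra_simps)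
  qed
  then have "integral {s..t} (\<lambda>x. (lam n - lam m) * (u m x * u n x)) = (u m t * flux n t - u n t * flux m t)
      - (u m s * flux n s - u n s * flux m s)"
    by (rule integral_unique)
  then show ?thesis by simp
qed

section \<open>Square norms and the uniform bound\<close>

lemma u_square_integral: "((\<lambda>x. (u n x)\<^sup>2) has_integral 2 powr (- c)) {0..pi}"
proof -
  have "(\<integral>x\<in>{-1..1}. p n x * p n x * w x \<partial>lborel) = (\<integral>x\<in>{-1..1}. (jacobiP \<alpha> \<beta> n x)\<^sup>2 * w x / h n \<partial>lborel)"
    unfolding set_lebesgue_integral_def
    by (intro Bochner_Integration.integral_cong refl) (use sqnorm_pos[of n] in \<open>auto simp: jacobi_p_def
        power2_eq_square\<close>)
  also have "\<dots> = h n / h n" by (simp add: jacobi_sqnorm_def)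
  also have "\<dots> = 1" using sqnorm_pos[of n] by simp
  finally have "2 powr c * integral {0..pi} (\<lambda>x. u n x * u n x) = 1" using kernel_integral(1)[of 0 pi n n]
      by simp
  then have "integral {0..pi} (\<lambda>x. (u n x)\<^sup>2) = 2 powr (- c)" unfolding power2_eq_square powr_minus
      by (metis inverse_unique)
  moreover have "(\<lambda>x. (u n x)\<^sup>2) integrable_on {0..pi}" using kernel_integral(2)[of 0 pi n n]
      by (simp add: power2_eq_square)
  ultimately show ?thesis by (metis integrable_integral)
qed

text \<open>\<open>(u v)' = nu n * (u^2 - v^2)\<close>, and \<open>u v\<close> vanishes at both
  ends; so \<open>v n\<close> and \<open>u n\<close> have equal square integrals.\<close>

lemma v_square_integral:
  assumes "n \<ge> 1"
  shows "((\<lambda>x. (v n x)\<^sup>2) has_integral 2 powr (- c)) {0..pi}"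
proof -
  interpret jacobi_system "\<beta> + 1/2" "\<alpha> + 1/2" "nu n" "u n" "v n" by (rule jacobi_system[OF assms])
  have "((\<lambda>x. nu n * ((u n x)\<^sup>2 - (v n x)\<^sup>2)) has_integral u n pi * v n pi - u n 0 * v n 0) {0..pi}"
  proof (rule fundamental_theorem_of_calculus_interior)
    have "continuous_on {0..pi} (\<lambda>x. u n x * flux n x / nu n)" using nu
        by (intro continuous_intros u_flux_continuous) auto
    then show "continuous_on {0..pi} (\<lambda>x. u n x * v n x)" by (simp add: v_def)
    fix x assume "x \<in> {0<..<pi}"
    then have x: "0 < x" "x < pi" by auto
    show "((\<lambda>x. u n x * v n x) has_vector_derivative nu n * ((u n x)\<^sup>2 - (v n x)\<^sup>2)) (at x)"
      unfolding has_real_derivative_iff_has_vector_derivative[symmetric]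
      by (rule DERIV_cong[OF DERIV_mult[OF du[OF x] dv[OF x]]]) (simp add: algebra_simps power2_eq_square)
  qed auto
  then have "((\<lambda>x. (1 / nu n) * (nu n * ((u n x)\<^sup>2 - (v n x)\<^sup>2))) has_integral (1 / nu n) * 0) {0..pi}"
    by (intro has_integral_mult_right) (simp add: ends)
  then have "((\<lambda>x. (u n x)\<^sup>2 - (v n x)\<^sup>2) has_integral 0) {0..pi}" using nu by simp
  from has_integral_diff[OF u_square_integral[of n] this] show ?thesis by simp
qed

text \<open>Large degrees are handled by the averaged energy estimate, the finitely many others by
  compactness.\<close>

lemma uniform_bound:
  obtains C where "C > 0" "\<And>n t. 0 \<le> t \<Longrightarrow> t \<le> pi \<Longrightarrow> \<bar>u n t\<bar> \<le> C" "\<And>n t. 0 \<le> t \<Longrightarrow> t \<le> pi \<Longrightarrow> \<bar>v n t\<bar> \<le> C"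
proof -
  \<comment> \<open>Ensures \<open>n \<ge> 1\<close> and \<open>2 * c \<le> nu n\<close> for
    \<open>n \<ge> N\<close>; in this system \<open>\<kappa> + \<mu>\<close> is
    \<open>c\<close>.\<close>
  define N where "N = nat \<lceil>2 * c\<rceil> + 1"
  have single: "\<exists>B. \<forall>t. 0 \<le> t \<and> t \<le> pi \<longrightarrow> \<bar>u n t\<bar> \<le> B \<and> \<bar>v n t\<bar> \<le> B" for n
  proof -
    have "bounded (p n ` {-1..1})" "bounded (dp n ` {-1..1})"
        by (intro compact_imp_bounded compact_continuous_image continuous_p; simp)+
    then obtain B1 B2 where "\<forall>y\<in>p n ` {-1..1}. norm y \<le> B1" "\<forall>y\<in>dp n ` {-1..1}. norm y \<le> B2"
      unfolding bounded_iff by blast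
    then have B: "\<And>x. x \<in> {-1..1} \<Longrightarrow> \<bar>p n x\<bar> \<le> B1" "\<And>x. x \<in> {-1..1} \<Longrightarrow> \<bar>dp n x\<bar> \<le> B2" by auto
    have "\<bar>u n t\<bar> \<le> max B1 (B2 / nu n) \<and> \<bar>v n t\<bar> \<le> max B1 (B2 / nu n)" if t: "0 \<le> t" "t \<le> pi" for t
    proof -
      have r: "0 \<le> r t" "r t \<le> 1" using rho_nonneg rho_le_1[OF _ _ t] alpha beta by auto
      have x: "- cos t \<in> {-1..1}" by (simp add: minus_le_iff)
      have "\<bar>u n t\<bar> = r t * \<bar>p n (- cos t)\<bar>" using r by (simp add: u_def abs_mult)
      also have "\<dots> \<le> 1 * B1" using r B(1)[OF x] by (intro mult_mono) auto
      finally have 1: "\<bar>u n t\<bar> \<le> B1" by simp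
      have "\<bar>flux n t\<bar> = r t * (\<bar>sin t\<bar> * \<bar>dp n (- cos t)\<bar>)" using r by (simp add: flux_def abs_mult)
      also have "\<dots> \<le> 1 * (1 * B2)" using r B(2)[OF x] by (intro mult_mono) auto
      \<comment> \<open>For \<open>n = 0\<close> both quotients are 0, since
        \<open>nu 0 = 0\<close>.\<close>
      finally have "\<bar>v n t\<bar> \<le> B2 / nu n" using nu_nonneg[of n] by (simp add: v_def divide_right_mono)
      with 1 show ?thesis by auto
    qed
    then show ?thesis by blast
  qed
  then obtain B where B: "\<And>n t. 0 \<le> t \<Longrightarrow> t \<le> pi \<Longrightarrow> \<bar>u n t\<bar> \<le> B n" "\<And>n t. 0 \<le> t \<Longrightarrow> t \<le> pi \<Longrightarrow> \<bar>v n t\<bar> \<le> B n" by metis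
  have B0: "B n \<ge> 0" for n using B(1)[of 0 n] pi_ge_zero by linarith
  \<comment> \<open>The last factor 2 bounds the total energy \<open>2 * 2 powr (- c)\<close>, as
    \<open>c \<ge> 0\<close>.\<close>
  define K where "K = 3 * exp (2 + 4 * c) * 2"
  have large: "\<bar>u n t\<bar> \<le> sqrt K \<and> \<bar>v n t\<bar> \<le> sqrt K" if n: "n \<ge> N" and t: "0 \<le> t" "t \<le> pi" for n t
  proof (cases "t = 0 \<or> t = pi")
    case True
    then show ?thesis by (auto simp: ends K_def)
  next
    case False
    then have t': "0 < t" "t < pi" using t by auto
    have n1: "n \<ge> 1" using n by (simp add: N_def)
    interpret jacobi_system "\<beta> + 1/2" "\<alpha> + 1/2" "nu n" "u n" "v n" by (rule jacobi_system[OF n1])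
    have "2 * c \<le> real N" unfolding N_def by linarith
    also have "\<dots> \<le> nu n" using n nu_ge[of n] by linarith
    finally have "energy t \<le> 3 * exp (2 + 4 * (\<beta> + 1/2 + (\<alpha> + 1/2))) * integral {pi/3..2*pi/3} energy"
      by (intro energy_le_integral t') simp
    also have "\<dots> \<le> 3 * exp (2 + 4 * (\<beta> + 1/2 + (\<alpha> + 1/2))) * 2"
    proof (intro mult_left_mono)
      have E: "(energy has_integral (2 powr (- c) + 2 powr (- c))) {0..pi}"
        unfolding energy_def by (intro has_integral_add u_square_integral v_square_integral n1)
      have "integral {pi/3..2*pi/3} energy \<le> integral {0..pi} energy"
        using pi_gt_zero has_integral_integrable[OF E]
        by (intro integral_subset_le) (auto intro: integrable_on_subinterval simp: energy_nonneg)
      also have "\<dots> = 2 * 2 powr (- c)" using integral_unique[OF E] by simp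
      also have "2 powr (- c) \<le> 2 powr 0" using c_nonneg by (intro powr_mono) auto
      finally show "integral {pi/3..2*pi/3} energy \<le> 2" by simp
    qed auto
    finally have e: "energy t \<le> K" by (simp add: K_def add_ac)
    have "(u n t)\<^sup>2 \<le> K" "(v n t)\<^sup>2 \<le> K" using e zero_le_power2[of "u n t"] zero_le_power2[of "v n t"]
        unfolding energy_def by linarith+
    then show ?thesis by (metis real_sqrt_abs real_sqrt_le_mono)
  qed
  define C where "C = sqrt K + (\<Sum>n<N. B n) + 1"
  have s0: "(\<Sum>n<N. B n) \<ge> 0" using B0 by (intro sum_nonneg) auto
  have K0: "sqrt K \<ge> 0" by (simp add: K_def)
  have "\<bar>u n t\<bar> \<le> C \<and> \<bar>v n t\<bar> \<le> C" if t: "0 \<le> t" "t \<le> pi" for n t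
  proof (cases "n < N")
    case True
    then have "B n \<le> (\<Sum>n<N. B n)" using B0 by (intro member_le_sum) auto
    then show ?thesis using B[OF t, of n] K0 unfolding C_def by linarith
  next
    case False
    then have "\<bar>u n t\<bar> \<le> sqrt K \<and> \<bar>v n t\<bar> \<le> sqrt K" using t by (intro large) auto
    then show ?thesis using s0 unfolding C_def by linarith
  qed
  moreover have "C > 0" using s0 K0 unfolding C_def by linarith
  ultimately show thesis using that by blast
qed

end

section \<open>The interval multipliers\<close>

context jacobi_params
begin

text \<open>For \<open>n \<noteq> m\<close>, \<open>(n + c/2) / (lam n - lam m)\<close> is half the sum of \<open>1 / (n - m)\<close> and \<open>1 / (n + m + c)\<close>, and
  \<open>(m + c/2) / (lam n - lam m)\<close> is half their difference.\<close>
definition nu_ratio where "nu_ratio n = nu n / (real n + c/2)"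

lemma nu_ratio_bound: "\<bar>nu_ratio n\<bar> \<le> 1"
proof -
  have "0 \<le> nu n / (real n + c/2)" "nu n / (real n + c/2) \<le> 1"
    using nu_nonneg[of n] nu_le[of n] c_nonneg by (auto intro!: divide_nonneg_nonneg divide_le_eq_1[THEN iffD2])
  then show ?thesis unfolding nu_ratio_def by linarith
qed

lemma nu_eq: "nu n = nu_ratio n * (real n + c/2)"
  using nu_nonneg[of n] nu_le[of n] by (auto simp: nu_ratio_def)

text \<open>Zero on the diagonal, so that \<open>endpoint_kernel\<close> vanishes there and the
  diagonal of the multiplier enters as a separate term.\<close>

definition hankel_part where "hankel_part n m = (if n = m then 0 else 1 / (real n + real m + c))"

text \<open>Off the diagonal this is twice the boundary term of \<open>kernel_offdiag\<close>
  divided by \<open>lam n - lam m\<close>, written as four kernels with bounded factors on either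
  side.\<close>

definition endpoint_kernel where "endpoint_kernel t n m =
   ((nu_ratio n * v n t) * (1 / (real n - real m)) * u m t + (nu_ratio n * v n t) * hankel_part n m * u m t)
   + ((- u n t) * (1 / (real n - real m)) * (nu_ratio m * v m t) + u n t * hankel_part n m * (nu_ratio m * v
       m t))"

text \<open>Division by \<open>lam n - lam m\<close> in \<open>kernel_offdiag\<close>, with one
  kernel per endpoint. The factors 1 give the terms the shape expected by
  \<open>lp_kernel_mult\<close>.\<close>

lemma kernel_eq:
  assumes st: "0 \<le> s" "s \<le> t" "t \<le> pi"
  shows "(\<integral>x\<in>{- cos s..- cos t}. p m x * p n x * w x \<partial>lborel) =
    ((2 powr c / 2) * endpoint_kernel t n m * 1 + (- (2 powr c / 2)) * endpoint_kernel s n m * 1)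
    + (if n = m then 2 powr c * integral {s..t} (\<lambda>x. (u n x)\<^sup>2) else 0)"
proof (cases "n = m")
  case True
  then show ?thesis unfolding kernel_integral(1)[OF st]
      by (simp add: endpoint_kernel_def hankel_part_def power2_eq_square)
next
  case False
  define d where "d = lam n - lam m"
  have nm: "real n + real m + c > 0" "real n - real m \<noteq> 0" using False c_nonneg by auto
  have d: "d = (real n - real m) * (real n + real m + c)" by (simp add: d_def lam_def algebra_simps)
  have d0: "d \<noteq> 0" using nm by (simp add: d)
  define H P where "H = 1 / (real n - real m)" and "P = 1 / (real n + real m + c)"
  have f: "(real n + c/2) / d = (H + P) / 2" "(real m + c/2) / d = (H - P) / 2"
    using nm unfolding d H_def P_def by (auto simp: divide_simps) (auto simp: algebra_simps)
  have kerHP: "endpoint_kernel x n m = nu_ratio n * v n x * H * u m x + nu_ratio n * v n x * P * u m x + (-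
      u n x * H * (nu_ratio m * v m x) + u n x * P * (nu_ratio m * v m x))" for x
    using False by (simp only: endpoint_kernel_def hankel_part_def H_def P_def if_False)
  have k: "(u m x * flux n x - u n x * flux m x) / d = endpoint_kernel x n m / 2" for x
  proof -
    have "(u m x * flux n x - u n x * flux m x) / d = nu_ratio n * v n x * u m x * ((real n + c/2) / d) -
        nu_ratio m * v m x * u n x * ((real m + c/2) / d)"
      unfolding flux_eq nu_eq by (simp add: diff_divide_distrib mult_ac)
    also have "\<dots> = endpoint_kernel x n m / 2" unfolding f kerHP by (simp add: field_simps)
    finally show ?thesis .
  qed
  have "integral {s..t} (\<lambda>x. u m x * u n x) = ((u m t * flux n t - u n t * flux m t) - (u m s * flux n s - u
      n s * flux m s)) / d"
    using kernel_offdiag[OF st, of n m] d0 by (simp add: d_def eq_divide_eq mult.commute)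
  also have "\<dots> = endpoint_kernel t n m / 2 - endpoint_kernel s n m / 2"
      unfolding diff_divide_distrib[of "u m t * flux n t - u n t * flux m t"] k ..
  finally have I: "integral {s..t} (\<lambda>x. u m x * u n x) = endpoint_kernel t n m / 2 - endpoint_kernel s n m /
      2" .
  show ?thesis unfolding kernel_integral(1)[OF st] I using False by (simp add: algebra_simps)
qed

text \<open>The endpoints enter only through uniformly bounded factors \<open>u\<close> and
  \<open>v\<close> and a diagonal bounded by 1, so one \<open>B\<close> serves all
  intervals.\<close>

lemma interval_kernel_lp:
  assumes q: "q > 1"
  shows "\<exists>B. \<forall>s t. 0 \<le> s \<and> s \<le> t \<and> t \<le> pi \<longrightarrow> lp_kernel q B (\<lambda>n m. \<integral>x\<in>{- cos s..- cos t}. p m x * p n x * w x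
      \<partial>lborel)"
proof -
  obtain C where C: "C > 0" "\<And>n t. 0 \<le> t \<Longrightarrow> t \<le> pi \<Longrightarrow> \<bar>u n t\<bar> \<le> C" "\<And>n t. 0 \<le> t \<Longrightarrow> t \<le> pi \<Longrightarrow> \<bar>v n t\<bar> \<le> C"
    using uniform_bound by blast
  have q0: "q \<ge> 0" using q by simp
  obtain B1 where B1: "lp_kernel q B1 (\<lambda>n m. 1 / (real n - real m))" using lp_kernel_hilbert[OF q] by blast
  obtain B0 where B0: "lp_kernel q B0 (\<lambda>n m. 1 / (real n + real m + 1))" using lp_kernel_hankel[OF q] by blast
  obtain B2 where B2: "lp_kernel q B2 hankel_part"
  proof -
    have "lp_kernel q (2 powr q * B0 * 1 powr q) (\<lambda>n m. 2 * (1 / (real n + real m + 1)) * 1)"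
      by (rule lp_kernel_mult[OF B0 q0]) auto
    then have "lp_kernel q (2 powr q * B0 * 1 powr q) hankel_part"
    proof (rule lp_kernel_mono[OF _ _ q0])
      fix n m
      show "\<bar>hankel_part n m\<bar> \<le> 2 * (1 / (real n + real m + 1)) * 1"
      proof (cases "n = m")
        \<comment> \<open>Off the diagonal \<open>n + m \<ge> 1\<close>, so the two denominators are
          comparable even for \<open>c = 0\<close>.\<close>
        case False
        then have "real n + real m \<ge> 1" by linarith
        moreover have "x + 1 \<le> 2 * (x + y) \<and> 0 < x + y" if "x \<ge> 1" "y \<ge> 0" for x y :: real using that by auto
        ultimately have "real n + real m + 1 \<le> 2 * (real n + real m + c)" "real n + real m + c > 0"
            using c_nonneg by blast+
        then show ?thesis using False by (simp add: hankel_part_def divide_simps)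
      qed (simp add: hankel_part_def)
    qed
    then show thesis by (rule that)
  qed
  define D1 D2 where "D1 = C powr q * B1 * C powr q" and "D2 = C powr q * B2 * C powr q"
  define D3 where "D3 = 2 powr q * (2 powr q * (D1 + D2) + 2 powr q * (D1 + D2))"
  define D4 where "D4 = (2 powr c / 2) powr q * D3 * 1 powr q"
  have ker: "lp_kernel q D3 (endpoint_kernel t)" if t: "0 \<le> t" "t \<le> pi" for t
  proof -
    have rv: "\<bar>nu_ratio n * v n t\<bar> \<le> C" for n
      using mult_mono[OF nu_ratio_bound[of n] C(3)[OF t, of n]] by (simp add: abs_mult)
    have uu: "\<bar>u n t\<bar> \<le> C" "\<bar>- u n t\<bar> \<le> C" for n using C(2)[OF t, of n] by auto
    have "lp_kernel q D3 (\<lambda>n m. ((nu_ratio n * v n t) * (1 / (real n - real m)) * u m t + (nu_ratio n * v n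
        t) * hankel_part n m * u m t)
      + ((- u n t) * (1 / (real n - real m)) * (nu_ratio m * v m t) + u n t * hankel_part n m * (nu_ratio m
          * v m t)))"
      unfolding D3_def D1_def D2_def
      by (intro lp_kernel_add[OF _ _ q0] lp_kernel_mult[OF B1 q0] lp_kernel_mult[OF B2 q0] rv uu)
    then show ?thesis by (simp add: endpoint_kernel_def[abs_def])
  qed
  have ker2: "lp_kernel q D4 (\<lambda>n m. a * endpoint_kernel t n m * 1)"
      if t: "0 \<le> t" "t \<le> pi" and a: "\<bar>a\<bar> = 2 powr c / 2" for t a
    unfolding D4_def by (rule lp_kernel_mult[OF ker[OF t] q0]) (use a in auto)
  show ?thesis
  proof (rule exI[of _ "2 powr q * (2 powr q * (D4 + D4) + 1 powr q)"], intro allI impI)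
    fix s t :: real assume "0 \<le> s \<and> s \<le> t \<and> t \<le> pi"
    then have st: "0 \<le> s" "s \<le> t" "t \<le> pi" by auto
    \<comment> \<open>The integral over part of the interval is at most the whole one,
      \<open>2 powr (- c)\<close>.\<close>
    have diag: "\<bar>2 powr c * integral {s..t} (\<lambda>x. (u n x)\<^sup>2)\<bar> \<le> 1" for n
    proof -
      have i: "(\<lambda>x. (u n x)\<^sup>2) integrable_on {0..pi}" using u_square_integral by blast
      have i2: "(\<lambda>x. (u n x)\<^sup>2) integrable_on {s..t}" by (rule integrable_on_subinterval[OF i]) (use st in auto)
      have "integral {s..t} (\<lambda>x. (u n x)\<^sup>2) \<le> integral {0..pi} (\<lambda>x. (u n x)\<^sup>2)"
        using st by (intro integral_subset_le i i2) auto
      also have "\<dots> = 2 powr (- c)" by (rule integral_unique[OF u_square_integral])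
      finally have "2 powr c * integral {s..t} (\<lambda>x. (u n x)\<^sup>2) \<le> 2 powr c * 2 powr (- c)"
          by (intro mult_left_mono) auto
      also have "\<dots> = 1" by (simp only: powr_add[symmetric]) simp
      finally have 1: "2 powr c * integral {s..t} (\<lambda>x. (u n x)\<^sup>2) \<le> 1" .
      have "0 \<le> 2 powr c * integral {s..t} (\<lambda>x. (u n x)\<^sup>2)"
          by (intro mult_nonneg_nonneg integral_nonneg i2) auto
      with 1 show ?thesis by linarith
    qed
    show "lp_kernel q (2 powr q * (2 powr q * (D4 + D4) + 1 powr q)) (\<lambda>n m. \<integral>x\<in>{- cos s..- cos t}. p m x * p
        n x * w x \<partial>lborel)"
      unfolding kernel_eq[OF st]
      by (intro lp_kernel_add[OF _ _ q0] ker2 lp_kernel_diag[OF diag q0]) (use st in auto)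
  qed
qed

lemma interval_mult_bounded:
  assumes q: "q > 1"
  shows "\<exists>C. \<forall>f a b. in_lp q f \<and> -1 \<le> a \<and> a \<le> b \<and> b \<le> 1 \<longrightarrow>
     in_lp q (interval_mult \<alpha> \<beta> a b f) \<and> lp_norm q (interval_mult \<alpha> \<beta> a b f) \<le> C * lp_norm q f"
proof -
  obtain B where B: "\<And>s t. 0 \<le> s \<and> s \<le> t \<and> t \<le> pi \<Longrightarrow> lp_kernel q B (\<lambda>n m. \<integral>x\<in>{- cos s..- cos t}. p m x * p n
      x * w x \<partial>lborel)"
    using interval_kernel_lp[OF q] by blast
  show ?thesis
  proof (rule exI[of _ "B powr (1/q)"], intro allI impI, elim conjE)
    fix f a b assume f: "in_lp q f" and ab: "-1 \<le> a" "a \<le> b" "b \<le> (1::real)"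
    \<comment> \<open>Every subinterval arises from two angles; \<open>x = - cos t\<close> is
      increasing, so their order is preserved.\<close>
    have cs: "- cos (arccos (- a)) = a" "- cos (arccos (- b)) = b" using ab by simp_all
    have st: "0 \<le> arccos (- a) \<and> arccos (- a) \<le> arccos (- b) \<and> arccos (- b) \<le> pi"
      using ab by (auto intro!: arccos_lbound arccos_ubound arccos_le_mono[THEN iffD2])
    have k: "lp_kernel q B (\<lambda>n m. \<integral>x\<in>{a..b}. p m x * p n x * w x \<partial>lborel)" using B[OF st] by (simp only: cs)
    have T: "interval_mult \<alpha> \<beta> a b f = (\<lambda>n. \<Sum>m. (\<integral>x\<in>{a..b}. p m x * p n x * w x \<partial>lborel) * f m)"
      unfolding interval_mult_def[abs_def] by (simp only: mult.commute[of "f _"])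
    show "in_lp q (interval_mult \<alpha> \<beta> a b f) \<and> lp_norm q (interval_mult \<alpha> \<beta> a b f) \<le> B powr (1/q) * lp_norm q f"
      unfolding T using lp_kernel_bounded_operator[OF k _ f] q by simp
  qed
qed

section \<open>Failure at exponent 1\<close>

lemma interval_mult_unbounded_l1:
  "\<not> (\<exists>C. \<forall>f a b. in_lp 1 f \<and> -1 \<le> a \<and> a \<le> b \<and> b \<le> 1 \<longrightarrow>
     in_lp 1 (interval_mult \<alpha> \<beta> a b f) \<and> lp_norm 1 (interval_mult \<alpha> \<beta> a b f) \<le> C * lp_norm 1 f)"
proof
  assume "\<exists>C. \<forall>f a b. in_lp 1 f \<and> -1 \<le> a \<and> a \<le> b \<and> b \<le> 1 \<longrightarrow>
     in_lp 1 (interval_mult \<alpha> \<beta> a b f) \<and> lp_norm 1 (interval_mult \<alpha> \<beta> a b f) \<le> C * lp_norm 1 f"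
  then obtain C where C: "\<And>f a b. in_lp 1 f \<Longrightarrow> -1 \<le> a \<Longrightarrow> a \<le> b \<Longrightarrow> b \<le> 1 \<Longrightarrow>
     in_lp 1 (interval_mult \<alpha> \<beta> a b f) \<and> lp_norm 1 (interval_mult \<alpha> \<beta> a b f) \<le> C * lp_norm 1 f" by blast
  obtain D where D: "D > 0" "\<And>n t. 0 \<le> t \<Longrightarrow> t \<le> pi \<Longrightarrow> \<bar>u n t\<bar> \<le> D" "\<And>n t. 0 \<le> t \<Longrightarrow> t \<le> pi \<Longrightarrow> \<bar>v n t\<bar> \<le> D"
    using uniform_bound by blast
  define e where "e = (\<lambda>m::nat. if m = 0 then 1 else (0::real))"
  have e_sums: "(\<lambda>m. \<bar>e m\<bar> powr 1) sums 1"
    using sums_single[of 0 "\<lambda>_. 1::real"] by (simp add: e_def if_distrib[of abs] cong: if_cong)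
  have e: "in_lp 1 e" "lp_norm 1 e = 1"
    using e_sums by (simp_all only: in_lp_def lp_norm_def sums_summable sums_unique[symmetric]) simp_all
  have bound: "(\<Sum>n<M. 2 powr c * (u 0 s * \<bar>v (Suc n) s\<bar> / nu (Suc n))) \<le> C" if s: "0 \<le> s" "s \<le> pi" for s M
  proof -
    define T where "T = interval_mult \<alpha> \<beta> (- cos s) 1 e"
    have T: "T n = 2 powr c * integral {s..pi} (\<lambda>x. u 0 x * u n x)" for n
    proof -
      have "(\<lambda>m. e m * (\<integral>x\<in>{- cos s..1}. p m x * p n x * w x \<partial>lborel)) sums (\<integral>x\<in>{- cos s..1}. p 0 x * p n x
          * w x \<partial>lborel)"
        using sums_single[of 0 "\<lambda>m. \<integral>x\<in>{- cos s..1}. p m x * p n x * w x \<partial>lborel"]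
            by (simp add: e_def if_distrib[of "\<lambda>x. x * _"] cong: if_cong)
      then have "T n = (\<integral>x\<in>{- cos s..- cos pi}. p 0 x * p n x * w x \<partial>lborel)"
        unfolding T_def interval_mult_def by (simp add: sums_unique[symmetric])
      also have "\<dots> = 2 powr c * integral {s..pi} (\<lambda>x. u 0 x * u n x)"
          by (rule kernel_integral(1)) (use s in auto)
      finally show ?thesis .
    qed
    have u0: "u 0 s \<ge> 0"
      unfolding u_def jacobi_p_def jacobiP_0 using sqnorm_pos[of 0]
          by (intro mult_nonneg_nonneg rho_nonneg) auto
    \<comment> \<open>In \<open>kernel_offdiag\<close> against degree 0, \<open>lam 0\<close>,
      \<open>flux 0\<close> and the boundary terms at \<open>pi\<close> vanish, which leaves a
      single term at \<open>s\<close>.\<close>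
    have aT: "2 powr c * (u 0 s * \<bar>v (Suc n) s\<bar> / nu (Suc n)) = \<bar>T (Suc n)\<bar>" for n
    proof -
      have n: "nu (Suc n) > 0" by (rule nu_pos) simp
      have flux0: "flux 0 x = 0" for x by (simp add: flux_def dp_def jacobiP_0)
      have "lam (Suc n) * integral {s..pi} (\<lambda>x. u 0 x * u (Suc n) x) = - (u 0 s * flux (Suc n) s)"
        using kernel_offdiag[of s pi "Suc n" 0] s by (simp add: ends flux0 lam_def)
      then have "nu (Suc n) * (nu (Suc n) * integral {s..pi} (\<lambda>x. u 0 x * u (Suc n) x)) = nu (Suc n) * (- (u
          0 s * v (Suc n) s))"
        unfolding nu_sq[symmetric] flux_eq by (simp add: mult_ac)
      then have "nu (Suc n) * integral {s..pi} (\<lambda>x. u 0 x * u (Suc n) x) = - (u 0 s * v (Suc n) s)"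
        using n by (subst (asm) mult_left_cancel) auto
      then have "integral {s..pi} (\<lambda>x. u 0 x * u (Suc n) x) = - (u 0 s * v (Suc n) s) / nu (Suc n)"
        using n by (metis less_irrefl nonzero_mult_div_cancel_left)
      then show ?thesis using n u0 unfolding T by (simp add: abs_mult)
    qed
    have "in_lp 1 T \<and> lp_norm 1 T \<le> C * lp_norm 1 e" unfolding T_def
        by (rule C[OF e(1)]) (simp_all add: minus_le_iff)
    then have sT: "summable (\<lambda>n. \<bar>T n\<bar>)" and nT: "(\<Sum>n. \<bar>T n\<bar>) \<le> C"
      using e(2) by (auto simp: in_lp_def lp_norm_def suminf_nonneg)
    have "(\<Sum>n<M. \<bar>T (Suc n)\<bar>) \<le> (\<Sum>n<Suc M. \<bar>T n\<bar>)" unfolding sum.lessThan_Suc_shift by simp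
    also have "\<dots> \<le> (\<Sum>n. \<bar>T n\<bar>)" by (rule sum_le_suminf[OF sT]) auto
    finally show ?thesis using nT unfolding aT by (rule order_trans)
  qed
  \<comment> \<open>As \<open>v^2 \<le> D^2\<close>, the two end pieces of length
    \<open>\<delta>\<close> carry at most half of the square integral \<open>2 powr (- c)\<close>;
    \<open>\<delta> \<le> 1\<close> keeps the middle piece nondegenerate.\<close>
  define \<delta> where "\<delta> = min 1 (2 powr (- c) / (4 * D\<^sup>2))"
  have d: "0 < \<delta>" "\<delta> \<le> 1" "\<delta> \<le> 2 powr (- c) / (4 * D\<^sup>2)" using D(1) by (auto simp: \<delta>_def)
  have dd: "2 * \<delta> * D\<^sup>2 \<le> 2 powr (- c) / 2"
  proof -
    have "4 * D\<^sup>2 > 0" using D(1) by simp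
    then have "\<delta> * (4 * D\<^sup>2) \<le> 2 powr (- c)" using d(3) by (simp only: pos_le_divide_eq)
    then show ?thesis by simp
  qed
  have dpi: "\<delta> < pi - \<delta>" using d pi_gt3 by linarith
  let ?J = "{\<delta>..pi - \<delta>}"
  have J: "0 < x" "x < pi" if "x \<in> ?J" for x using that d by auto
  have cu: "continuous_on ?J (u n)" for n
    by (intro continuous_at_imp_continuous_on ballI DERIV_isCont[OF DERIV_u] J)
  have cv: "continuous_on ?J (v (Suc n))" for n
    unfolding v_def[abs_def] using nu_pos[of "Suc n"]
    by (intro continuous_intros continuous_on_subset[OF flux_continuous]) (use d in auto)
  \<comment> \<open>On the compact middle piece \<open>u 0\<close> has a positive minimum, by which
    the factor \<open>u 0 s\<close> can be divided out.\<close>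
  obtain s0 where s0: "s0 \<in> ?J" "\<And>s. s \<in> ?J \<Longrightarrow> u 0 s0 \<le> u 0 s"
    using continuous_attains_inf[OF compact_Icc _ cu[of 0]] dpi by auto
  define \<eta> where "\<eta> = u 0 s0"
  have eta: "\<eta> > 0"
    unfolding \<eta>_def u_def jacobi_p_def jacobiP_0 using sqnorm_pos[of 0] J[OF s0(1)]
        by (intro mult_pos_pos rho_pos) auto
  \<comment> \<open>The empty sum, \<open>M = 0\<close>, already gives the sign of
    \<open>C\<close>.\<close>
  have C0: "C \<ge> 0" using bound[of 0 0] pi_ge_zero by simp
  define K where "K = C / (2 powr c * \<eta>)"
  have b2: "(\<Sum>n<M. \<bar>v (Suc n) s\<bar> / nu (Suc n)) \<le> K" if s: "s \<in> ?J" for s M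
  proof -
    have "2 powr c * \<eta> * (\<Sum>n<M. \<bar>v (Suc n) s\<bar> / nu (Suc n)) = (\<Sum>n<M. 2 powr c * (\<eta> * \<bar>v (Suc n) s\<bar> / nu (Suc
        n)))"
      by (simp add: sum_distrib_left mult.assoc)
    also have "\<dots> \<le> (\<Sum>n<M. 2 powr c * (u 0 s * \<bar>v (Suc n) s\<bar> / nu (Suc n)))"
      using s0(2)[OF s] nu_nonneg
          by (intro sum_mono mult_left_mono divide_right_mono mult_right_mono) (auto simp: \<eta>_def)
    also have "\<dots> \<le> C" using J[OF s] by (intro bound) auto
    finally show ?thesis using eta by (simp add: K_def pos_le_divide_eq mult.commute)
  qed
  \<comment> \<open>\<open>v^2 \<le> D * \<bar>v\<bar>\<close> converts half of the square integral
    into a lower bound for the L^1 norm.\<close>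
  define L where "L = 2 powr (- c) / (2 * D)"
  have L: "L > 0" using D(1) by (simp add: L_def)
  have low: "L \<le> integral ?J (\<lambda>x. \<bar>v (Suc n) x\<bar>)" for n
  proof -
    let ?g = "\<lambda>x. (v (Suc n) x)\<^sup>2"
    have G: "(?g has_integral 2 powr (- c)) {0..pi}" by (rule v_square_integral) simp
    have gi: "?g integrable_on {a..b}" if "{a..b} \<subseteq> {0..pi}" for a b
      by (rule integrable_on_subinterval[OF has_integral_integrable[OF G] that])
    have gD: "?g x \<le> D\<^sup>2" if "0 \<le> x" "x \<le> pi" for x using D(3)[OF that, of "Suc n"] D(1)
        by (intro abs_le_square_iff[THEN iffD1, of "v (Suc n) x" D, simplified]) auto
    have "integral {0..pi} ?g = integral {0..\<delta>} ?g + integral ?J ?g + integral {pi - \<delta>..pi} ?g"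
      using Henstock_Kurzweil_Integration.integral_combine[of 0 \<delta> pi ?g]
          Henstock_Kurzweil_Integration.integral_combine[of \<delta> "pi - \<delta>" pi ?g] gi d dpi
      by simp
    moreover have "integral {0..\<delta>} ?g \<le> integral {0..\<delta>} (\<lambda>_. D\<^sup>2)"
      using d dpi by (intro integral_le gi) (auto intro!: gD)
    moreover have "integral {pi - \<delta>..pi} ?g \<le> integral {pi - \<delta>..pi} (\<lambda>_. D\<^sup>2)"
      using d dpi by (intro integral_le gi) (auto intro!: gD)
    moreover have "integral {0..\<delta>} (\<lambda>_. D\<^sup>2) + integral {pi - \<delta>..pi} (\<lambda>_. D\<^sup>2) = 2 * \<delta> * D\<^sup>2" using d by simp
    ultimately have "2 powr (- c) / 2 \<le> integral ?J ?g" using integral_unique[OF G] dd by linarith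
    also have "\<dots> \<le> integral ?J (\<lambda>x. D * \<bar>v (Suc n) x\<bar>)"
    proof (rule integral_le)
      show "(\<lambda>x. D * \<bar>v (Suc n) x\<bar>) integrable_on ?J" by (intro integrable_continuous_real continuous_intros cv)
      show "?g integrable_on ?J" using d by (intro gi) auto
      fix x assume x: "x \<in> ?J"
      have "\<bar>v (Suc n) x\<bar> * \<bar>v (Suc n) x\<bar> \<le> D * \<bar>v (Suc n) x\<bar>" using J[OF x] by (intro mult_right_mono D) auto
      then show "?g x \<le> D * \<bar>v (Suc n) x\<bar>" by (simp add: power2_eq_square)
    qed
    also have "\<dots> = D * integral ?J (\<lambda>x. \<bar>v (Suc n) x\<bar>)" by simp
    finally show ?thesis using D(1) by (simp add: L_def field_simps)
  qed
  \<comment> \<open>Integrating \<open>b2\<close> over \<open>?J\<close> bounds the sums of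
    \<open>L / nu (Suc n)\<close>, and \<open>nu (Suc n) \<le> (1 + c) * real (Suc n)\<close>
    compares them with the harmonic series.\<close>
  have "(\<Sum>n<M. 1 / real (Suc n)) \<le> (1 + c) * (K * pi) / L" for M
  proof -
    have "(\<Sum>n<M. L / nu (Suc n)) \<le> (\<Sum>n<M. integral ?J (\<lambda>x. \<bar>v (Suc n) x\<bar>) / nu (Suc n))"
      using low nu_nonneg by (intro sum_mono divide_right_mono) auto
    also have "\<dots> = integral ?J (\<lambda>x. \<Sum>n<M. \<bar>v (Suc n) x\<bar> / nu (Suc n))"
      using nu_pos by (subst integral_sum) (auto intro!: integrable_continuous_real continuous_intros cv
          simp: less_imp_neq[symmetric])
    also have "\<dots> \<le> integral ?J (\<lambda>x. K)"
      by (rule integral_le) (use nu_pos in \<open>auto intro!: integrable_continuous_real continuous_intros cv b2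
          simp: less_imp_neq[symmetric]\<close>)
    also have "\<dots> = K * (pi - 2 * \<delta>)" using dpi by simp
    also have "\<dots> \<le> K * pi" using C0 eta d by (intro mult_left_mono) (auto simp: K_def)
    finally have 1: "(\<Sum>n<M. L / nu (Suc n)) \<le> K * pi" .
    have "(\<Sum>n<M. 1 / real (Suc n)) \<le> (\<Sum>n<M. (1 + c) / L * (L / nu (Suc n)))"
    proof (intro sum_mono)
      fix n
      have "y / 2 \<le> y * 1" if "y \<ge> 0" for y :: real using that by simp
      from order_trans[OF nu_le add_left_mono[OF this[OF c_nonneg]]] have "nu (Suc n) \<le> real (Suc n) + c * 1" .
      also have "c * 1 \<le> c * real (Suc n)" using c_nonneg by (intro mult_left_mono) auto
      finally have "nu (Suc n) \<le> (1 + c) * real (Suc n)" by (simp add: algebra_simps)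
      then show "1 / real (Suc n) \<le> (1 + c) / L * (L / nu (Suc n))" using nu_pos[of "Suc n"] L
          by (simp add: divide_simps mult.commute)
    qed
    also have "\<dots> = (1 + c) / L * (\<Sum>n<M. L / nu (Suc n))" by (rule sum_distrib_left[symmetric])
    also have "\<dots> \<le> (1 + c) / L * (K * pi)" using 1 L c_nonneg by (intro mult_left_mono) auto
    finally show ?thesis by simp
  qed
  then have "summable (\<lambda>n. 1 / real (Suc n))" by (intro summableI_nonneg_bounded) auto
  then have "summable (\<lambda>n. inverse (of_nat (Suc n) :: real))" by (simp add: inverse_eq_divide)
  then have "summable (\<lambda>n. inverse (of_nat n) :: real)" by (subst (asm) summable_Suc_iff)
  then show False using not_summable_harmonic by blast
qed

end

theorem theorem1p2:
  fixes \<alpha> \<beta> p :: real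
  assumes "\<alpha> \<ge> -1/2" and "\<beta> \<ge> -1/2" and "1 \<le> p"
  shows "(\<exists>C. \<forall>f a b. in_lp p f \<and> -1 \<le> a \<and> a \<le> b \<and> b \<le> 1 \<longrightarrow>
              in_lp p (interval_mult \<alpha> \<beta> a b f) \<and>
              lp_norm p (interval_mult \<alpha> \<beta> a b f) \<le> C * lp_norm p f)
         \<longleftrightarrow> 1 < p"
proof -
  interpret jacobi_params \<alpha> \<beta> by unfold_locales (use assms in auto)
  show ?thesis
  proof
    assume L: "\<exists>C. \<forall>f a b. in_lp p f \<and> -1 \<le> a \<and> a \<le> b \<and> b \<le> 1 \<longrightarrow>
              in_lp p (interval_mult \<alpha> \<beta> a b f) \<and>
              lp_norm p (interval_mult \<alpha> \<beta> a b f) \<le> C * lp_norm p f"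
    show "1 < p"
    proof (rule ccontr)
      assume "\<not> 1 < p"
      then have "p = 1" using assms by simp
      then show False using L interval_mult_unbounded_l1 by simp
    qed
  qed (rule interval_mult_bounded)
qed

end
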